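(* Let $0<s<1$, $n\ge1$, $T>0$, and let $\mathcal U\subset\mathbb{R}^n$ be an arbitrary nonempty open set. Let $u\in\mathcal H^s(\mathbb{R}^{n+1})$ satisfy $u=\mathcal L^su=0$ in $(-T,T)\times\mathcal U$. Then $u(t,x)\equiv0$ for $(t,x)\in(-T,T)\times\mathbb{R}^n$.
   Context: Points of $\mathbb{R}^{n+1}$ are written $(t,x)$ with $t\in\mathbb{R}$, $x\in\mathbb{R}^n$. With the Fourier transform $\widehat u(\rho,\xi)=\int_{\mathbb{R}^{n+1}}e^{-i(t\rho+x\cdot\xi)}u(t,x)\,dt\,dx$, the operator $\mathcal L^s=(\partial_t-\Delta_x)^s$ is defined by $\widehat{\mathcal L^su}(\rho,\xi)=(i\rho+|\xi|^2)^s\widehat u(\rho,\xi)$ (principal branch). $\mathcal H^s(\mathbb{R}^{n+1})$ is the space of $u\in L^2(\mathbb{R}^{n+1})$ with $\int(1+|i\rho+|\xi|^2|)^s|\widehat u(\rho,\xi)|^2\,d\rho\,d\xi<\infty$. For $u\in\mathcal H^s(\mathbb{R}^{n+1})$, $\mathcal L^su$ is a tempered distribution, and "$\mathcal L^su=0$ in $(-T,T)\times\mathcal U$" is meant in the sense of distributions on this open set. *)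

theory Defs
  imports "HOL-Analysis.Analysis"
begin

text \<open>
  Elements of \<open>L\<^sup>2\<close> are represented by Borel functions, and equality of two of them on a set is
  equality almost everywhere on that set.
\<close>

definition square_integrable :: "('a::euclidean_space \<Rightarrow> complex) \<Rightarrow> bool" where
  "square_integrable f \<longleftrightarrow>
     f \<in> borel_measurable lborel \<and> integrable lborel (\<lambda>z. (cmod (f z))\<^sup>2)"

definition fourier :: "('a::euclidean_space \<Rightarrow> complex) \<Rightarrow> 'a \<Rightarrow> complex" where
  "fourier f \<zeta> = (LINT z|lborel. exp (- (\<i> * of_real (z \<bullet> \<zeta>))) * f z)"

definition inv_fourier :: "('a::euclidean_space \<Rightarrow> complex) \<Rightarrow> 'a \<Rightarrow> complex" where
  "inv_fourier f z =
     (LINT \<zeta>|lborel. exp (\<i> * of_real (z \<bullet> \<zeta>)) * f \<zeta>) / of_real ((2 * pi) ^ DIM('a))"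

text \<open>
  The Fourier integral need not converge for \<open>u \<in> L\<^sup>2\<close>. The Fourier--Plancherel transform is the
  limit in \<open>L\<^sup>2\<close> of the Fourier integrals over balls of increasing radius. By Plancherel's theorem
  it exists for every \<open>u \<in> L\<^sup>2\<close>, and it is unique up to null sets.
\<close>

definition has_fourier_L2 ::
    "('a::euclidean_space \<Rightarrow> complex) \<Rightarrow> ('a \<Rightarrow> complex) \<Rightarrow> bool" where
  "has_fourier_L2 u v \<longleftrightarrow> square_integrable u \<and> square_integrable v \<and>
     ((\<lambda>R::real. \<integral>\<^sup>+\<zeta>. ennreal ((cmod (fourier (\<lambda>z. indicator (cball 0 R) z * u z) \<zeta> - v \<zeta>))\<^sup>2) \<partial>lborel)
        \<longlongrightarrow> 0) at_top"

definition fourier_L2 :: "('a::euclidean_space \<Rightarrow> complex) \<Rightarrow> 'a \<Rightarrow> complex" where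
  "fourier_L2 u = (SOME v. has_fourier_L2 u v)"

definition heat_symbol :: "real \<times> (real ^ 'n) \<Rightarrow> complex" where
  "heat_symbol = (\<lambda>(\<rho>, \<xi>). \<i> * of_real \<rho> + of_real ((norm \<xi>)\<^sup>2))"

definition parabolic_sobolev :: "real \<Rightarrow> (real \<times> (real ^ 'n) \<Rightarrow> complex) set" where
  "parabolic_sobolev s = {u. square_integrable u \<and>
     (\<exists>v. has_fourier_L2 u v \<and>
        integrable lborel (\<lambda>\<zeta>. (1 + cmod (heat_symbol \<zeta>)) powr s * (cmod (v \<zeta>))\<^sup>2))}"

text \<open>
  A distribution is represented by its action on functions, with the bilinear pairing
  \<open>\<langle>f, \<phi>\<rangle> = \<integral> f \<phi>\<close>. The inverse Fourier transform of a tempered distribution \<open>W\<close> is given by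
  \<open>\<langle>F\<^sup>-\<^sup>1 W, \<phi>\<rangle> = \<langle>W, F\<^sup>-\<^sup>1 \<phi>\<rangle>\<close>. Only the values on Schwartz functions are meaningful.
\<close>

type_synonym 'a distribution = "('a \<Rightarrow> complex) \<Rightarrow> complex"

definition dist_of_fun :: "('a::euclidean_space \<Rightarrow> complex) \<Rightarrow> 'a distribution" where
  "dist_of_fun f \<phi> = (LINT z|lborel. f z * \<phi> z)"

definition inv_fourier_dist :: "'a::euclidean_space distribution \<Rightarrow> 'a distribution" where
  "inv_fourier_dist W \<phi> = W (inv_fourier \<phi>)"

definition frac_heat ::
    "real \<Rightarrow> (real \<times> (real ^ 'n) \<Rightarrow> complex) \<Rightarrow> (real \<times> (real ^ 'n)) distribution" where
  "frac_heat s u =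
     inv_fourier_dist (dist_of_fun (\<lambda>\<zeta>. heat_symbol \<zeta> powr of_real s * fourier_L2 u \<zeta>))"

primrec C_k :: "nat \<Rightarrow> ('a::euclidean_space \<Rightarrow> complex) \<Rightarrow> bool" where
  "C_k 0 f \<longleftrightarrow> continuous_on UNIV f"
| "C_k (Suc k) f \<longleftrightarrow> (\<forall>x. f differentiable (at x)) \<and>
     (\<forall>b\<in>Basis. C_k k (\<lambda>x. frechet_derivative f (at x) b))"

definition test_function :: "'a::euclidean_space set \<Rightarrow> ('a \<Rightarrow> complex) \<Rightarrow> bool" where
  "test_function \<Omega> \<phi> \<longleftrightarrow> (\<forall>k. C_k k \<phi>) \<and>
     compact (closure {z. \<phi> z \<noteq> 0}) \<and> closure {z. \<phi> z \<noteq> 0} \<subseteq> \<Omega>"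

definition dist_vanishes_on :: "'a::euclidean_space distribution \<Rightarrow> 'a set \<Rightarrow> bool" where
  "dist_vanishes_on D \<Omega> \<longleftrightarrow> (\<forall>\<phi>. test_function \<Omega> \<phi> \<longrightarrow> D \<phi> = 0)"

end

theory Submission
  imports Defs "HOL-Probability.Characteristic_Functions" "HOL-Probability.Sinc_Integral"
    "HOL-Complex_Analysis.Conformal_Mappings"
begin

text \<open>
  Let \<open>P\<^sub>\<tau>\<close> be the semigroup generated by \<open>- (\<partial>\<^sub>t - \<Delta>)\<close>, so that \<open>P\<^sub>\<tau> u (t, \<cdot>)\<close> is the
  Gaussian average of \<open>u (t - \<tau>, \<cdot>)\<close>. For a test function \<open>\<psi>\<close> on \<open>\<Omega> = (-T, T) \<times> U\<close> put
  \<open>a (1 / \<tau>) = \<langle>P\<^sub>\<tau> u, \<psi>\<rangle>\<close>. Since \<open>u = 0\<close> on \<open>\<Omega>\<close>, the Gaussian tail bound gives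
  \<open>a (\<eta>) = O (exp (- c \<eta>))\<close>. Writing the fractional power as an integral over the semigroup, the
  equation says \<open>\<integral> a (\<eta>) \<eta> powr (s - 1) d\<eta> = 0\<close>. Applied to \<open>(- \<partial>\<^sub>t - \<Delta>)^k \<psi>\<close> in place of \<open>\<psi>\<close>,
  it yields \<open>\<integral> a (\<eta>) \<eta> powr (s - 1 + k) d\<eta> = 0\<close> for all \<open>k\<close>. By the exponential decay all moments
  determine \<open>a\<close>, hence \<open>a = 0\<close>. So for every \<open>\<tau> > 0\<close> and almost every \<open>t\<close> in \<open>(-T, T)\<close> the Gaussian average of
  \<open>u (t - \<tau>, \<cdot>)\<close> vanishes on \<open>U\<close>. It is real analytic in space, so it vanishes everywhere, and
  the heat flow is injective: \<open>u (t - \<tau>, \<cdot>) = 0\<close>. Now let \<open>\<tau> \<rightarrow> 0\<close>.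
\<close>

subsection \<open>Gaussians and uniqueness of the Fourier transform\<close>

text \<open>Every operator is put on the test function. Since \<open>u\<close> is only square
  integrable, the semigroup and the symbol act on \<open>inv_fourier \<psi>\<close>, which is
  integrable and square integrable, and the bridge to \<open>u\<close> is the transposition rule
  \<open>has_fourier_L2_transfer\<close>. The adjoint heat operator keeps the support inside
  \<Omega>, so the order of the moment can be raised without asking any regularity of
  \<open>u\<close>. The variable \<eta> = 1 / \<tau> turns the Gaussian bound exp (- c / \<tau>)
  into exponential decay and negative powers of \<tau> into growing powers of \<eta>; exponential
  decay is what makes the moment problem determinate. The integral formula for the fractional power
  is plain scaling for real h > 0, but the symbol has the imaginary part \<rho>. Analytic
  continuation in the half-plane Re h > 0 covers the symbol off a null set. The semigroup smooths in
  space only: in t the averages are as rough as \<open>u\<close>. Hence unique continuation is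
  applied to single time slices, and what is learnt at time t concerns \<open>u\<close> at the
  earlier time t - \<tau>.\<close>

lemma integrable_prod_Basis:
  fixes f :: "'a::euclidean_space \<Rightarrow> real \<Rightarrow> complex"
  assumes "\<And>b. b \<in> Basis \<Longrightarrow> integrable lborel (f b)"
  shows "integrable lborel (\<lambda>x. \<Prod>b\<in>Basis. f b (x \<bullet> b))"
    and "(LINT x|lborel. (\<Prod>b\<in>Basis. f b (x \<bullet> b))) = (\<Prod>b\<in>Basis. LINT t|lborel. f b t)"
proof -
  interpret product_sigma_finite "\<lambda>_::'a. lborel :: real measure" ..
  have [measurable]: "\<And>b. b \<in> Basis \<Longrightarrow> f b \<in> borel_measurable borel"
    using assms by (auto dest: borel_measurable_integrable)
  have m: "(\<lambda>g. \<Sum>b\<in>Basis. g b *\<^sub>R b) \<in> measurable (\<Pi>\<^sub>M b\<in>(Basis::'a set). lborel) borel"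
    by measurable
  have fm: "(\<lambda>x. \<Prod>b\<in>Basis. f b (x \<bullet> b)) \<in> borel_measurable borel"
    by measurable
  have eq: "(\<Prod>b\<in>Basis. f b ((\<Sum>c\<in>Basis. g c *\<^sub>R c) \<bullet> b)) = (\<Prod>b\<in>Basis. f b (g b))" for g
    by (intro prod.cong refl) simp
  show "integrable lborel (\<lambda>x. \<Prod>b\<in>Basis. f b (x \<bullet> b))"
    unfolding lborel_eq[where 'a='a] using assms
    by (subst integrable_distr_eq[OF m fm]) (auto simp: eq intro!: product_integrable_prod)
  show "(LINT x|lborel. (\<Prod>b\<in>Basis. f b (x \<bullet> b))) = (\<Prod>b\<in>Basis. LINT t|lborel. f b t)"
    by (subst lborel_eq[where 'a='a], subst integral_distr[OF m fm])
       (simp add: eq product_integral_prod assms)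
qed

text \<open>With \<open>\<sigma>\<close> = sqrt (2 a), the substitution of
  \<open>\<sigma> * x\<close> turns the Gaussian into the standard normal density up to the factor
  sqrt (2 pi), so the formula is the characteristic function of the normal distribution at
  \<open>t / \<sigma>\<close>.\<close>

lemma gauss_fourier_real:
  fixes a t :: real
  assumes "a > 0"
  shows "integrable lborel (\<lambda>x. of_real (exp (- a * x\<^sup>2)) * exp (\<i> * of_real (x * t)))"
    and "(LINT x|lborel. of_real (exp (- a * x\<^sup>2)) * exp (\<i> * of_real (x * t)))
       = complex_of_real (sqrt (pi / a) * exp (- t\<^sup>2 / (4 * a)))"
proof -
  let ?g = "\<lambda>x::real. complex_of_real (exp (- a * x\<^sup>2)) * exp (\<i> * of_real (x * t))"
  define \<sigma> where "\<sigma> = sqrt (2 * a)"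
  have \<sigma>: "\<sigma> > 0" "\<sigma>\<^sup>2 = 2 * a" using assms by (auto simp: \<sigma>_def)
  have key: "std_normal_density (0 + \<sigma> * x) *\<^sub>R iexp ((t / \<sigma>) * (0 + \<sigma> * x))
      = of_real (1 / sqrt (2 * pi)) * (?g x)" for x
    using \<sigma> by (simp add: std_normal_density_def power_mult_distrib scaleR_conv_of_real field_simps)
  have int: "integrable lborel (\<lambda>x. std_normal_density x *\<^sub>R iexp ((t / \<sigma>) * x))"
    by (rule Bochner_Integration.integrable_bound[OF integrable_normal_density[of 1 0]])
       (auto simp: norm_mult normal_density_nonneg)
  have "integrable lborel (\<lambda>x. std_normal_density (0 + \<sigma> * x) *\<^sub>R iexp ((t / \<sigma>) * (0 + \<sigma> * x)))"
    by (rule lborel_integrable_real_affine[OF int]) (use \<sigma> in simp)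
  then have "integrable lborel (\<lambda>x. complex_of_real (sqrt (2 * pi)) * (of_real (1 / sqrt (2 * pi)) *
      (?g x)))"
    unfolding key by (rule integrable_mult_right)
  then show "integrable lborel (\<lambda>x. ?g x)"
    unfolding mult.assoc[symmetric, of "complex_of_real (sqrt (2 * pi))"] of_real_mult[symmetric] by simp
  have "complex_of_real (exp (- ((t / \<sigma>)\<^sup>2) / 2)) = char std_normal_distribution (t / \<sigma>)"
    by (simp add: char_std_normal_distribution)
  also have "\<dots> = (LINT x|lborel. std_normal_density x *\<^sub>R iexp ((t / \<sigma>) * x))"
    unfolding char_def by (subst integral_density) (auto simp: normal_density_nonneg)
  also have "\<dots> = \<bar>\<sigma>\<bar> *\<^sub>R (LINT x|lborel. std_normal_density (0 + \<sigma> * x) *\<^sub>R iexp ((t / \<sigma>) * (0 + \<sigma> * x)))"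
    using \<sigma> by (intro lborel_integral_real_affine) auto
  also have "\<dots> = of_real (\<sigma> / sqrt (2 * pi)) * (LINT x|lborel. ?g x)"
    unfolding key using \<sigma> by (simp add: scaleR_conv_of_real)
  finally have *: "of_real (\<sigma> / sqrt (2 * pi)) * (LINT x|lborel. ?g x)
     = complex_of_real (exp (- t\<^sup>2 / (4 * a)))"
    using \<sigma> by (simp add: power_divide)
  have "sqrt (2 * pi) / \<sigma> = sqrt (pi / a)"
    using assms by (simp add: \<sigma>_def real_sqrt_divide[symmetric])
  then show "(LINT x|lborel. ?g x)
       = complex_of_real (sqrt (pi / a) * exp (- t\<^sup>2 / (4 * a)))"
    using arg_cong[OF *, of "\<lambda>z. of_real (sqrt (2 * pi) / \<sigma>) * z"] \<sigma> assms by (simp add: field_simps)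
qed

lemma gauss_fourier:
  fixes \<xi> :: "'a::euclidean_space"
  assumes "a > 0"
  shows "integrable lborel (\<lambda>y::'a. of_real (exp (- a * (norm y)\<^sup>2)) * exp (\<i> * of_real (y \<bullet> \<xi>)))"
    and "(LINT y|lborel. of_real (exp (- a * (norm y)\<^sup>2)) * exp (\<i> * of_real (y \<bullet> \<xi>)))
       = complex_of_real (sqrt (pi / a) ^ DIM('a) * exp (- (norm \<xi>)\<^sup>2 / (4 * a)))"
proof -
  let ?g = "\<lambda>y::'a. complex_of_real (exp (- a * (norm y)\<^sup>2)) * exp (\<i> * of_real (y \<bullet> \<xi>))"
  let ?f = "\<lambda>b x. complex_of_real (exp (- a * x\<^sup>2)) * exp (\<i> * of_real (x * (\<xi> \<bullet> b)))"
  have n: "(norm y)\<^sup>2 = (\<Sum>b\<in>Basis. (y \<bullet> b)\<^sup>2)" for y :: 'a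
    unfolding power2_norm_eq_inner by (subst euclidean_inner) (simp add: power2_eq_square)
  have eq: "?g y = (\<Prod>b\<in>Basis. ?f b (y \<bullet> b))" for y
    unfolding n by (subst (2) euclidean_inner)
      (simp add: prod.distrib exp_sum sum_distrib_left sum_negf[symmetric] del: sum_negf flip: exp_of_real)
  have *: "integrable lborel (?f b)" for b
    by (rule gauss_fourier_real[OF assms])
  show "integrable lborel (\<lambda>y::'a. ?g y)"
    unfolding eq by (rule integrable_prod_Basis[OF *])
  show "(LINT y|lborel. ?g y)
       = complex_of_real (sqrt (pi / a) ^ DIM('a) * exp (- (norm \<xi>)\<^sup>2 / (4 * a)))"
    unfolding eq integrable_prod_Basis(2)[OF *] gauss_fourier_real(2)[OF assms] of_real_prod[symmetric]
    by (simp add: prod.distrib n exp_sum sum_divide_distrib sum_negf[symmetric] del: sum_negf)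
qed

text \<open>The fundamental solution of the heat equation at time \<open>\<tau>\<close>. The factor
  4 is the normalisation for the full Laplacian, with variance \<open>2 * \<tau>\<close> in each
  coordinate, so that the Fourier transform is exp (- \<tau> |\<xi>|^2).\<close>

definition heat_kernel :: "real \<Rightarrow> 'a::euclidean_space \<Rightarrow> real" where
  "heat_kernel \<tau> y = exp (- (norm y)\<^sup>2 / (4 * \<tau>)) / sqrt (4 * pi * \<tau>) ^ DIM('a)"

lemma heat_kernel_measurable [measurable]: "heat_kernel \<tau> \<in> borel_measurable borel"
  unfolding heat_kernel_def[abs_def] by measurable

lemma heat_kernel_nonneg: "\<tau> > 0 \<Longrightarrow> heat_kernel \<tau> y \<ge> 0"
  by (simp add: heat_kernel_def)

lemma heat_kernel_le: "\<tau> > 0 \<Longrightarrow> heat_kernel \<tau> (y :: 'a) \<le> 1 / sqrt (4 * pi * \<tau>) ^ DIM('a::euclidean_space)"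
  by (simp add: heat_kernel_def divide_right_mono)

lemma heat_kernel_minus [simp]: "heat_kernel \<tau> (- y) = heat_kernel \<tau> y"
  by (simp add: heat_kernel_def)

lemma heat_kernel_fourier:
  fixes \<xi> :: "'a::euclidean_space"
  assumes "\<tau> > 0"
  shows "(LINT y|lborel. of_real (heat_kernel \<tau> (y::'a)) * exp (\<i> * of_real (y \<bullet> \<xi>)))
       = of_real (exp (- \<tau> * (norm \<xi>)\<^sup>2))"
proof -
  let ?c = "sqrt (4 * pi * \<tau>) ^ DIM('a)"
  have c: "?c \<noteq> 0" using assms by simp
  have "(\<lambda>y::'a. of_real (heat_kernel \<tau> y) * exp (\<i> * of_real (y \<bullet> \<xi>)))
    = (\<lambda>y. of_real (1 / ?c) * (of_real (exp (- (1/(4*\<tau>)) * (norm y)\<^sup>2)) * exp (\<i> * of_real (y \<bullet> \<xi>))))"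
    by (auto simp: heat_kernel_def)
  then have "(LINT y|lborel. of_real (heat_kernel \<tau> (y::'a)) * exp (\<i> * of_real (y \<bullet> \<xi>)))
    = of_real (1 / ?c) * of_real (sqrt (pi / (1/(4*\<tau>))) ^ DIM('a) * exp (- (norm \<xi>)\<^sup>2 / (4 * (1/(4*\<tau>)))))"
    using gauss_fourier(2)[of "1/(4*\<tau>)" \<xi>] assms by (simp only: integral_mult_right_zero) simp
  also have "\<dots> = of_real ((1 / ?c) * (?c * exp (- \<tau> * (norm \<xi>)\<^sup>2)))"
    unfolding of_real_mult[symmetric] by (simp add: mult_ac)
  finally show ?thesis using c by simp
qed

lemma heat_kernel_integrable:
  assumes "\<tau> > 0" shows "integrable lborel (heat_kernel \<tau> :: 'a::euclidean_space \<Rightarrow> real)"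
proof -
  have "integrable lborel (\<lambda>y::'a. complex_of_real (exp (- (1/(4*\<tau>)) * (norm y)\<^sup>2)))"
    using gauss_fourier(1)[of "1/(4*\<tau>)" 0] assms by simp
  then have "integrable lborel (\<lambda>y::'a. (exp (- (1/(4*\<tau>)) * (norm y)\<^sup>2)))"
    using complex_of_real_integrable_eq by blast
  then have "integrable lborel (\<lambda>y::'a. (exp (- (1/(4*\<tau>)) * (norm y)\<^sup>2)) / sqrt (4 * pi * \<tau>) ^ DIM('a))"
    by (rule integrable_divide)
  then show ?thesis by (simp add: heat_kernel_def[abs_def])
qed

lemma heat_kernel_integral:
  assumes "\<tau> > 0" shows "(LINT y|lborel. heat_kernel \<tau> (y::'a::euclidean_space)) = 1"
proof -
  have "complex_of_real (LINT y|lborel. heat_kernel \<tau> (y::'a)) = (LINT y|lborel. of_real (heat_kernel \<tau> (y::'a)))"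
    by simp
  also have "\<dots> = 1" using heat_kernel_fourier[OF assms, of 0] by simp
  finally show ?thesis by (simp only: of_real_eq_1_iff)
qed

text \<open>Half of the exponent is spent on the bound \<open>norm y \<ge> \<delta>\<close>. The
  other half is the heat kernel at time \<open>2 * \<tau>\<close>, which has total mass 1; the
  different normalisations account for the power of sqrt 2.\<close>

lemma heat_kernel_tail:
  assumes "\<tau> > 0" "\<delta> > 0"
  shows "(LINT y|lborel. indicator {y. norm y \<ge> \<delta>} y * heat_kernel \<tau> (y::'a::euclidean_space))
     \<le> sqrt 2 ^ DIM('a) * exp (- \<delta>\<^sup>2 / (8 * \<tau>))"
proof -
  let ?c = "sqrt 2 ^ DIM('a) * exp (- \<delta>\<^sup>2 / (8 * \<tau>))"
  have le: "indicator {y. norm y \<ge> \<delta>} y * heat_kernel \<tau> y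
     \<le> ?c * heat_kernel (2 * \<tau>) y" for y :: 'a
  proof (cases "norm y \<ge> \<delta>")
    case True
    then have "\<delta>\<^sup>2 \<le> (norm y)\<^sup>2" using assms by (intro power_mono) auto
    then have "- (norm y)\<^sup>2 / (4 * \<tau>) \<le> - \<delta>\<^sup>2 / (8 * \<tau>) + - (norm y)\<^sup>2 / (8 * \<tau>)"
      using assms by (simp add: field_simps)
    then have e: "exp (- (norm y)\<^sup>2 / (4 * \<tau>)) \<le> exp (- \<delta>\<^sup>2 / (8 * \<tau>)) * exp (- (norm y)\<^sup>2 / (8 * \<tau>))"
      by (simp flip: exp_add)
    have s: "sqrt (8 * pi * \<tau>) ^ DIM('a) = sqrt 2 ^ DIM('a) * sqrt (4 * pi * \<tau>) ^ DIM('a)"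
      by (simp only: power_mult_distrib[symmetric] real_sqrt_mult[symmetric]) (simp add: mult.assoc)
    have "?c * heat_kernel (2 * \<tau>) y
      = exp (- \<delta>\<^sup>2 / (8 * \<tau>)) * exp (- (norm y)\<^sup>2 / (8 * \<tau>)) / sqrt (4 * pi * \<tau>) ^ DIM('a)"
      unfolding heat_kernel_def using s by (simp add: mult_ac)
    then show ?thesis using True e assms by (simp add: heat_kernel_def divide_right_mono)
  qed (use assms in \<open>simp add: heat_kernel_nonneg\<close>)
  have "(LINT y|lborel. indicator {y. norm y \<ge> \<delta>} y * heat_kernel \<tau> (y::'a))
     \<le> (LINT y|lborel. ?c * heat_kernel (2 * \<tau>) (y::'a))"
  proof (rule integral_mono)
    show "integrable lborel (\<lambda>y::'a. indicator {y. norm y \<ge> \<delta>} y * heat_kernel \<tau> y)"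
      by (rule Bochner_Integration.integrable_bound[OF heat_kernel_integrable[OF assms(1)]])
         (auto split: split_indicator)
    show "integrable lborel (\<lambda>y::'a. ?c * heat_kernel (2 * \<tau>) y)"
      using assms by (intro integrable_mult_right heat_kernel_integrable) auto
  qed (rule le)
  also have "\<dots> = ?c"
    using heat_kernel_integral[of "2 * \<tau>", where 'a='a] assms by simp
  finally show ?thesis .
qed

lemma heat_kernel_tail_integrable:
  "\<tau> > 0 \<Longrightarrow> integrable lborel (\<lambda>y::'a::euclidean_space. indicator {y. norm y \<ge> \<delta>} y * heat_kernel \<tau> y)"
  by (rule Bochner_Integration.integrable_bound[OF heat_kernel_integrable]) (auto split: split_indicator)

text \<open>The heat kernel is an approximate identity: continuity at \<open>z\<close> controls the
  displacements shorter than \<open>d\<close>, and the Gaussian tail the others. Continuity at the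
  single point \<open>z\<close> is the form that suits the indicator of a box.\<close>

lemma heat_kernel_approx:
  fixes f :: "'a::euclidean_space \<Rightarrow> complex"
  assumes [measurable]: "f \<in> borel_measurable borel" and M: "\<And>y. cmod (f y) \<le> M"
    and cont: "isCont f z"
  shows "((\<lambda>\<epsilon>. LINT y|lborel. of_real (heat_kernel \<epsilon> y) * f (z + y)) \<longlongrightarrow> f z) (at_right 0)"
proof (rule tendstoI)
  fix e :: real assume e: "e > 0"
  obtain d where d: "d > 0" and fd: "\<And>y. norm y < d \<Longrightarrow> cmod (f (z + y) - f z) < e / 2"
  proof -
    obtain d where "d > 0" "\<And>x. x \<noteq> z \<Longrightarrow> norm (x - z) < d \<Longrightarrow> norm (f x - f z) < e / 2"
      using cont e unfolding isCont_def LIM_def dist_norm by (meson half_gt_zero)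
    then have "norm y < d \<Longrightarrow> cmod (f (z + y) - f z) < e / 2" for y
      using e by (cases "y = 0") auto
    then show thesis using that \<open>d > 0\<close> by blast
  qed
  have M0: "M \<ge> 0" using M[of 0] norm_ge_zero order_trans by blast
  have "((\<lambda>\<epsilon>. 2 * M * (sqrt 2 ^ DIM('a) * exp (- d\<^sup>2 / (8 * \<epsilon>)))) \<longlongrightarrow> 2 * M * (sqrt 2 ^ DIM('a) * 0)) (at_right 0)"
  proof (intro tendsto_intros filterlim_compose[OF exp_at_bot])
    have "filterlim (\<lambda>\<epsilon>. inverse \<epsilon> :: real) at_top (at_right 0)"
      by (rule filterlim_inverse_at_top_right)
    then have "filterlim (\<lambda>\<epsilon>. - d\<^sup>2 / 8 * inverse \<epsilon>) at_bot (at_right 0)"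
      by (intro filterlim_tendsto_neg_mult_at_bot[OF tendsto_const]) (use d in auto)
    then show "filterlim (\<lambda>\<epsilon>. - d\<^sup>2 / (8 * \<epsilon>)) at_bot (at_right 0)"
      by (simp add: field_simps)
  qed
  then have "\<forall>\<^sub>F \<epsilon> in at_right 0. 2 * M * (sqrt 2 ^ DIM('a) * exp (- d\<^sup>2 / (8 * \<epsilon>))) < e / 2"
    by (rule order_tendstoD) (use e in simp)
  moreover have "\<forall>\<^sub>F \<epsilon> in at_right 0. (\<epsilon>::real) > 0"
    by (simp add: eventually_at_right_less)
  ultimately show "\<forall>\<^sub>F \<epsilon> in at_right 0. dist (LINT y|lborel. of_real (heat_kernel \<epsilon> y) * f (z + y)) (f z) < e"
  proof eventually_elim
    case (elim \<epsilon>)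
    note hi = heat_kernel_integrable[OF elim(2), where 'a='a]
    have i1: "integrable lborel (\<lambda>y::'a. of_real (heat_kernel \<epsilon> y) * f (z + y))"
      by (rule Bochner_Integration.integrable_bound[OF integrable_mult_right[OF hi, of M]])
         (auto simp: norm_mult heat_kernel_nonneg elim M M0 abs_mult mult.commute[of M] intro!: mult_left_mono)
    have i2: "integrable lborel (\<lambda>y::'a. of_real (heat_kernel \<epsilon> y) * f z)"
      using hi by simp
    have "(LINT y|lborel. of_real (heat_kernel \<epsilon> y) * f (z + y)) - f z
       = (LINT y|lborel. of_real (heat_kernel \<epsilon> y) * (f (z + y) - f z))"
      using i1 i2 heat_kernel_integral[OF elim(2), where 'a='a] by (simp add: right_diff_distrib)
    also have "cmod \<dots> \<le> (LINT y|lborel. e / 2 * heat_kernel \<epsilon> (y::'a)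
         + 2 * M * (indicator {y. norm y \<ge> d} y * heat_kernel \<epsilon> y))"
    proof (rule Bochner_Integration.integral_norm_bound_integral)
      show "integrable lborel (\<lambda>y. of_real (heat_kernel \<epsilon> y) * (f (z + y) - f z))"
        using i1 i2 by (simp add: right_diff_distrib)
      show "integrable lborel (\<lambda>y::'a. e / 2 * heat_kernel \<epsilon> (y::'a)
         + 2 * M * (indicator {y. norm y \<ge> d} y * heat_kernel \<epsilon> y))"
        by (intro Bochner_Integration.integrable_add integrable_mult_right hi heat_kernel_tail_integrable elim)
      fix y :: 'a
      have h: "heat_kernel \<epsilon> y \<ge> 0" by (rule heat_kernel_nonneg[OF elim(2)])
      show "cmod (of_real (heat_kernel \<epsilon> y) * (f (z + y) - f z)) \<le> e / 2 * heat_kernel \<epsilon> (y::'a)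
         + 2 * M * (indicator {y. norm y \<ge> d} y * heat_kernel \<epsilon> y)"
      proof (cases "norm y < d")
        case True
        then show ?thesis using mult_right_mono[OF less_imp_le[OF fd[OF True]] h] h by (simp add: norm_mult mult.commute)
      next
        case False
        have "cmod (f (z + y) - f z) \<le> 2 * M"
          using norm_triangle_ineq4[of "f (z+y)" "f z"] M[of "z+y"] M[of z] by linarith
        then have "heat_kernel \<epsilon> y * cmod (f (z + y) - f z) \<le> heat_kernel \<epsilon> y * (2 * M)"
          using h by (rule mult_left_mono)
        moreover have "e / 2 * heat_kernel \<epsilon> y \<ge> 0" using e h by simp
        ultimately show ?thesis using False h by (simp add: norm_mult mult_ac)
      qed
    qed
    also have "\<dots> = e / 2 + 2 * M * (LINT y|lborel. indicator {y. norm y \<ge> d} y * heat_kernel \<epsilon> (y::'a))"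
      using hi heat_kernel_tail_integrable[OF elim(2), of d, where 'a='a]
        heat_kernel_integral[OF elim(2), where 'a='a] by simp
    also have "\<dots> \<le> e / 2 + 2 * M * (sqrt 2 ^ DIM('a) * exp (- d\<^sup>2 / (8 * \<epsilon>)))"
      using M0 heat_kernel_tail[OF elim(2) d, where 'a='a] by (intro add_left_mono mult_left_mono) auto
    also have "\<dots> < e" using elim(1) by simp
    finally show ?case by (simp add: dist_norm)
  qed
qed

text \<open>The measures with the positive and the negative part as density agree on boxes and are
  finite there. Boxes form an intersection-stable generator of the Borel sets, so the measures
  coincide, and so do the densities almost everywhere.\<close>

lemma AE_zero_if_box_integrals_zero:
  fixes f :: "'a::euclidean_space \<Rightarrow> real"
  assumes f: "integrable lborel f"
    and zero: "\<And>a b. (LINT x|lborel. indicator (box a b) x * f x) = 0"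
  shows "AE x in lborel. f x = 0"
proof -
  have [measurable]: "f \<in> borel_measurable borel" using f by auto
  let ?P = "density lborel (\<lambda>x. ennreal (f x))" and ?N = "density lborel (\<lambda>x. ennreal (- f x))"
  have em: "emeasure (density lborel (\<lambda>x. ennreal (g x))) (box a b)
      = ennreal (LINT x|lborel. indicator (box a b) x * max 0 (g x))"
    if g: "integrable lborel g" for g :: "'a \<Rightarrow> real" and a b
  proof -
    have [measurable]: "g \<in> borel_measurable borel" using g by auto
    have "emeasure (density lborel (\<lambda>x. ennreal (g x))) (box a b)
      = (\<integral>\<^sup>+x. ennreal (indicator (box a b) x * max 0 (g x)) \<partial>lborel)"
      by (subst emeasure_density) (auto intro!: nn_integral_cong split: split_indicator simp: ennreal_neg max_def)
    also have "\<dots> = ennreal (LINT x|lborel. indicator (box a b) x * max 0 (g x))"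
      by (rule nn_integral_eq_integral, rule Bochner_Integration.integrable_bound[OF g])
         (auto split: split_indicator)
    finally show ?thesis .
  qed
  have eq: "emeasure ?P (box a b) = emeasure ?N (box a b)" for a b
  proof -
    have i: "integrable lborel (\<lambda>x. indicator (box a b) x * max 0 (f x))"
            "integrable lborel (\<lambda>x. indicator (box a b) x * max 0 (- f x))"
      by (rule Bochner_Integration.integrable_bound[OF f], auto split: split_indicator)+
    have "(LINT x|lborel. indicator (box a b) x * max 0 (f x)) - (LINT x|lborel. indicator (box a b) x * max 0 (- f x))
      = (LINT x|lborel. indicator (box a b) x * f x)"
      by (subst Bochner_Integration.integral_diff[symmetric, OF i])
         (auto intro!: Bochner_Integration.integral_cong simp: max_def split: split_indicator)
    then show ?thesis unfolding em[OF f] em[OF integrable_minus[OF f]] zero by simp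
  qed
  have fin: "emeasure ?P (box a b) \<noteq> \<infinity>" for a b by (simp add: em[OF f])
  have "?P = ?N"
  proof (rule measure_eqI_generator_eq)
    let ?E = "range (\<lambda>(a, b). box a b::'a set)"
    let ?A = "\<lambda>n::nat. box (- (real n *\<^sub>R One)) (real n *\<^sub>R One) :: 'a set"
    show "Int_stable ?E" by (auto simp: Int_stable_def box_Int_box)
    show "?E \<subseteq> Pow UNIV" "sets ?P = sigma_sets UNIV ?E" "sets ?N = sigma_sets UNIV ?E"
      by (simp_all add: borel_eq_box)
    show "range ?A \<subseteq> ?E" "(\<Union>i. ?A i) = UNIV" unfolding UN_box_eq_UNIV by auto
    show "emeasure ?P (?A i) \<noteq> \<infinity>" for i by (rule fin)
    show "emeasure ?P X = emeasure ?N X" if "X \<in> ?E" for X using that eq by auto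
  qed
  \<comment> \<open>\<open>ennreal\<close> sends negative numbers to 0, so one of the two sides is
    always 0; equality then forces \<open>f x = 0\<close>.\<close>
  then have "AE x in lborel. ennreal (f x) = ennreal (- f x)"
    by (intro sigma_finite_measure.density_unique[OF lborel.sigma_finite_measure_axioms]) auto
  then show ?thesis
  proof eventually_elim
    case (elim x) then show ?case by (cases "f x \<ge> 0"; cases "f x = 0") (auto simp: ennreal_neg)
  qed
qed

text \<open>By Lindelof, countably many boxes with closure in \<open>\<Omega>\<close> cover it, and
  the function cut off to one of them is globally integrable. Integrability is asked only on such
  boxes because a Gaussian average of a square integrable function need not be integrable.\<close>

lemma AE_zero_on_open_if_box_integrals_zero:
  fixes f :: "'a::euclidean_space \<Rightarrow> complex"
  assumes "open \<Omega>"
    and f: "\<And>a b. cbox a b \<subseteq> \<Omega> \<Longrightarrow> integrable lborel (\<lambda>x. indicator (box a b) x * f x)"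
    and zero: "\<And>a b. cbox a b \<subseteq> \<Omega> \<Longrightarrow> (LINT x|lborel. indicator (box a b) x * f x) = 0"
  shows "AE x in lborel. x \<in> \<Omega> \<longrightarrow> f x = 0"
proof -
  define F where "F = {box a b | a b. cbox a b \<subseteq> \<Omega>}"
  obtain F' where F': "F' \<subseteq> F" "countable F'" "\<Union>F' = \<Union>F"
    by (rule Lindelof[of F]) (auto simp: F_def)
  have "\<Union>F = \<Omega>"
  proof
    show "\<Union>F \<subseteq> \<Omega>" using box_subset_cbox by (fastforce simp: F_def)
    show "\<Omega> \<subseteq> \<Union>F"
    proof
      fix x assume "x \<in> \<Omega>"
      then obtain e where e: "e > 0" "cball x e \<subseteq> \<Omega>" using assms(1) open_contains_cball by blast
      obtain a b where "x \<in> box a b" "box a b \<subseteq> ball x e" using rational_boxes[OF e(1), of x] by blast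
      moreover from this have "closure (box a b) \<subseteq> cball x e" 
        by (metis closure_minimal closed_cball ball_subset_cball order_trans)
      moreover have "closure (box a b) = cbox a b" using \<open>x \<in> box a b\<close> closure_box by blast
      ultimately have "cbox a b \<subseteq> \<Omega>" using e(2) by auto
      then show "x \<in> \<Union>F" using \<open>x \<in> box a b\<close> by (auto simp: F_def)
    qed
  qed
  have "AE x in lborel. \<forall>X\<in>F'. x \<in> X \<longrightarrow> f x = 0"
  proof (subst AE_ball_countable[OF F'(2)], intro ballI)
    fix X assume "X \<in> F'"
    then obtain a b where X: "X = box a b" and ab: "cbox a b \<subseteq> \<Omega>" using F'(1) by (auto simp: F_def)
    note i = f[OF ab]
    have sub: "LINT x|lborel. indicator (box c d) x * (indicator (box a b) x * f x) = 0" for c d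
    proof -
      \<comment> \<open>Two boxes meet in a box whose closed version still lies in
        \<open>cbox a b\<close>, so \<open>zero\<close> applies to the intersection.\<close>
      let ?l = "\<Sum>i\<in>Basis. max (a\<bullet>i) (c\<bullet>i) *\<^sub>R i" and ?u = "\<Sum>i\<in>Basis. min (b\<bullet>i) (d\<bullet>i) *\<^sub>R i"
      have "box ?l ?u = box a b \<inter> box c d" by (simp add: box_Int_box)
      moreover have "cbox ?l ?u \<subseteq> cbox a b" by (auto simp: mem_box)
      ultimately have "(LINT x|lborel. indicator (box a b \<inter> box c d) x * f x) = 0"
        using zero[of ?l ?u] ab by auto
      then show ?thesis by (simp add: indicator_inter_arith mult_ac)
    qed
    have part: "AE x in lborel. g (indicator (box a b) x * f x) = 0" if g: "bounded_linear g" for g :: "complex \<Rightarrow> real"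
    proof (rule AE_zero_if_box_integrals_zero)
      show "integrable lborel (\<lambda>x. g (indicator (box a b) x * f x))" by (rule integrable_bounded_linear[OF g i])
      fix c d
      have j: "integrable lborel (\<lambda>x. indicator (box c d) x * (indicator (box a b) x * f x))"
        using i by (rule Bochner_Integration.integrable_bound) (use borel_measurable_integrable[OF i] in \<open>auto split: split_indicator\<close>)
      have "(LINT x|lborel. indicator (box c d) x * g (indicator (box a b) x * f x))
        = (LINT x|lborel. g (indicator (box c d) x * (indicator (box a b) x * f x)))"
        using linear_0[OF bounded_linear.linear[OF g]]
        by (intro Bochner_Integration.integral_cong refl) (simp add: indicator_def)
      then show "(LINT x|lborel. indicator (box c d) x * g (indicator (box a b) x * f x)) = 0"
        using integral_bounded_linear[OF g j] sub linear_0[OF bounded_linear.linear[OF g]] by simp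
    qed
    from part[OF bounded_linear_Re] part[OF bounded_linear_Im]
    show "AE x in lborel. x \<in> X \<longrightarrow> f x = 0"
      by eventually_elim (auto simp: X complex_eq_iff)
  qed
  then show ?thesis
  proof eventually_elim
    case (elim x) then show ?case using \<open>\<Union>F = \<Omega>\<close> F'(3) by auto
  qed
qed

section \<open>Translation, reflection and exchange of integrals for Lebesgue measure\<close>

lemma lborel_integral_translate:
  fixes f :: "'a::euclidean_space \<Rightarrow> 'b::{banach, second_countable_topology}"
  assumes [measurable]: "f \<in> borel_measurable borel"
  shows "(LINT y|lborel. f (z + y)) = (LINT y|lborel. f y)"
proof -
  have "(LINT y|lborel. f y) = (LINT y|distr lborel borel ((+) z). f y)"
    by (simp add: lborel_distr_plus)
  also have "\<dots> = (LINT y|lborel. f (z + y))"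
    by (intro integral_distr) auto
  finally show ?thesis ..
qed

lemma lborel_integrable_translate:
  fixes f :: "'a::euclidean_space \<Rightarrow> 'b::{banach, second_countable_topology}"
  assumes "integrable lborel f"
  shows "integrable lborel (\<lambda>y. f (z + y))"
proof -
  have "integrable (distr lborel borel ((+) z)) f" using assms by (simp add: lborel_distr_plus)
  then show ?thesis by (subst (asm) integrable_distr_eq) (use assms in auto)
qed

lemma lborel_distr_uminus_euclidean: "distr lborel borel uminus = (lborel :: 'a::euclidean_space measure)"
  using lborel_affine[of "-1" "0::'a"] by (simp add: density_1)

lemma lborel_integral_reflect:
  fixes f :: "'a::euclidean_space \<Rightarrow> 'b::{banach, second_countable_topology}"
  assumes [measurable]: "f \<in> borel_measurable borel"
  shows "(LINT y|lborel. f (z - y)) = (LINT y|lborel. f y)"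
proof -
  have "(LINT y|lborel. f (z - y)) = (LINT y|distr lborel borel uminus. f (z + y))"
    by (subst integral_distr) auto
  then show ?thesis by (simp add: lborel_distr_uminus_euclidean lborel_integral_translate)
qed

text \<open>A majorant of product form justifies most exchanges of integrals below. The norms around
  \<open>g\<close> and \<open>h\<close> spare the callers a sign condition.\<close>

lemma fubini_integrable_bound:
  fixes f :: "'a \<times> 'b \<Rightarrow> complex"
  assumes "sigma_finite_measure M1" "sigma_finite_measure M2"
    and f: "f \<in> borel_measurable (M1 \<Otimes>\<^sub>M M2)"
    and g: "integrable M1 g" and h: "integrable M2 h"
    and bound: "\<And>x y. cmod (f (x, y)) \<le> norm (g x :: real) * norm (h y :: real)"
  shows "integrable (M1 \<Otimes>\<^sub>M M2) f"
proof -
  interpret pair_sigma_finite M1 M2 using assms(1,2) by (simp add: pair_sigma_finite_def)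
  have [measurable]: "g \<in> borel_measurable M1" "h \<in> borel_measurable M2" using g h by auto
  have "integrable (M1 \<Otimes>\<^sub>M M2) (\<lambda>(x, y). g x * h y)"
  proof (rule Fubini_integrable)
    show "AE x in M1. integrable M2 (\<lambda>y. case (x, y) of (x, y) \<Rightarrow> g x * h y)"
      using h by simp
    have "integrable M1 (\<lambda>x. norm (g x) * (LINT y|M2. norm (h y)))"
      using g by (intro integrable_mult_left integrable_norm)
    then show "integrable M1 (\<lambda>x. LINT y|M2. norm (case (x, y) of (x, y) \<Rightarrow> g x * h y))"
      by (simp add: abs_mult)
  qed simp
  then show ?thesis
    by (rule Bochner_Integration.integrable_bound) (use f bound in \<open>auto simp: abs_mult\<close>)
qed

text \<open>The Gaussian factor makes the inversion integral absolutely convergent, so the integrals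
  may be exchanged. The transform of the factor is the heat kernel at time \<open>\<epsilon>\<close>
  up to the constant sqrt (pi / \<epsilon>) * sqrt (4 pi \<epsilon>) = 2 pi per dimension. Both
  uniqueness for integrable functions and inversion for test functions follow by letting
  \<open>\<epsilon>\<close> tend to 0.\<close>

lemma gauss_damped_inversion:
  fixes H :: "'a::euclidean_space \<Rightarrow> complex"
  assumes H: "integrable lborel H" and \<epsilon>: "\<epsilon> > 0"
  shows "(LINT \<zeta>|lborel. of_real (exp (- \<epsilon> * (norm \<zeta>)\<^sup>2)) * exp (- (\<i> * of_real (\<zeta> \<bullet> w)))
            * (LINT z|lborel. exp (\<i> * of_real (z \<bullet> \<zeta>)) * H z))
       = of_real ((2 * pi) ^ DIM('a)) * (LINT z|lborel. H z * of_real (heat_kernel \<epsilon> (w - z)))"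
proof -
  have [measurable]: "H \<in> borel_measurable borel" using H by auto
  let ?e = "\<lambda>\<zeta>::'a. complex_of_real (exp (- \<epsilon> * (norm \<zeta>)\<^sup>2))"
  define C where "C = sqrt (pi / \<epsilon>) ^ DIM('a) * sqrt (4 * pi * \<epsilon>) ^ DIM('a)"
  have C: "C = (2 * pi) ^ DIM('a)"
  proof -
    have "sqrt (pi / \<epsilon>) * sqrt (4 * pi * \<epsilon>) = sqrt ((2 * pi)\<^sup>2)"
      unfolding real_sqrt_mult[symmetric] using \<epsilon> by (simp add: power2_eq_square)
    also have "\<dots> = 2 * pi" by (simp only: real_sqrt_abs) simp
    finally show ?thesis unfolding C_def power_mult_distrib[symmetric] by simp
  qed
  have g: "(LINT \<zeta>|lborel. ?e \<zeta> * exp (\<i> * of_real (\<zeta> \<bullet> (z - w)))) = of_real C * of_real (heat_kernel \<epsilon> (w - z))" for z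
    using \<epsilon> unfolding gauss_fourier(2)[OF \<epsilon>] of_real_mult[symmetric]
    by (simp add: C_def heat_kernel_def norm_minus_commute)
  have ei: "integrable lborel (\<lambda>\<zeta>::'a. exp (- \<epsilon> * (norm \<zeta>)\<^sup>2))"
    using gauss_fourier(1)[OF \<epsilon>, of 0, THEN integrable_norm] by (simp add: norm_mult)
  have "of_real C * (LINT z|lborel. H z * of_real (heat_kernel \<epsilon> (w - z)))
      = (LINT z|lborel. (LINT \<zeta>|lborel. H z * (?e \<zeta> * exp (\<i> * of_real (\<zeta> \<bullet> (z - w))))))"
    by (simp only: integral_mult_right_zero g mult.left_commute[of "H _" "of_real C"])
  also have "\<dots> = (LINT \<zeta>|lborel. (LINT z|lborel. H z * (?e \<zeta> * exp (\<i> * of_real (\<zeta> \<bullet> (z - w))))))"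
  proof (rule lborel_pair.Fubini_integral[symmetric], rule fubini_integrable_bound)
    show "integrable lborel (\<lambda>z. cmod (H z))" using H by simp
    show "cmod (case (z, \<zeta>) of (z, \<zeta>) \<Rightarrow> H z * (?e \<zeta> * exp (\<i> * of_real (\<zeta> \<bullet> (z - w)))))
      \<le> norm (cmod (H z)) * norm (exp (- \<epsilon> * (norm \<zeta>)\<^sup>2))" for z \<zeta>
      by (simp add: norm_mult)
  qed (use ei in \<open>auto intro: lborel.sigma_finite_measure_axioms\<close>)
  also have "\<dots> = (LINT \<zeta>|lborel. ?e \<zeta> * exp (- (\<i> * of_real (\<zeta> \<bullet> w))) * (LINT z|lborel. exp (\<i> * of_real (z \<bullet> \<zeta>)) * H z))"
  proof (intro Bochner_Integration.integral_cong refl)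
    fix \<zeta> :: 'a
    have "H z * (?e \<zeta> * exp (\<i> * of_real (\<zeta> \<bullet> (z - w))))
      = ?e \<zeta> * exp (- (\<i> * of_real (\<zeta> \<bullet> w))) * (exp (\<i> * of_real (z \<bullet> \<zeta>)) * H z)" for z
      by (simp add: inner_diff_right exp_add[symmetric] inner_commute algebra_simps exp_diff exp_minus field_simps)
    then show "(LINT z|lborel. H z * (?e \<zeta> * exp (\<i> * of_real (\<zeta> \<bullet> (z - w)))))
     = ?e \<zeta> * exp (- (\<i> * of_real (\<zeta> \<bullet> w))) * (LINT z|lborel. exp (\<i> * of_real (z \<bullet> \<zeta>)) * H z)"
      by (simp only: integral_mult_right_zero)
  qed
  finally show ?thesis unfolding C ..
qed

text \<open>By the damped inversion formula all Gaussian averages of \<open>H\<close> vanish. Fubini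
  moves the averaging onto the indicator of a box, and \<open>\<epsilon>\<close> tending to 0 shows
  that \<open>H\<close> has integral 0 over every box.\<close>

lemma fourier_L1_unique:
  fixes H :: "'a::euclidean_space \<Rightarrow> complex"
  assumes H: "integrable lborel H"
    and zero: "\<And>\<zeta>. (LINT z|lborel. exp (\<i> * of_real (z \<bullet> \<zeta>)) * H z) = 0"
  shows "AE z in lborel. H z = 0"
proof -
  have [measurable]: "H \<in> borel_measurable borel" using H by auto
  have conv: "(LINT z|lborel. H z * of_real (heat_kernel \<epsilon> (w - z))) = 0" if \<epsilon>: "\<epsilon> > 0" for \<epsilon> and w :: 'a
    using gauss_damped_inversion[OF H \<epsilon>, of w] by (simp add: zero)
  have box0: "(LINT z|lborel. indicator (box a b) z * H z) = 0" for a b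
  proof -
    let ?B = "\<lambda>w. indicator (box a b) w :: complex"
    define \<phi> where "\<phi> \<epsilon> z = (LINT y|lborel. of_real (heat_kernel \<epsilon> y) * ?B (z + y))" for \<epsilon> z
    have \<phi>0: "(LINT z|lborel. H z * \<phi> \<epsilon> z) = 0" if \<epsilon>: "\<epsilon> > 0" for \<epsilon>
    proof -
      have "\<phi> \<epsilon> z = (LINT w|lborel. ?B w * of_real (heat_kernel \<epsilon> (w - z)))" for z
        unfolding \<phi>_def by (subst lborel_integral_translate[of _ z, symmetric]) (auto simp: mult.commute)
      then have "(LINT z|lborel. H z * \<phi> \<epsilon> z)
        = (LINT z|lborel. (LINT w|lborel. H z * (?B w * of_real (heat_kernel \<epsilon> (w - z)))))"
        by simp
      also have "\<dots> = (LINT w|lborel. (LINT z|lborel. H z * (?B w * of_real (heat_kernel \<epsilon> (w - z)))))"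
      proof (rule lborel_pair.Fubini_integral[symmetric], rule fubini_integrable_bound)
        show "integrable lborel (\<lambda>z. cmod (H z))" using H by simp
        show "integrable lborel (\<lambda>w. indicator (box a b) w / sqrt (4 * pi * \<epsilon>) ^ DIM('a))"
          by (intro integrable_divide integrable_real_indicator) (auto simp: emeasure_lborel_box_eq)
        show "cmod (case (z, w) of (z, w) \<Rightarrow> H z * (?B w * of_real (heat_kernel \<epsilon> (w - z))))
          \<le> norm (cmod (H z)) * norm (indicator (box a b) w / sqrt (4 * pi * \<epsilon>) ^ DIM('a))" for z w
          using \<epsilon> heat_kernel_le[OF \<epsilon>, of "w - z"] mult_left_mono[OF heat_kernel_le[OF \<epsilon>, of "w - z"], of "cmod (H z)"]
          by (auto simp: norm_mult heat_kernel_nonneg split: split_indicator)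
      qed (auto intro: lborel.sigma_finite_measure_axioms)
      also have "\<dots> = (LINT w|lborel. ?B w * (LINT z|lborel. H z * of_real (heat_kernel \<epsilon> (w - z))))"
        by (simp only: integral_mult_right_zero mult.left_commute[of "H _" "indicator _ _"])
      also have "\<dots> = 0" by (simp add: conv[OF \<epsilon>])
      finally show ?thesis .
    qed
    have [measurable]: "\<phi> \<epsilon> \<in> borel_measurable borel" for \<epsilon>
      unfolding \<phi>_def[abs_def] by measurable
    have \<phi>1: "cmod (\<phi> \<epsilon> z) \<le> 1" if \<epsilon>: "\<epsilon> > 0" for \<epsilon> z
    proof -
      have "cmod (\<phi> \<epsilon> z) \<le> (LINT y|lborel. heat_kernel \<epsilon> (y::'a))"
        unfolding \<phi>_def
        by (rule Bochner_Integration.integral_norm_bound_integral,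
            rule Bochner_Integration.integrable_bound[OF heat_kernel_integrable[OF \<epsilon>]])
           (auto simp: norm_mult heat_kernel_nonneg \<epsilon> heat_kernel_integrable split: split_indicator)
      then show ?thesis by (simp add: heat_kernel_integral \<epsilon>)
    qed
    have "(\<lambda>n. LINT z|lborel. H z * \<phi> (inverse (real (Suc n))) z) \<longlonglongrightarrow> (LINT z|lborel. H z * ?B z)"
    proof (rule integral_dominated_convergence)
      show "integrable lborel (\<lambda>z. cmod (H z))" using H by simp
      show "AE z in lborel. cmod (H z * \<phi> (inverse (real (Suc n))) z) \<le> cmod (H z)" for n
        by (auto simp: norm_mult intro!: mult_left_le \<phi>1)
      \<comment> \<open>The smoothed indicator converges where the indicator is continuous, that is,
        off the boundary of the box.\<close>
      have "negligible (frontier (box a b))" by (simp add: negligible_convex_frontier)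
      then have "frontier (box a b) \<in> null_sets lborel"
        by (simp add: negligible_iff_null_sets null_sets_completion_iff)
      then have "AE z in lborel. z \<notin> frontier (box a b)" by (rule AE_not_in)
      then show "AE z in lborel. (\<lambda>n. H z * \<phi> (inverse (real (Suc n))) z) \<longlonglongrightarrow> H z * ?B z"
      proof eventually_elim
        case (elim z)
        have "isCont (indicator (box a b) :: 'a \<Rightarrow> real) z"
          using elim by (simp add: isCont_indicator)
        then have "isCont (\<lambda>w. complex_of_real (indicator (box a b) w)) z"
          by (intro continuous_intros)
        moreover have "(\<lambda>w. complex_of_real (indicator (box a b) w)) = ?B"
          by (auto split: split_indicator)
        ultimately have c: "isCont ?B z" by simp
        have "((\<lambda>\<epsilon>. \<phi> \<epsilon> z) \<longlongrightarrow> ?B z) (at_right 0)"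
          unfolding \<phi>_def by (rule heat_kernel_approx[OF _ _ c, of 1]) (auto split: split_indicator)
        moreover have "filterlim (\<lambda>n. inverse (real (Suc n))) (at_right 0) sequentially"
          using LIMSEQ_inverse_real_of_nat by (auto simp: filterlim_at)
        ultimately have "(\<lambda>n. \<phi> (inverse (real (Suc n))) z) \<longlonglongrightarrow> ?B z"
          by (rule filterlim_compose)
        then show ?case by (intro tendsto_intros)
      qed
    qed auto
    then show ?thesis by (simp add: \<phi>0 LIMSEQ_const_iff mult.commute)
  qed
  have "AE z in lborel. z \<in> UNIV \<longrightarrow> H z = 0"
  proof (rule AE_zero_on_open_if_box_integrals_zero)
    show "integrable lborel (\<lambda>x. indicator (box a b) x * H x)" for a b
      by (rule Bochner_Integration.integrable_bound[OF H]) (auto split: split_indicator)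
  qed (auto simp: box0)
  then show ?thesis by simp
qed

subsection \<open>Test functions\<close>

text \<open>Gives a name to the partial derivatives inside \<open>C_k\<close>, so that they can be
  iterated and rewritten as functions.\<close>

definition dir_deriv :: "'a::euclidean_space \<Rightarrow> ('a \<Rightarrow> complex) \<Rightarrow> 'a \<Rightarrow> complex" where
  "dir_deriv b f = (\<lambda>x. frechet_derivative f (at x) b)"

lemma C_k_Suc_iff: "C_k (Suc k) f \<longleftrightarrow> (\<forall>x. f differentiable (at x)) \<and> (\<forall>b\<in>Basis. C_k k (dir_deriv b f))"
  by (simp add: dir_deriv_def)

lemma dir_deriv_eq: "(\<And>x. (f has_derivative f' x) (at x)) \<Longrightarrow> dir_deriv b f = (\<lambda>x. f' x b)"
proof -
  assume "\<And>x. (f has_derivative f' x) (at x)"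
  then have "f' x = frechet_derivative f (at x)" for x by (rule frechet_derivative_at)
  then show ?thesis by (simp add: dir_deriv_def)
qed

lemma has_derivative_dir_deriv:
  "f differentiable (at x) \<Longrightarrow> (f has_derivative (\<lambda>b. dir_deriv b f x)) (at x)"
  unfolding dir_deriv_def by (simp add: frechet_derivative_works)

lemma C_k_continuous: "C_k k f \<Longrightarrow> continuous_on UNIV f"
proof (cases k)
  case (Suc j)
  assume "C_k k f"
  then have "isCont f x" for x using Suc by (auto intro: differentiable_imp_continuous_within)
  then show ?thesis by (simp add: continuous_on_eq_continuous_within)
qed simp

lemma C_k_Suc_imp: "C_k (Suc k) f \<Longrightarrow> C_k k f"
proof (induction k arbitrary: f)
  case 0 then show ?case using C_k_continuous[of "Suc 0" f] by (simp only: C_k.simps(1))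
next
  case (Suc k) then show ?case unfolding C_k_Suc_iff by blast
qed

lemma C_k_const: "C_k k (\<lambda>_. c)"
proof (induction k arbitrary: c)
  case (Suc k)
  have "dir_deriv b (\<lambda>_::'a. c) = (\<lambda>_. 0)" for b by (rule dir_deriv_eq) (rule has_derivative_const)
  then show ?case unfolding C_k_Suc_iff using Suc by simp
qed auto

lemma dir_deriv_add:
  assumes "\<And>x. f differentiable (at x)" "\<And>x. g differentiable (at x)"
  shows "dir_deriv b (\<lambda>x. f x + g x) = (\<lambda>x. dir_deriv b f x + dir_deriv b g x)"
  by (rule dir_deriv_eq) (intro has_derivative_add has_derivative_dir_deriv assms)

lemma dir_deriv_mult:
  assumes "\<And>x. f differentiable (at x)" "\<And>x. g differentiable (at x)"
  shows "dir_deriv b (\<lambda>x. f x * g x) = (\<lambda>x. f x * dir_deriv b g x + dir_deriv b f x * g x)"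
  by (rule dir_deriv_eq) (intro has_derivative_mult has_derivative_dir_deriv assms)

lemma C_k_add: "C_k k f \<Longrightarrow> C_k k g \<Longrightarrow> C_k k (\<lambda>x. f x + g x)"
proof (induction k arbitrary: f g)
  case (Suc k)
  then have d: "\<And>x. f differentiable (at x)" "\<And>x. g differentiable (at x)" by auto
  show ?case unfolding C_k_Suc_iff dir_deriv_add[OF d]
    using Suc d unfolding C_k_Suc_iff by auto
qed (auto intro: continuous_intros)

lemma C_k_mult: "C_k k f \<Longrightarrow> C_k k g \<Longrightarrow> C_k k (\<lambda>x. f x * g x)"
proof (induction k arbitrary: f g)
  case (Suc k)
  then have d: "\<And>x. f differentiable (at x)" "\<And>x. g differentiable (at x)" by auto
  have "C_k k f" "C_k k g" using Suc.prems by (blast intro: C_k_Suc_imp)+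
  then show ?case unfolding C_k_Suc_iff dir_deriv_mult[OF d]
    using Suc d unfolding C_k_Suc_iff by (auto intro!: C_k_add)
qed (auto intro: continuous_intros)

lemma C_k_prod: "finite I \<Longrightarrow> (\<And>i. i \<in> I \<Longrightarrow> C_k k (f i)) \<Longrightarrow> C_k k (\<lambda>x. \<Prod>i\<in>I. f i x)"
  by (induction I rule: finite_induct) (auto intro: C_k_const C_k_mult)

text \<open>The derivatives of \<open>exp (- 1 / r)\<close>, extended by zero to \<open>r \<le> 0\<close>, are linear combinations of these functions.\<close>

definition flat_exp :: "nat \<Rightarrow> real \<Rightarrow> real" where
  "flat_exp k r = (if r > 0 then (1 / r) ^ k * exp (- (1 / r)) else 0)"

lemma flat_exp_tendsto_0: "(flat_exp k \<longlongrightarrow> 0) (at_right 0)"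
proof -
  have "((\<lambda>x. x ^ k / exp x) \<longlongrightarrow> (0::real)) at_top" by (rule tendsto_power_div_exp_0)
  then have "((\<lambda>r. inverse r ^ k / exp (inverse r)) \<longlongrightarrow> (0::real)) (at_right 0)"
    by (rule filterlim_compose[OF _ filterlim_inverse_at_top_right])
  then show ?thesis
    by (rule Lim_transform_eventually)
       (auto simp: eventually_at_right_less flat_exp_def exp_minus field_simps intro!: eventually_at_right_less[THEN eventually_mono])
qed

text \<open>This closes the family under differentiation. For r > 0 it is the chain rule in x = 1 /
  r. At 0 the right difference quotient of \<open>flat_exp k\<close> is
  \<open>flat_exp (Suc k)\<close>, which tends to 0.\<close>

lemma flat_exp_deriv:
  "(flat_exp k has_real_derivative (flat_exp (k + 2) r - real k * flat_exp (k + 1) r)) (at r)"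
proof (cases r "0::real" rule: linorder_cases)
  case less
  have "((\<lambda>_. 0) has_real_derivative 0) (at r)" by simp
  then have "(flat_exp k has_real_derivative 0) (at r)"
    by (rule has_field_derivative_transform_within_open[where S="{..<0}"]) (use less in \<open>auto simp: flat_exp_def\<close>)
  then show ?thesis using less by (simp add: flat_exp_def)
next
  case greater
  define x where "x = 1 / r"
  have "((\<lambda>x. x ^ k * exp (- x)) has_real_derivative (real k * x ^ (k - 1) - x ^ k) * exp (- x)) (at (1 / r))"
    unfolding x_def by (auto intro!: derivative_eq_intros) (simp add: algebra_simps)
  moreover have "((\<lambda>r. 1 / r) has_real_derivative - (x ^ 2)) (at r)"
    using greater unfolding x_def by (auto intro!: derivative_eq_intros simp: power2_eq_square)
  ultimately have "((\<lambda>r. (1 / r) ^ k * exp (- (1 / r))) has_real_derivative (real k * x ^ (k - 1) - x ^ k) * exp (- x) * - (x ^ 2)) (at r)"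
    by (rule DERIV_chain2)
  moreover have "(real k * x ^ (k - 1) - x ^ k) * exp (- x) * - (x ^ 2) = flat_exp (k + 2) r - real k * flat_exp (k + 1) r"
    using greater by (cases k) (simp_all add: flat_exp_def x_def[symmetric] algebra_simps power2_eq_square)
  ultimately have "((\<lambda>r. (1 / r) ^ k * exp (- (1 / r))) has_real_derivative (flat_exp (k + 2) r - real k * flat_exp (k + 1) r)) (at r)"
    by simp
  then show ?thesis
    by (rule has_field_derivative_transform_within_open[where S="{0<..}"]) (use greater in \<open>auto simp: flat_exp_def\<close>)
next
  case equal
  have "((\<lambda>h. (flat_exp k (0 + h) - flat_exp k 0) / h) \<longlongrightarrow> 0) (at 0)"
  proof (rule filterlim_split_at)
    show "((\<lambda>h. (flat_exp k (0 + h) - flat_exp k 0) / h) \<longlongrightarrow> 0) (at_left 0)"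
      by (rule Lim_transform_eventually[OF tendsto_const])
         (auto simp: flat_exp_def eventually_at_left_field intro!: exI[of _ "-1"])
    show "((\<lambda>h. (flat_exp k (0 + h) - flat_exp k 0) / h) \<longlongrightarrow> 0) (at_right 0)"
      by (rule Lim_transform_eventually[OF flat_exp_tendsto_0[of "Suc k"]])
         (auto simp: flat_exp_def eventually_at_right_field intro!: exI[of _ 1])
  qed
  then show ?thesis using equal by (simp add: DERIV_def flat_exp_def)
qed

text \<open>Along an affine function each partial derivative is a constant times a combination of
  the members \<open>k + 1\<close> and \<open>k + 2\<close>, so induction on the order
  \<open>j\<close> with \<open>k\<close> free yields smoothness.\<close>

lemma C_k_flat_exp: "C_k j (\<lambda>z. complex_of_real (flat_exp k (c + z \<bullet> d)))"
proof (induction j arbitrary: k)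
  have hd: "((\<lambda>z. complex_of_real (flat_exp k (c + z \<bullet> d))) has_derivative
      (\<lambda>h. of_real ((flat_exp (k + 2) (c + x \<bullet> d) - real k * flat_exp (k + 1) (c + x \<bullet> d)) * (h \<bullet> d)))) (at x)" for k x
    by (rule has_derivative_of_real, rule has_derivative_compose[OF _ has_field_derivative_imp_has_derivative[OF flat_exp_deriv]])
       (auto intro!: derivative_eq_intros)
  {
    case 0
    show ?case unfolding C_k.simps continuous_on_eq_continuous_within
      using has_derivative_continuous[OF hd] by blast
  next
    case (Suc j)
    show ?case unfolding C_k_Suc_iff dir_deriv_eq[OF hd]
    proof (intro conjI ballI allI)
      show "(\<lambda>z. complex_of_real (flat_exp k (c + z \<bullet> d))) differentiable at x" for x
        using hd by (auto simp: differentiable_def)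
      fix b :: 'a
      have eq: "complex_of_real ((flat_exp (k + 2) (c + x \<bullet> d) - real k * flat_exp (k + 1) (c + x \<bullet> d)) * (b \<bullet> d))
        = of_real (b \<bullet> d) * (of_real (flat_exp (k + 2) (c + x \<bullet> d)) + of_real (- real k) * of_real (flat_exp (k + 1) (c + x \<bullet> d)))" for x
        by (simp add: algebra_simps)
      show "C_k j (\<lambda>x. complex_of_real ((flat_exp (k + 2) (c + x \<bullet> d) - real k * flat_exp (k + 1) (c + x \<bullet> d)) * (b \<bullet> d)))"
        unfolding eq by (intro C_k_mult C_k_add C_k_const Suc)
    qed
  }
qed

text \<open>A smooth function positive exactly on the open box: one flat factor for the signed
  distance to each face. The parameter \<open>m\<close> is the steepness; as it grows the function
  tends to the indicator of the box.\<close>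

definition box_bump :: "real \<Rightarrow> 'a::euclidean_space \<Rightarrow> 'a \<Rightarrow> 'a \<Rightarrow> real" where
  "box_bump m a b z = (\<Prod>i\<in>Basis. flat_exp 0 (m * (z \<bullet> i - a \<bullet> i)) * flat_exp 0 (m * (b \<bullet> i - z \<bullet> i)))"

lemma flat_exp_0: "0 \<le> flat_exp 0 r" "flat_exp 0 r \<le> 1" "flat_exp 0 r = 0 \<longleftrightarrow> r \<le> 0"
  by (auto simp: flat_exp_def)

lemma box_bump_bounds: "0 \<le> box_bump m a b z" "box_bump m a b z \<le> 1"
  unfolding box_bump_def
  by (intro prod_nonneg prod_le_1 conjI mult_nonneg_nonneg mult_le_one flat_exp_0 ballI; simp add: flat_exp_0)+

lemma box_bump_eq_0_iff: "m > 0 \<Longrightarrow> box_bump m a b z = 0 \<longleftrightarrow> z \<notin> box a b"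
  by (auto simp: box_bump_def flat_exp_0 mem_box mult_le_0_iff not_less)

lemma box_bump_tendsto:
  "(\<lambda>n. box_bump (real (Suc n)) a b z) \<longlonglongrightarrow> indicator (box a b) z"
proof (cases "z \<in> box a b")
  case True
  have "(\<lambda>n. flat_exp 0 (real (Suc n) * r)) \<longlonglongrightarrow> 1" if "r > 0" for r
  proof -
    have "(\<lambda>n. exp (- (inverse (real (Suc n)) * (1 / r)))) \<longlonglongrightarrow> exp (- (0 * (1 / r)))"
      by (intro tendsto_intros LIMSEQ_inverse_real_of_nat)
    moreover have "flat_exp 0 (real (Suc n) * r) = exp (- (inverse (real (Suc n)) * (1 / r)))" for n
      using mult_pos_pos[OF of_nat_0_less_iff[THEN iffD2, OF zero_less_Suc[of n]] that] that
      by (simp add: flat_exp_def field_simps del: of_nat_Suc)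
    ultimately show ?thesis by simp
  qed
  then have "(\<lambda>n. box_bump (real (Suc n)) a b z) \<longlonglongrightarrow> (\<Prod>i\<in>(Basis::'a set). 1 * 1)"
    unfolding box_bump_def using True by (intro tendsto_intros) (auto simp: mem_box)
  then show ?thesis using True by simp
next
  case False
  then have "box_bump (real (Suc n)) a b z = 0" for n using box_bump_eq_0_iff[of "real (Suc n)" a b z] by simp
  then show ?thesis using False by simp
qed

lemma test_function_box_bump:
  assumes "m > 0" "cbox a b \<subseteq> \<Omega>"
  shows "test_function \<Omega> (\<lambda>z. complex_of_real (box_bump m a b z))"
  unfolding test_function_def
proof (intro conjI allI)
  have sub: "closure {z. complex_of_real (box_bump m a b z) \<noteq> 0} \<subseteq> cbox a b"
    by (rule closure_minimal) (use assms box_subset_cbox in \<open>auto simp: box_bump_eq_0_iff\<close>)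
  then show "closure {z. complex_of_real (box_bump m a b z) \<noteq> 0} \<subseteq> \<Omega>" using assms by blast
  show "compact (closure {z. complex_of_real (box_bump m a b z) \<noteq> 0})"
    using sub by (meson bounded_cbox bounded_subset closed_closure compact_eq_bounded_closed)
  fix k
  have eq: "(\<lambda>z. complex_of_real (box_bump m a b z)) = (\<lambda>z. \<Prod>i\<in>Basis.
      complex_of_real (flat_exp 0 (- m * (a \<bullet> i) + z \<bullet> (m *\<^sub>R i))) *
      complex_of_real (flat_exp 0 (m * (b \<bullet> i) + z \<bullet> (- m *\<^sub>R i))))"
    by (simp add: box_bump_def algebra_simps)
  show "C_k k (\<lambda>z. complex_of_real (box_bump m a b z))"
    unfolding eq by (intro C_k_prod C_k_mult C_k_flat_exp) auto
qed

lemma test_functionD: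
  assumes "test_function \<Omega> \<psi>"
  shows "\<psi> differentiable (at x)" "continuous_on UNIV \<psi>" "\<psi> \<in> borel_measurable borel"
    "compact (closure {z. \<psi> z \<noteq> 0})" "closure {z. \<psi> z \<noteq> 0} \<subseteq> \<Omega>"
    "\<exists>R. \<forall>z. \<psi> z \<noteq> 0 \<longrightarrow> norm z \<le> R"
    "\<exists>M. \<forall>z. cmod (\<psi> z) \<le> M"
    "integrable lborel \<psi>"
proof -
  let ?K = "closure {z. \<psi> z \<noteq> 0}"
  have C: "C_k (Suc 0) \<psi>" and K: "compact ?K" "?K \<subseteq> \<Omega>" using assms unfolding test_function_def by blast+
  then show "\<psi> differentiable (at x)" "compact ?K" "?K \<subseteq> \<Omega>" by auto
  show cont: "continuous_on UNIV \<psi>" by (rule C_k_continuous[OF C])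
  then show [measurable]: "\<psi> \<in> borel_measurable borel" by (rule borel_measurable_continuous_onI)
  show "\<exists>R. \<forall>z. \<psi> z \<noteq> 0 \<longrightarrow> norm z \<le> R"
    using compact_imp_bounded[OF K(1)] closure_subset[of "{z. \<psi> z \<noteq> 0}"] unfolding bounded_iff by blast
  have "bounded (\<psi> ` ?K)"
    by (intro compact_imp_bounded compact_continuous_image K continuous_on_subset[OF cont]) auto
  then obtain M where M: "\<And>z. z \<in> ?K \<Longrightarrow> cmod (\<psi> z) \<le> M" unfolding bounded_iff by blast
  show "\<exists>M. \<forall>z. cmod (\<psi> z) \<le> M"
  proof (intro exI allI)
    fix z show "cmod (\<psi> z) \<le> max 0 M"
      using M[of z] closure_subset[of "{z. \<psi> z \<noteq> 0}"] by (cases "\<psi> z = 0") (auto simp: max.coboundedI2)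
  qed
  have "integrable lborel (\<lambda>z. indicator ?K z *\<^sub>R \<psi> z)"
    by (rule borel_integrable_compact[OF K(1)]) (rule continuous_on_subset[OF cont], simp)
  moreover have "indicator ?K z *\<^sub>R \<psi> z = \<psi> z" for z
    using closure_subset[of "{z. \<psi> z \<noteq> 0}"] by (cases "\<psi> z = 0") (auto simp: indicator_def)
  ultimately show "integrable lborel \<psi>" by simp
qed

lemma test_functionI:
  assumes "\<And>k. C_k k \<phi>" "{z. \<phi> z \<noteq> 0} \<subseteq> K" "compact K" "K \<subseteq> \<Omega>"
  shows "test_function \<Omega> \<phi>"
proof -
  have "closure {z. \<phi> z \<noteq> 0} \<subseteq> K" using assms(2,3) by (intro closure_minimal compact_imp_closed)
  then have "K \<inter> closure {z. \<phi> z \<noteq> 0} = closure {z. \<phi> z \<noteq> 0}" "closure {z. \<phi> z \<noteq> 0} \<subseteq> \<Omega>"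
    using assms(4) by auto
  moreover have "compact (K \<inter> closure {z. \<phi> z \<noteq> 0})"
    by (intro compact_Int_closed assms closed_closure)
  ultimately show ?thesis unfolding test_function_def using assms(1) by simp
qed

lemma test_function_C_k: "test_function \<Omega> \<psi> \<Longrightarrow> C_k k \<psi>"
  unfolding test_function_def by blast

lemma test_function_supportI:
  assumes "test_function \<Omega> \<psi>" "\<And>k. C_k k \<phi>" "{z. \<phi> z \<noteq> 0} \<subseteq> closure {z. \<psi> z \<noteq> 0}"
  shows "test_function \<Omega> \<phi>"
  by (rule test_functionI[OF assms(2,3) test_functionD(4,5)[OF assms(1)]])

lemma test_function_add:
  assumes "test_function \<Omega> \<phi>" "test_function \<Omega> \<psi>"
  shows "test_function \<Omega> (\<lambda>z. \<phi> z + \<psi> z)"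
proof (rule test_functionI)
  let ?K = "closure {z. \<phi> z \<noteq> 0} \<union> closure {z. \<psi> z \<noteq> 0}"
  show "{z. \<phi> z + \<psi> z \<noteq> 0} \<subseteq> ?K"
  proof
    fix z assume "z \<in> {z. \<phi> z + \<psi> z \<noteq> 0}"
    then have "\<phi> z \<noteq> 0 \<or> \<psi> z \<noteq> 0" by auto
    then show "z \<in> ?K"
      using closure_subset[of "{z. \<phi> z \<noteq> 0}"] closure_subset[of "{z. \<psi> z \<noteq> 0}"] by auto
  qed
  show "compact ?K" "?K \<subseteq> \<Omega>"
    by (intro compact_Un Un_least test_functionD(4,5)[OF assms(1)] test_functionD(4,5)[OF assms(2)])+
  show "C_k k (\<lambda>z. \<phi> z + \<psi> z)" for k
    by (rule C_k_add[OF test_function_C_k[OF assms(1)] test_function_C_k[OF assms(2)]])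
qed

lemma test_function_cmult:
  assumes "test_function \<Omega> \<psi>" shows "test_function \<Omega> (\<lambda>z. c * \<psi> z)"
proof (rule test_function_supportI[OF assms])
  show "{z. c * \<psi> z \<noteq> 0} \<subseteq> closure {z. \<psi> z \<noteq> 0}"
    using closure_subset[of "{z. \<psi> z \<noteq> 0}"] by auto
  show "C_k k (\<lambda>z. c * \<psi> z)" for k
    by (rule C_k_mult[OF C_k_const test_function_C_k[OF assms]])
qed

lemma test_function_zero: "test_function \<Omega> (\<lambda>_. 0)"
  by (rule test_functionI[where K="{}"]) (simp_all only: C_k_const compact_empty empty_subsetI simp_thms Collect_empty_eq subset_empty)

lemma test_function_sum:
  "finite I \<Longrightarrow> (\<And>i. i \<in> I \<Longrightarrow> test_function \<Omega> (f i)) \<Longrightarrow> test_function \<Omega> (\<lambda>x. \<Sum>i\<in>I. f i x)"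
  by (induction I rule: finite_induct) (simp_all add: test_function_add test_function_zero)

lemma test_function_dir_deriv:
  assumes "test_function \<Omega> \<psi>" "b \<in> Basis"
  shows "test_function \<Omega> (dir_deriv b \<psi>)"
proof (rule test_function_supportI[OF assms(1)])
  show "C_k k (dir_deriv b \<psi>)" for k
  proof -
    have "C_k (Suc k) \<psi>" using assms(1) unfolding test_function_def by blast
    then show ?thesis using assms(2) unfolding C_k_Suc_iff by blast
  qed
  have "dir_deriv b \<psi> z = 0" if "z \<notin> closure {z. \<psi> z \<noteq> 0}" for z
  proof -
    have "((\<lambda>_. 0) has_derivative (\<lambda>_. 0)) (at z)" by (rule has_derivative_const)
    then have "(\<psi> has_derivative (\<lambda>_. 0)) (at z)"
      by (rule has_derivative_transform_within_open[where s="- closure {z. \<psi> z \<noteq> 0}"])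
         (use that closure_subset[of "{z. \<psi> z \<noteq> 0}"] in auto)
    then show ?thesis unfolding dir_deriv_def by (simp add: frechet_derivative_at[symmetric])
  qed
  then show "{z. dir_deriv b \<psi> z \<noteq> 0} \<subseteq> closure {z. \<psi> z \<noteq> 0}" by blast
qed

section \<open>Inverse Fourier transforms of test functions\<close>

lemma difference_quotient_tendsto:
  fixes f :: "'a::real_normed_vector \<Rightarrow> complex"
  assumes "(f has_derivative f') (at z)"
  shows "(\<lambda>n. (f (z + inverse (real (Suc n)) *\<^sub>R b) - f z) / of_real (inverse (real (Suc n)))) \<longlonglongrightarrow> f' b"
proof -
  interpret f': bounded_linear f' using assms by (rule has_derivative_bounded_linear)
  have "((\<lambda>t. z + t *\<^sub>R b) has_derivative (\<lambda>t. t *\<^sub>R b)) (at (0::real))"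
    by (auto intro!: derivative_eq_intros)
  moreover have "(f has_derivative f') (at (z + (0::real) *\<^sub>R b))" using assms by simp
  ultimately have "((\<lambda>t. f (z + t *\<^sub>R b)) has_derivative (\<lambda>t. f' (t *\<^sub>R b))) (at (0::real))"
    by (rule has_derivative_compose)
  then have "(\<lambda>t. cmod (f (z + (0 + t) *\<^sub>R b) - f (z + (0::real) *\<^sub>R b) - f' (t *\<^sub>R b)) / norm t) \<midarrow>0\<rightarrow> 0"
    unfolding has_derivative_at by blast
  moreover have "filterlim (\<lambda>n. inverse (real (Suc n))) (at 0) sequentially"
    using LIMSEQ_inverse_real_of_nat by (auto simp: filterlim_at)
  ultimately have "(\<lambda>n. cmod (f (z + (0 + inverse (real (Suc n))) *\<^sub>R b) - f (z + (0::real) *\<^sub>R b)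
      - f' (inverse (real (Suc n)) *\<^sub>R b)) / norm (inverse (real (Suc n)))) \<longlonglongrightarrow> 0"
    by (rule filterlim_compose)
  moreover have "cmod (f (z + (0 + r) *\<^sub>R b) - f (z + (0::real) *\<^sub>R b) - f' (r *\<^sub>R b)) / norm r
     = cmod ((f (z + r *\<^sub>R b) - f z) / of_real r - f' b)" if "r > 0" for r
  proof -
    have "(f (z + r *\<^sub>R b) - f z) / of_real r - f' b = (f (z + r *\<^sub>R b) - f z - r *\<^sub>R f' b) / of_real r"
      using that by (simp add: diff_divide_distrib scaleR_conv_of_real)
    then show ?thesis by (simp add: f'.scaleR norm_divide)
  qed
  ultimately have "(\<lambda>n. cmod ((f (z + inverse (real (Suc n)) *\<^sub>R b) - f z) / of_real (inverse (real (Suc n))) - f' b)) \<longlonglongrightarrow> 0"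
    by simp
  then show ?thesis by (simp only: tendsto_norm_zero_iff Lim_null[of _ "f' b"])
qed

text \<open>Integration by parts in the form of translation invariance: shifting the variable turns
  the Fourier integral of a difference quotient of \<open>\<psi>\<close> into a difference quotient
  of the character times the Fourier integral of \<open>\<psi>\<close>. The limit is then taken on
  both sides.\<close>

lemma inv_fourier_dir_deriv:
  fixes \<psi> :: "'a::euclidean_space \<Rightarrow> complex"
  assumes \<psi>: "test_function \<Omega> \<psi>" and b: "b \<in> Basis"
  shows "inv_fourier (dir_deriv b \<psi>) \<zeta> = - \<i> * of_real (\<zeta> \<bullet> b) * inv_fourier \<psi> \<zeta>"
proof -
  note [measurable] = test_functionD(3)[OF \<psi>]
  define F where "F = (LINT z|lborel. exp (\<i> * of_real (z \<bullet> \<zeta>)) * \<psi> z)"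
  define c where "c = \<zeta> \<bullet> b"
  define h where "h n = inverse (real (Suc n))" for n
  let ?q = "\<lambda>n z. exp (\<i> * of_real (z \<bullet> \<zeta>)) * ((\<psi> (z + h n *\<^sub>R b) - \<psi> z) / of_real (h n))"
  have h: "h n > 0" "h n \<le> 1" for n by (auto simp: h_def inverse_le_1_iff)
  have Fi: "integrable lborel (\<lambda>z. exp (\<i> * of_real (z \<bullet> \<zeta>)) * \<psi> z)"
    by (rule Bochner_Integration.integrable_bound[OF test_functionD(8)[OF \<psi>]]) (auto simp: norm_mult)
  obtain R where R: "\<And>z. \<psi> z \<noteq> 0 \<Longrightarrow> norm z \<le> R" using test_functionD(6)[OF \<psi>] by blast
  obtain M where M: "\<And>z. cmod (dir_deriv b \<psi> z) \<le> M"
    using test_functionD(7)[OF test_function_dir_deriv[OF \<psi> b]] by blast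
  \<comment> \<open>The right-hand side is spelled as a difference quotient at 0 in the direction
    \<open>c\<close>, the shape of \<open>difference_quotient_tendsto\<close>.\<close>
  have quot: "(LINT z|lborel. ?q n z)
     = (exp (- (\<i> * of_real (0 + h n *\<^sub>R c))) - exp (- (\<i> * of_real 0))) / of_real (h n) * F" for n
  proof -
    let ?G = "\<lambda>z. exp (\<i> * of_real (z \<bullet> \<zeta>)) * \<psi> z"
    have e: "?q n z
      = (exp (- (\<i> * of_real (h n * c))) * ?G (h n *\<^sub>R b + z) - ?G z) / of_real (h n)" for z
    proof -
      have "exp (- (\<i> * of_real (h n * c))) * exp (\<i> * of_real ((h n *\<^sub>R b + z) \<bullet> \<zeta>)) = exp (\<i> * of_real (z \<bullet> \<zeta>))"
        by (simp add: exp_add[symmetric] inner_add_left c_def inner_commute[of b \<zeta>] algebra_simps)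
      then have "exp (- (\<i> * of_real (h n * c))) * ?G (h n *\<^sub>R b + z) = exp (\<i> * of_real (z \<bullet> \<zeta>)) * \<psi> (z + h n *\<^sub>R b)"
        by (simp only: mult.assoc[symmetric] add.commute[of "h n *\<^sub>R b"])
      then show ?thesis by (simp only: right_diff_distrib times_divide_eq_right)
    qed
    have i: "integrable lborel (\<lambda>z. ?G (h n *\<^sub>R b + z))" by (rule lborel_integrable_translate[OF Fi])
    have t: "(LINT z|lborel. ?G (h n *\<^sub>R b + z)) = F"
      unfolding F_def by (rule lborel_integral_translate[of ?G]) measurable
    show ?thesis
      unfolding e integral_divide_zero Bochner_Integration.integral_diff[OF integrable_mult_right[OF i] Fi]
        integral_mult_right_zero t F_def[symmetric]
      by (simp add: algebra_simps)
  qed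
  have "((\<lambda>t. - (\<i> * of_real t)) has_derivative (\<lambda>t. - (\<i> * of_real t))) (at (0::real))"
    by (intro has_derivative_minus has_derivative_mult_right has_derivative_of_real has_derivative_ident)
  from has_derivative_compose[OF this has_field_derivative_imp_has_derivative[OF DERIV_exp]]
  have "((\<lambda>t. exp (- (\<i> * of_real t))) has_derivative (\<lambda>t. of_real t * (- \<i>))) (at (0::real))"
    by (simp add: mult.commute)
  from difference_quotient_tendsto[OF this, of c]
  have "(\<lambda>n. (exp (- (\<i> * of_real (0 + h n *\<^sub>R c))) - exp (- (\<i> * of_real 0))) / of_real (h n) * F) \<longlonglongrightarrow> (of_real c * - \<i>) * F"
    unfolding h_def by (intro tendsto_mult_right)
  moreover have "(\<lambda>n. LINT z|lborel. ?q n z)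
     \<longlonglongrightarrow> (LINT z|lborel. exp (\<i> * of_real (z \<bullet> \<zeta>)) * dir_deriv b \<psi> z)"
  proof (rule integral_dominated_convergence)
    note [measurable] = test_functionD(3)[OF test_function_dir_deriv[OF \<psi> b]]
    show "(\<lambda>z. exp (\<i> * of_real (z \<bullet> \<zeta>)) * dir_deriv b \<psi> z) \<in> borel_measurable lborel" by measurable
    show "(\<lambda>z. ?q n z) \<in> borel_measurable lborel" for n
      by measurable
    \<comment> \<open>\<open>M\<close> bounds the quotients by the mean value inequality. As
      \<open>h n \<le> 1\<close> and \<open>b\<close> is a unit vector, enlarging the radius by 1
      captures the supports of all shifted functions.\<close>
    show "integrable lborel (\<lambda>z::'a. M * indicator (cball 0 (R + 1)) z)"
      by (intro integrable_mult_right integrable_real_indicator)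
         (use emeasure_bounded_finite[of "cball 0 (R + 1) :: 'a set"] in auto)
    show "AE z in lborel. (\<lambda>n. ?q n z)
       \<longlonglongrightarrow> exp (\<i> * of_real (z \<bullet> \<zeta>)) * dir_deriv b \<psi> z"
      unfolding h_def
      by (intro AE_I2 tendsto_mult_left difference_quotient_tendsto has_derivative_dir_deriv test_functionD[OF \<psi>])
    show "AE z in lborel. cmod (?q n z)
       \<le> M * indicator (cball 0 (R + 1)) z" for n
    proof (rule AE_I2)
      fix z :: 'a
      have hd: "((\<lambda>t. \<psi> (z + t *\<^sub>R b)) has_derivative (\<lambda>t. dir_deriv (t *\<^sub>R b) \<psi> (z + s *\<^sub>R b))) (at s)" for s
        by (rule has_derivative_compose[OF _ has_derivative_dir_deriv[OF test_functionD(1)[OF \<psi>]]])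
           (auto intro!: derivative_eq_intros)
      obtain s where s: "cmod (\<psi> (z + h n *\<^sub>R b) - \<psi> (z + 0 *\<^sub>R b)) \<le> cmod (dir_deriv ((h n - 0) *\<^sub>R b) \<psi> (z + s *\<^sub>R b))"
        using mvt_general[of 0 "h n" "\<lambda>t. \<psi> (z + t *\<^sub>R b)" "\<lambda>s t. dir_deriv (t *\<^sub>R b) \<psi> (z + s *\<^sub>R b)", OF h(1)] hd
        by (metis (no_types, lifting) continuous_at_imp_continuous_on has_derivative_continuous)
      have "dir_deriv (h n *\<^sub>R b) \<psi> (z + s *\<^sub>R b) = h n *\<^sub>R dir_deriv b \<psi> (z + s *\<^sub>R b)"
        using has_derivative_bounded_linear[OF has_derivative_dir_deriv[OF test_functionD(1)[OF \<psi>]]]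
        by (rule linear_scale[OF bounded_linear.linear])
      then have "cmod (\<psi> (z + h n *\<^sub>R b) - \<psi> z) \<le> h n * M"
        using s h[of n] by (auto intro: order_trans[OF _ mult_left_mono[OF M]])
      then have *: "cmod ((\<psi> (z + h n *\<^sub>R b) - \<psi> z) / of_real (h n)) \<le> M"
        using h[of n] by (simp add: norm_divide field_simps)
      have "\<psi> (z + h n *\<^sub>R b) - \<psi> z = 0" if "z \<notin> cball 0 (R + 1)"
      proof -
        have z: "norm z > R + 1" using that by simp
        have "norm z \<le> norm (z + h n *\<^sub>R b) + norm (h n *\<^sub>R b)"
          by (metis add_diff_cancel norm_triangle_ineq4)
        then have "norm (z + h n *\<^sub>R b) > R" using z h[of n] b by simp
        then show ?thesis using R[of z] R[of "z + h n *\<^sub>R b"] z by force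
      qed
      then show "cmod (?q n z)
       \<le> M * indicator (cball 0 (R + 1)) z"
        using * by (auto simp: norm_mult indicator_def simp del: times_divide_eq_right)
    qed
  qed
  ultimately have "(LINT z|lborel. exp (\<i> * of_real (z \<bullet> \<zeta>)) * dir_deriv b \<psi> z) = (of_real c * - \<i>) * F"
    unfolding quot using LIMSEQ_unique by blast
  then show ?thesis by (simp add: inv_fourier_def F_def c_def mult_ac inner_commute[of \<zeta>])
qed

text \<open>A product over the coordinates reduces integrability to the one-dimensional arctangent
  integral, and it is the form of decay that coordinatewise integration by parts delivers.\<close>

lemma one_plus_square_weight:
  defines "w \<equiv> \<lambda>\<zeta>::'a::euclidean_space. \<Prod>b\<in>Basis. inverse (1 + (\<zeta> \<bullet> b)\<^sup>2)"
  shows "integrable lborel w" "0 \<le> w \<zeta>" "w \<zeta> \<le> 1"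
proof -
  have "integrable lborel (\<lambda>x::real. inverse (1 + x\<^sup>2))"
  proof -
    have "set_integrable lborel (einterval (-\<infinity>) \<infinity>) (\<lambda>x::real. inverse (1 + x\<^sup>2))"
      using integrable_inverse_1_plus_square by simp
    then show ?thesis by (simp add: set_integrable_def)
  qed
  then have "integrable lborel (\<lambda>x::real. complex_of_real (inverse (1 + x\<^sup>2)))"
    by (simp only: complex_of_real_integrable_eq)
  from integrable_prod_Basis(1)[of "\<lambda>_::'a. \<lambda>x::real. complex_of_real (inverse (1 + x\<^sup>2))", OF this]
  have "integrable lborel (\<lambda>\<zeta>. complex_of_real (w \<zeta>))" by (simp add: w_def)
  then show "integrable lborel w" using complex_of_real_integrable_eq by blast
  show "0 \<le> w \<zeta>" unfolding w_def by (intro prod_nonneg) auto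
  show "w \<zeta> \<le> 1" unfolding w_def by (intro prod_le_1) (auto simp: inverse_le_1_iff)
qed

lemma inv_fourier_bound:
  fixes \<zeta> :: "'a::euclidean_space"
  assumes "integrable lborel \<psi>"
  shows "cmod (inv_fourier \<psi> \<zeta>) \<le> (LINT z|lborel. cmod (\<psi> z)) / (2 * pi) ^ DIM('a)"
proof -
  have "cmod (LINT z|lborel. exp (\<i> * of_real (\<zeta> \<bullet> z)) * \<psi> z) \<le> (LINT z|lborel. cmod (exp (\<i> * of_real (\<zeta> \<bullet> z)) * \<psi> z))"
    by (rule integral_norm_bound)
  then show ?thesis
    by (simp add: inv_fourier_def norm_divide norm_power norm_mult divide_right_mono inner_commute)
qed

lemma inv_fourier_add:
  assumes [simp]: "integrable lborel f" "integrable lborel g"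
  shows "inv_fourier (\<lambda>z. f z + g z) \<zeta> = inv_fourier f \<zeta> + inv_fourier g \<zeta>"
proof -
  have *: "integrable lborel (\<lambda>z. exp (\<i> * of_real (\<zeta> \<bullet> z)) * f z)" if "integrable lborel f" for f
    by (rule Bochner_Integration.integrable_bound[OF that])
       (use borel_measurable_integrable[OF that] in \<open>auto simp: norm_mult\<close>)
  show ?thesis
    by (simp add: inv_fourier_def distrib_left Bochner_Integration.integral_add[OF *[OF assms(1)] *[OF assms(2)]] add_divide_distrib)
qed

lemma inv_fourier_cmult: "inv_fourier (\<lambda>z. c * f z) \<zeta> = c * inv_fourier f \<zeta>"
  by (simp add: inv_fourier_def mult.left_commute[of _ c])

text \<open>The factor 1 + (\<zeta> \<bullet> b)^2 on the Fourier side is the operator identity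
  minus second derivative in the direction \<open>b\<close>, which preserves test functions.
  Induction over the coordinates applies it once for each \<open>b\<close>; the last transform is
  bounded by an L1 norm.\<close>

lemma inv_fourier_decay:
  fixes \<psi> :: "'a::euclidean_space \<Rightarrow> complex"
  assumes \<psi>: "test_function \<Omega> \<psi>"
  obtains C where "\<And>\<zeta>. cmod (inv_fourier \<psi> \<zeta>) \<le> C * (\<Prod>b\<in>Basis. inverse (1 + (\<zeta> \<bullet> b)\<^sup>2))"
proof -
  have "\<exists>C. \<forall>\<zeta>. (\<Prod>b\<in>S. 1 + (\<zeta> \<bullet> b)\<^sup>2) * cmod (inv_fourier \<psi> \<zeta>) \<le> C" if "finite S" "S \<subseteq> Basis" for S
    using that \<psi>
  proof (induction S arbitrary: \<psi> rule: finite_induct)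
    case empty
    then show ?case using inv_fourier_bound[OF test_functionD(8)] by auto
  next
    case (insert b S)
    then have b: "b \<in> Basis" by auto
    note t1 = test_function_dir_deriv[OF insert.prems(2) b]
    note t2 = test_function_cmult[OF test_function_dir_deriv[OF t1 b], of "-1"]
    let ?\<phi> = "\<lambda>z. \<psi> z + (-1) * dir_deriv b (dir_deriv b \<psi>) z"
    have "test_function \<Omega> ?\<phi>" by (rule test_function_add[OF insert.prems(2) t2])
    then obtain C where C: "\<And>\<zeta>. (\<Prod>b\<in>S. 1 + (\<zeta> \<bullet> b)\<^sup>2) * cmod (inv_fourier ?\<phi> \<zeta>) \<le> C"
      using insert.IH insert.prems(1) by blast
    have "inv_fourier ?\<phi> \<zeta> = of_real (1 + (\<zeta> \<bullet> b)\<^sup>2) * inv_fourier \<psi> \<zeta>" for \<zeta>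
      unfolding inv_fourier_add[OF test_functionD(8)[OF insert.prems(2)] test_functionD(8)[OF t2]]
        inv_fourier_cmult inv_fourier_dir_deriv[OF t1 b] inv_fourier_dir_deriv[OF insert.prems(2) b]
      by (simp add: algebra_simps power2_eq_square)
    then have "cmod (inv_fourier ?\<phi> \<zeta>) = (1 + (\<zeta> \<bullet> b)\<^sup>2) * cmod (inv_fourier \<psi> \<zeta>)" for \<zeta>
      by (simp only: norm_mult norm_of_real) simp
    then show ?case using C insert.hyps by (intro exI[of _ C]) (simp add: mult_ac)
  qed
  from this[of Basis] obtain C where
    C: "\<And>\<zeta>. (\<Prod>b\<in>Basis. 1 + (\<zeta> \<bullet> b)\<^sup>2) * cmod (inv_fourier \<psi> \<zeta>) \<le> C" by auto
  have "cmod (inv_fourier \<psi> \<zeta>) \<le> C * (\<Prod>b\<in>Basis. inverse (1 + (\<zeta> \<bullet> b)\<^sup>2))" for \<zeta>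
  proof -
    have "(\<Prod>b\<in>Basis. 1 + (\<zeta> \<bullet> b)\<^sup>2) > 0" by (intro prod_pos) (auto simp: add_pos_nonneg)
    moreover have "(\<Prod>b\<in>Basis. inverse (1 + (\<zeta> \<bullet> b)\<^sup>2)) = inverse (\<Prod>b\<in>Basis. 1 + (\<zeta> \<bullet> b)\<^sup>2)"
      using prod_inversef[of "\<lambda>b. 1 + (\<zeta> \<bullet> b)\<^sup>2" Basis] by (simp add: comp_def)
    ultimately show ?thesis
      using C[of \<zeta>] by (simp only: divide_inverse[symmetric] pos_le_divide_eq mult.commute)
  qed
  then show ?thesis using that by blast
qed

lemma inv_fourier_measurable [measurable]:
  assumes [measurable]: "\<psi> \<in> borel_measurable borel"
  shows "inv_fourier \<psi> \<in> borel_measurable (borel :: 'a::euclidean_space measure)"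
  unfolding inv_fourier_def[abs_def] by measurable

lemma inv_fourier_integrable:
  fixes \<psi> :: "'a::euclidean_space \<Rightarrow> complex"
  assumes \<psi>: "test_function \<Omega> \<psi>"
  shows "integrable lborel (inv_fourier \<psi>)" "square_integrable (inv_fourier \<psi>)"
proof -
  note [measurable] = test_functionD(3)[OF \<psi>]
  let ?w = "\<lambda>\<zeta>::'a. \<Prod>b\<in>Basis. inverse (1 + (\<zeta> \<bullet> b)\<^sup>2)"
  obtain C where C: "\<And>\<zeta>. cmod (inv_fourier \<psi> \<zeta>) \<le> C * ?w \<zeta>" using inv_fourier_decay[OF \<psi>] by blast
  note w = one_plus_square_weight[where 'a='a]
  show "integrable lborel (inv_fourier \<psi>)"
    by (rule Bochner_Integration.integrable_bound[OF integrable_mult_right[OF w(1), of C]])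
       (use C in \<open>auto intro: order_trans[OF _ abs_ge_self]\<close>)
  have "(cmod (inv_fourier \<psi> \<zeta>))\<^sup>2 \<le> C\<^sup>2 * ?w \<zeta>" for \<zeta>
  proof -
    have "(cmod (inv_fourier \<psi> \<zeta>))\<^sup>2 \<le> (C * ?w \<zeta>)\<^sup>2" using C by (intro power_mono) auto
    also have "\<dots> = C\<^sup>2 * (?w \<zeta> * ?w \<zeta>)" by (simp add: power2_eq_square mult_ac)
    also have "\<dots> \<le> C\<^sup>2 * ?w \<zeta>" using w(2,3)[of \<zeta>] by (intro mult_left_mono mult_left_le) auto
    finally show ?thesis .
  qed
  then have "integrable lborel (\<lambda>\<zeta>. (cmod (inv_fourier \<psi> \<zeta>))\<^sup>2)"
    by (intro Bochner_Integration.integrable_bound[OF integrable_mult_right[OF w(1), of "C\<^sup>2"]])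
       (auto intro: order_trans[OF _ abs_ge_self])
  then show "square_integrable (inv_fourier \<psi>)" by (simp add: square_integrable_def)
qed

text \<open>The Gaussian-damped integral \<open>G n\<close> has two limits. By
  \<open>gauss_damped_inversion\<close> it is a heat average of \<open>\<psi>\<close> and tends to
  \<open>\<psi> w\<close>; by dominated convergence it tends to the undamped Fourier
  integral.\<close>

lemma fourier_inv_fourier:
  fixes \<psi> :: "'a::euclidean_space \<Rightarrow> complex"
  assumes \<psi>: "test_function \<Omega> \<psi>"
  shows "fourier (inv_fourier \<psi>) w = \<psi> w"
proof -
  note [measurable] = test_functionD(3)[OF \<psi>]
  note gi = inv_fourier_integrable(1)[OF \<psi>]
  let ?g = "inv_fourier \<psi>"
  let ?e = "\<lambda>\<epsilon> (\<zeta>::'a). complex_of_real (exp (- \<epsilon> * (norm \<zeta>)\<^sup>2)) * exp (- (\<i> * of_real (\<zeta> \<bullet> w)))"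
  define h where "h n = inverse (real (Suc n))" for n
  have h: "h n > 0" for n by (auto simp: h_def)
  have hl: "h \<longlonglongrightarrow> 0" unfolding h_def by (rule LIMSEQ_inverse_real_of_nat)
  have hr: "filterlim h (at_right 0) sequentially"
    using hl h by (auto simp: filterlim_at order_less_imp_not_eq2[OF h])
  define G where "G n = (LINT \<zeta>|lborel. ?e (h n) \<zeta> * ?g \<zeta>)" for n
  have "G = (\<lambda>n. LINT y|lborel. of_real (heat_kernel (h n) y) * \<psi> (w + y))"
  proof
    fix n
    have "of_real ((2 * pi) ^ DIM('a)) * G n = (LINT \<zeta>|lborel. ?e (h n) \<zeta>
            * (LINT z|lborel. exp (\<i> * of_real (z \<bullet> \<zeta>)) * \<psi> z))"
      unfolding G_def integral_mult_right_zero[symmetric]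
      by (intro Bochner_Integration.integral_cong refl) (simp add: inv_fourier_def inner_commute)
    also have "\<dots> = of_real ((2 * pi) ^ DIM('a)) * (LINT z|lborel. \<psi> z * of_real (heat_kernel (h n) (w - z)))"
      by (rule gauss_damped_inversion[OF test_functionD(8)[OF \<psi>] h])
    also have "(LINT z|lborel. \<psi> z * of_real (heat_kernel (h n) (w - z))) = (LINT y|lborel. \<psi> (w + y) * of_real (heat_kernel (h n) (w - (w + y))))"
      by (rule lborel_integral_translate[symmetric]) measurable
    finally show "G n = (LINT y|lborel. of_real (heat_kernel (h n) y) * \<psi> (w + y))"
      by (simp add: mult.commute)
  qed
  moreover
  have "((\<lambda>\<epsilon>. LINT y|lborel. of_real (heat_kernel \<epsilon> y) * \<psi> (w + y)) \<longlongrightarrow> \<psi> w) (at_right 0)"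
  proof -
    obtain M where M: "\<And>z. cmod (\<psi> z) \<le> M" using test_functionD(7)[OF \<psi>] by blast
    show ?thesis
      by (rule heat_kernel_approx[OF _ M])
         (use test_functionD(2)[OF \<psi>] in \<open>auto simp: continuous_on_eq_continuous_at\<close>)
  qed
  from filterlim_compose[OF this hr]
  have "(\<lambda>n. LINT y|lborel. of_real (heat_kernel (h n) y) * \<psi> (w + y)) \<longlonglongrightarrow> \<psi> w" .
  ultimately have "G \<longlonglongrightarrow> \<psi> w" by simp
  moreover have "G \<longlonglongrightarrow> (LINT \<zeta>|lborel. of_real (exp (- 0 * (norm \<zeta>)\<^sup>2)) * exp (- (\<i> * of_real (\<zeta> \<bullet> w))) * ?g \<zeta>)"
    unfolding G_def
  proof (rule integral_dominated_convergence)
    show "integrable lborel (\<lambda>\<zeta>. cmod (?g \<zeta>))" using gi by simp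
    show "AE \<zeta> in lborel. (\<lambda>n. ?e (h n) \<zeta> * ?g \<zeta>)
       \<longlonglongrightarrow> of_real (exp (- 0 * (norm \<zeta>)\<^sup>2)) * exp (- (\<i> * of_real (\<zeta> \<bullet> w))) * ?g \<zeta>"
      by (intro AE_I2 tendsto_intros hl)
    show "AE \<zeta> in lborel. cmod (?e (h n) \<zeta> * ?g \<zeta>) \<le> cmod (?g \<zeta>)" for n
      using h[of n] by (intro AE_I2) (auto simp: norm_mult intro!: mult_left_le_one_le)
  qed auto
  ultimately show ?thesis
    using LIMSEQ_unique by (fastforce simp: fourier_def inner_commute)
qed

subsection \<open>Fractional powers as integrals over the semigroup\<close>

lemma integrable_lborel_if_integrable_on:
  fixes f :: "real \<Rightarrow> real"
  assumes "f integrable_on S" "\<And>x. x \<in> S \<Longrightarrow> 0 \<le> f x" "f \<in> borel_measurable borel" "S \<in> sets borel"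
  shows "integrable lborel (\<lambda>x. indicator S x * f x)"
proof -
  have "f absolutely_integrable_on S" using assms(1,2) by (rule nonnegative_absolutely_integrable_1)
  then have "integrable lebesgue (\<lambda>x. indicator S x *\<^sub>R f x)" by (simp add: set_integrable_def)
  then show ?thesis using assms(3,4) by (subst (asm) integrable_completion) auto
qed

text \<open>Dominates \<open>frac_integrand s h\<close> for Re h \<ge> 0 and |h| = r, since |exp (-
  h / \<eta>) - 1| is at most 2 and at most r / \<eta>.\<close>

definition frac_majorant :: "real \<Rightarrow> real \<Rightarrow> real \<Rightarrow> real" where
  "frac_majorant s r \<eta> = indicator {0<..} \<eta> * min 2 (r / \<eta>) * \<eta> powr (s - 1)"

text \<open>The bound 2 is used on (0, 1], where the power s - 1 is integrable because s > 0. The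
  bound r / \<eta> is used beyond 1, where it gives the power s - 2, integrable because s <
  1.\<close>

lemma frac_majorant_integrable:
  assumes s: "0 < s" "s < 1" and r: "r \<ge> 0"
  shows "integrable lborel (frac_majorant s r)"
proof -
  have i1: "integrable lborel (\<lambda>\<eta>. indicator {0..1} \<eta> * \<eta> powr (s - 1))"
    by (rule integrable_lborel_if_integrable_on) (use s in \<open>auto intro!: integrable_on_powr_from_0\<close>)
  have "(\<lambda>\<eta>. \<eta> powr (s - 2)) integrable_on {1..}"
    using has_integral_powr_to_inf[of "s - 2" 1] s by (auto simp: integrable_on_def)
  then have i2: "integrable lborel (\<lambda>\<eta>. indicator {1..} \<eta> * \<eta> powr (s - 2))"
    by (rule integrable_lborel_if_integrable_on) auto
  show ?thesis
  proof (rule Bochner_Integration.integrable_bound)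
    show "integrable lborel (\<lambda>\<eta>. 2 * (indicator {0..1} \<eta> * \<eta> powr (s - 1)) + r * (indicator {1..} \<eta> * \<eta> powr (s - 2)))"
      using i1 i2 by (intro Bochner_Integration.integrable_add integrable_mult_right)
    show "frac_majorant s r \<in> borel_measurable lborel" unfolding frac_majorant_def[abs_def] by measurable
    show "AE \<eta> in lborel. norm (frac_majorant s r \<eta>)
       \<le> norm (2 * (indicator {0..1} \<eta> * \<eta> powr (s - 1)) + r * (indicator {1..} \<eta> * \<eta> powr (s - 2)))"
    proof (rule AE_I2)
      fix \<eta> :: real
      consider "\<eta> \<le> 0" | "0 < \<eta>" "\<eta> \<le> 1" | "\<eta> > 1" by linarith
      then show "norm (frac_majorant s r \<eta>)
       \<le> norm (2 * (indicator {0..1} \<eta> * \<eta> powr (s - 1)) + r * (indicator {1..} \<eta> * \<eta> powr (s - 2)))"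
      proof cases
        case 2
        have "min 2 (r / \<eta>) * \<eta> powr (s - 1) \<le> 2 * \<eta> powr (s - 1)" by (intro mult_right_mono) auto
        moreover have "0 \<le> r * (indicator {1..} \<eta> * \<eta> powr (s - 2))" using r by simp
        moreover have "0 \<le> min 2 (r / \<eta>) * \<eta> powr (s - 1)" using 2 r by simp
        ultimately have "\<bar>min 2 (r / \<eta>) * \<eta> powr (s - 1)\<bar>
          \<le> \<bar>2 * \<eta> powr (s - 1) + r * (indicator {1..} \<eta> * \<eta> powr (s - 2))\<bar>" by linarith
        then show ?thesis using 2 by (simp add: frac_majorant_def)
      next
        case 3
        have "\<eta> powr (s - 1) = \<eta> * \<eta> powr (s - 2)" using 3 by (simp add: powr_mult_base)
        then have "(r / \<eta>) * \<eta> powr (s - 1) = r * \<eta> powr (s - 2)" using 3 by simp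
        moreover have "min 2 (r / \<eta>) * \<eta> powr (s - 1) \<le> (r / \<eta>) * \<eta> powr (s - 1)" by (intro mult_right_mono) auto
        moreover have "0 \<le> min 2 (r / \<eta>) * \<eta> powr (s - 1)" using 3 r by simp
        ultimately show ?thesis using 3 r by (simp add: frac_majorant_def)
      qed (simp add: frac_majorant_def)
    qed
  qed
qed

lemma frac_majorant_nonneg: "r \<ge> 0 \<Longrightarrow> frac_majorant s r \<eta> \<ge> 0"
  by (auto simp: frac_majorant_def split: split_indicator)

text \<open>The mean value inequality on a half-plane, which is convex and on which exp is bounded
  by exp (- m).\<close>

lemma exp_minus_lipschitz:
  fixes a b :: complex
  assumes "Re a \<ge> m" "Re b \<ge> m"
  shows "cmod (exp (- a) - exp (- b)) \<le> exp (- m) * cmod (a - b)"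
proof -
  have "cmod (exp (- a) - exp (- b)) \<le> exp (- m) * cmod (- a - - b)"
  proof (rule field_differentiable_bound[where S="{z. Re z \<le> - m}" and f'=exp])
    show "convex {z. Re z \<le> - m}" by (rule convex_halfspace_Re_le)
    show "(exp has_field_derivative exp z) (at z within {z. Re z \<le> - m})" for z
      by (rule DERIV_subset[OF DERIV_exp]) simp
  qed (use assms in auto)
  also have "cmod (- a - - b) = cmod (a - b)" by (simp add: norm_minus_commute)
  finally show ?thesis .
qed

text \<open>
  This is \<open>\<Gamma> (- s) h powr s = \<integral> (exp (- \<tau> h) - 1) \<tau> powr (- 1 - s) d\<tau>\<close> in the variable \<open>\<eta> = 1 / \<tau>\<close>, in which
  the factor \<open>h\<close> raises the power of \<open>\<eta>\<close> by one.
\<close>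

definition frac_integrand :: "real \<Rightarrow> complex \<Rightarrow> real \<Rightarrow> complex" where
  "frac_integrand s h \<eta> = indicator {0<..} \<eta> * ((exp (- (h / of_real \<eta>)) - 1) * of_real (\<eta> powr (s - 1)))"

definition frac_integral :: "real \<Rightarrow> complex \<Rightarrow> complex" where
  "frac_integral s h = (LINT \<eta>|lborel. frac_integrand s h \<eta>)"

lemma frac_integrand_measurable [measurable]: "frac_integrand s h \<in> borel_measurable borel"
  unfolding frac_integrand_def[abs_def] by measurable

lemma frac_integrand_measurable_pair:
  "(\<lambda>(h, \<eta>). frac_integrand s h \<eta>) \<in> borel_measurable (borel \<Otimes>\<^sub>M borel)"
  unfolding frac_integrand_def by measurable

lemma frac_integrand_bound:
  assumes "Re h \<ge> 0"
  shows "cmod (frac_integrand s h \<eta>) \<le> frac_majorant s (cmod h) \<eta>"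
proof (cases "\<eta> > 0")
  case True
  have R: "Re (h / of_real \<eta>) \<ge> 0" using assms True by (simp add: Re_divide_of_real)
  have "cmod (exp (- (h / of_real \<eta>)) - exp (- 0)) \<le> exp (- 0) * cmod (h / of_real \<eta> - 0)"
    by (rule exp_minus_lipschitz) (use R in auto)
  then have 1: "cmod (exp (- (h / of_real \<eta>)) - 1) \<le> cmod h / \<eta>" using True by (simp add: norm_divide)
  have "cmod (exp (- (h / of_real \<eta>)) - 1) \<le> cmod (exp (- (h / of_real \<eta>))) + cmod 1" by (rule norm_triangle_ineq4)
  also have "\<dots> \<le> 2" using R by simp
  finally have "cmod (exp (- (h / of_real \<eta>)) - 1) \<le> min 2 (cmod h / \<eta>)" using 1 by simp
  then show ?thesis using True by (simp add: frac_integrand_def frac_majorant_def norm_mult mult_right_mono)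
qed (simp add: frac_integrand_def frac_majorant_def)

lemma frac_integrand_integrable:
  assumes "0 < s" "s < 1" "Re h \<ge> 0"
  shows "integrable lborel (frac_integrand s h)"
  by (rule Bochner_Integration.integrable_bound[OF frac_majorant_integrable[OF assms(1,2) norm_ge_zero[of h]]])
     (use frac_integrand_bound[OF assms(3)] in \<open>auto simp: frac_majorant_nonneg\<close>)

lemma frac_integral_scale:
  assumes r: "r > 0"
  shows "frac_integral s (of_real r * h) = of_real (r powr s) * frac_integral s h"
proof -
  have "frac_integral s (of_real r * h) = \<bar>r\<bar> *\<^sub>R (LINT \<eta>|lborel. frac_integrand s (of_real r * h) (0 + r * \<eta>))"
    unfolding frac_integral_def using r by (intro lborel_integral_real_affine) auto
  also have "(\<lambda>\<eta>. frac_integrand s (of_real r * h) (0 + r * \<eta>)) = (\<lambda>\<eta>. of_real (r powr (s - 1)) * frac_integrand s h \<eta>)"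
    using r by (auto simp: frac_integrand_def powr_mult indicator_def zero_less_mult_iff fun_eq_iff)
  also have "\<bar>r\<bar> *\<^sub>R (LINT \<eta>|lborel. of_real (r powr (s - 1)) * frac_integrand s h \<eta>)
     = of_real (r * r powr (s - 1)) * frac_integral s h"
    using r by (simp add: frac_integral_def scaleR_conv_of_real)
  also have "r * r powr (s - 1) = r powr s" using r by (simp add: powr_mult_base)
  finally show ?thesis .
qed

text \<open>Differentiation under the integral sign. With r = Re h0 / 2, increments shorter than r
  stay in the half-plane Re h \<ge> r, where the difference quotients of the exponential are at most
  exp (- r / \<eta>) / \<eta>; this is dominated uniformly in the increment.\<close>

lemma frac_integral_holomorphic:
  assumes s: "0 < s" "s < 1"
  shows "frac_integral s holomorphic_on {h. Re h > 0}"
proof -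
  have "\<exists>D. (frac_integral s has_field_derivative D) (at h0)" if h0: "Re h0 > 0" for h0
  proof -
    define r where "r = Re h0 / 2"
    have r: "r > 0" using h0 by (simp add: r_def)
    define D where "D \<eta> = indicator {0<..} \<eta> * (- exp (- (h0 / of_real \<eta>)) / of_real \<eta> * of_real (\<eta> powr (s - 1)))" for \<eta>
    define S where "S = {k. cmod k < r}"
    have Sopen: "open S" "0 \<in> S" using r by (auto simp: S_def intro!: open_Collect_less continuous_intros)
    have Re: "Re (h0 + k) \<ge> r" if "k \<in> S" for k
      using that abs_Re_le_cmod[of k] by (simp add: S_def r_def)
    have "((\<lambda>k. (frac_integral s (h0 + k) - frac_integral s h0) / k) \<longlongrightarrow> (LINT \<eta>|lborel. D \<eta>)) (at 0 within S)"
      unfolding tendsto_at_iff_sequentially comp_def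
    proof (intro allI impI)
      fix X :: "nat \<Rightarrow> complex" assume X: "\<forall>i. X i \<in> S - {0}" "X \<longlonglongrightarrow> 0"
      let ?Q = "\<lambda>i \<eta>. (frac_integrand s (h0 + X i) \<eta> - frac_integrand s h0 \<eta>) / X i"
      have int: "integrable lborel (frac_integrand s (h0 + X i))" "integrable lborel (frac_integrand s h0)" for i
        using Re[of "X i"] X(1) r h0 by (intro frac_integrand_integrable s; force)+
      have eq: "(frac_integral s (h0 + X i) - frac_integral s h0) / X i
         = (LINT \<eta>|lborel. ?Q i \<eta>)" for i
        using int by (simp add: frac_integral_def)
      have "(\<lambda>i. LINT \<eta>|lborel. ?Q i \<eta>) \<longlonglongrightarrow> (LINT \<eta>|lborel. D \<eta>)"
      proof (rule integral_dominated_convergence)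
        show "integrable lborel (\<lambda>\<eta>. frac_majorant s r \<eta> / r)"
          using r by (intro integrable_divide frac_majorant_integrable s) simp
        show "AE \<eta> in lborel. cmod (?Q i \<eta>) \<le> frac_majorant s r \<eta> / r" for i
        proof (rule AE_I2)
          fix \<eta> :: real
          show "cmod (?Q i \<eta>) \<le> frac_majorant s r \<eta> / r"
          proof (cases "\<eta> > 0")
            case True
            let ?a = "(h0 + X i) / of_real \<eta>" and ?b = "h0 / of_real \<eta>"
            have "X i \<in> S" "X i \<noteq> 0" using X(1) by auto
            have "cmod (exp (- ?a) - exp (- ?b)) \<le> exp (- (r / \<eta>)) * cmod (?a - ?b)"
            proof (rule exp_minus_lipschitz)
              show "r / \<eta> \<le> Re ?a" using Re[OF \<open>X i \<in> S\<close>] True by (simp add: Re_divide_of_real divide_right_mono del: plus_complex.simps)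
              show "r / \<eta> \<le> Re ?b" using True h0 divide_right_mono[of r "Re h0" \<eta>] by (simp add: Re_divide_of_real r_def)
            qed
            also have "?a - ?b = X i / of_real \<eta>" by (simp add: add_divide_distrib)
            finally have 1: "cmod (exp (- ?a) - exp (- ?b)) \<le> exp (- (r / \<eta>)) / \<eta> * cmod (X i)"
              using True by (simp add: norm_divide)
            \<comment> \<open>For x > 0 the product exp (- x) * x is at most 1 and at most x. The
              weaker bound 2 is chosen so that \<open>frac_majorant s r\<close> can be reused as
              majorant.\<close>
            have "exp (- (r / \<eta>)) * (r / \<eta>) \<le> min 2 (r / \<eta>)"
            proof -
              have p: "r / \<eta> > 0" using r True by simp
              have "r / \<eta> \<le> exp (r / \<eta>)" using exp_ge_add_one_self[of "r / \<eta>"] by linarith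
              then have "exp (- (r / \<eta>)) * (r / \<eta>) \<le> exp (- (r / \<eta>)) * exp (r / \<eta>)" by (intro mult_left_mono) auto
              then have "exp (- (r / \<eta>)) * (r / \<eta>) \<le> 1" by (simp flip: exp_add)
              moreover have "exp (- (r / \<eta>)) * (r / \<eta>) \<le> 1 * (r / \<eta>)" using p by (intro mult_right_mono) auto
              ultimately show ?thesis by simp
            qed
            then have 2: "exp (- (r / \<eta>)) / \<eta> \<le> min 2 (r / \<eta>) / r" using r by (simp add: field_simps)
            have "cmod (?Q i \<eta>)
               = cmod (exp (- ?a) - exp (- ?b)) / cmod (X i) * \<eta> powr (s - 1)"
              using True by (simp add: frac_integrand_def norm_mult norm_divide flip: left_diff_distrib)
            also have "\<dots> \<le> exp (- (r / \<eta>)) / \<eta> * \<eta> powr (s - 1)"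
              using 1 \<open>X i \<noteq> 0\<close> by (intro mult_right_mono) (auto simp: pos_divide_le_eq)
            also have "\<dots> \<le> min 2 (r / \<eta>) / r * \<eta> powr (s - 1)" using 2 by (intro mult_right_mono) auto
            finally show ?thesis using True by (simp add: frac_majorant_def)
          qed (simp add: frac_integrand_def frac_majorant_def)
        qed
        show "AE \<eta> in lborel. (\<lambda>i. ?Q i \<eta>) \<longlonglongrightarrow> D \<eta>"
        proof (rule AE_I2)
          fix \<eta> :: real
          show "(\<lambda>i. ?Q i \<eta>) \<longlonglongrightarrow> D \<eta>"
          proof (cases "\<eta> > 0")
            case True
            have "((\<lambda>h. frac_integrand s h \<eta>) has_field_derivative D \<eta>) (at h0)"
              unfolding frac_integrand_def D_def using True by (auto intro!: derivative_eq_intros)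
            then have "(\<lambda>k. (frac_integrand s (h0 + k) \<eta> - frac_integrand s h0 \<eta>) / k) \<midarrow>0\<rightarrow> D \<eta>"
              by (simp add: DERIV_def)
            moreover have "filterlim X (at 0) sequentially" using X by (auto simp: filterlim_at)
            ultimately show ?thesis by (rule filterlim_compose)
          qed (simp add: frac_integrand_def D_def)
        qed
        show "D \<in> borel_measurable lborel" unfolding D_def[abs_def] by measurable
      qed measurable
      then show "(\<lambda>i. (frac_integral s (h0 + X i) - frac_integral s h0) / X i) \<longlonglongrightarrow> (LINT \<eta>|lborel. D \<eta>)"
        unfolding eq .
    qed
    then have "((\<lambda>k. (frac_integral s (h0 + k) - frac_integral s h0) / k) \<longlongrightarrow> (LINT \<eta>|lborel. D \<eta>)) (at 0)"
      using at_within_open[OF Sopen(2,1)] by simp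
    then show ?thesis unfolding DERIV_def by blast
  qed
  then show ?thesis
    unfolding holomorphic_on_def field_differentiable_def
    by (metis has_field_derivative_at_within mem_Collect_eq)
qed

text \<open>On the positive reals the formula is the scaling rule. Both sides are holomorphic for Re
  h > 0, the power in its principal branch, so analytic continuation extends it. The constant
  \<open>frac_integral s 1\<close> is Gamma (- s).\<close>

lemma frac_integral_eq_powr:
  assumes s: "0 < s" "s < 1" and h: "Re h > 0"
  shows "frac_integral s h = h powr of_real s * frac_integral s 1"
proof -
  have "(\<lambda>h. frac_integral s h - h powr of_real s * frac_integral s 1) h = 0"
  proof -
    let ?S = "{h. Re h > 0}" and ?U = "complex_of_real ` {0<..}"
    let ?f = "\<lambda>h. frac_integral s h - h powr of_real s * frac_integral s 1"
    have hol: "?f holomorphic_on ?S"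
      by (intro holomorphic_intros frac_integral_holomorphic s) (auto simp: complex_nonpos_Reals_iff)
    have S: "open ?S" by (rule open_halfspace_Re_gt)
    have conn: "connected ?S" by (rule convex_connected) (rule convex_halfspace_Re_gt)
    have lim: "(1::complex) islimpt ?U"
    proof -
      have "(\<lambda>n. complex_of_real (1 + inverse (real (Suc n)))) \<longlonglongrightarrow> complex_of_real (1 + 0)"
        by (intro tendsto_intros LIMSEQ_inverse_real_of_nat)
      then show ?thesis unfolding islimpt_sequential
        by (intro exI[of _ "\<lambda>n. complex_of_real (1 + inverse (real (Suc n)))"])
           (auto simp del: of_nat_Suc simp: add_pos_pos image_iff intro!: bexI[of _ "1 + inverse (real (Suc _))"])
    qed
    have zero: "?f z = 0" if "z \<in> ?U" for z
      using that frac_integral_scale[of _ s 1] by (auto simp: powr_of_real)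
    show ?thesis
      by (rule analytic_continuation[OF hol S conn _ _ lim zero]) (use h in auto)
  qed
  then show ?thesis by simp
qed

subsection \<open>The Fourier--Plancherel transform\<close>

text \<open>The square of the L2 norm. Young's inequality with a free parameter takes the role of
  Cauchy-Schwarz, so all estimates are stated for squares.\<close>

definition L2_sq :: "('a::euclidean_space \<Rightarrow> complex) \<Rightarrow> real" where
  "L2_sq f = (LINT z|lborel. (cmod (f z))\<^sup>2)"

lemma L2_sq_nonneg: "L2_sq f \<ge> 0"
  by (simp add: L2_sq_def)

lemma young_cmod: "e > 0 \<Longrightarrow> cmod (a * b) \<le> ((cmod a)\<^sup>2 / e + e * (cmod b)\<^sup>2) / 2"
proof -
  assume e: "e > 0"
  have "0 \<le> (cmod a - e * cmod b)\<^sup>2" by simp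
  then have "2 * e * (cmod a * cmod b) \<le> (cmod a)\<^sup>2 + e\<^sup>2 * (cmod b)\<^sup>2"
    by (simp add: power2_diff power_mult_distrib mult_ac)
  then show ?thesis using e by (simp add: norm_mult field_simps power2_eq_square)
qed

lemma square_integrable_mult:
  assumes a: "square_integrable a" and b: "square_integrable b"
  shows "integrable lborel (\<lambda>z. a z * b z)"
    and "e > 0 \<Longrightarrow> (LINT z|lborel. cmod (a z * b z)) \<le> (L2_sq a / e + e * L2_sq b) / 2"
proof -
  have [measurable]: "a \<in> borel_measurable borel" "b \<in> borel_measurable borel"
    and a2: "integrable lborel (\<lambda>z. (cmod (a z))\<^sup>2)" and b2: "integrable lborel (\<lambda>z. (cmod (b z))\<^sup>2)"
    using a b by (auto simp: square_integrable_def)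
  have i: "integrable lborel (\<lambda>z. ((cmod (a z))\<^sup>2 / e + e * (cmod (b z))\<^sup>2) / 2)" for e
    using a2 b2 by (intro integrable_divide Bochner_Integration.integrable_add integrable_mult_right)
  show I: "integrable lborel (\<lambda>z. a z * b z)"
    by (rule Bochner_Integration.integrable_bound[OF i[of 1]])
       (use young_cmod[of 1] in \<open>auto intro: order_trans[OF _ abs_ge_self]\<close>)
  show "(LINT z|lborel. cmod (a z * b z)) \<le> (L2_sq a / e + e * L2_sq b) / 2" if e: "e > 0"
  proof -
    have "(LINT z|lborel. cmod (a z * b z)) \<le> (LINT z|lborel. ((cmod (a z))\<^sup>2 / e + e * (cmod (b z))\<^sup>2) / 2)"
      by (intro integral_mono i integrable_norm I young_cmod e)
    also have "\<dots> = (L2_sq a / e + e * L2_sq b) / 2"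
      using a2 b2 by (simp add: L2_sq_def)
    finally show ?thesis .
  qed
qed

lemma fourier_measurable [measurable]:
  assumes [measurable]: "f \<in> borel_measurable borel"
  shows "fourier f \<in> borel_measurable (borel :: 'a::euclidean_space measure)"
  unfolding fourier_def[abs_def] by measurable

text \<open>Transposition of the Fourier transform, through which information on \<open>v\<close> is
  turned into information on \<open>u\<close>. The truncations \<open>f n\<close> are integrable, so
  Fubini applies to them. Then the side of \<open>u\<close> converges by domination and the side of
  \<open>v\<close> by the L2 limit in \<open>has_fourier_L2\<close>.\<close>

lemma has_fourier_L2_transfer:
  fixes u v g :: "'a::euclidean_space \<Rightarrow> complex"
  assumes uv: "has_fourier_L2 u v" and g1: "integrable lborel g" and g2: "square_integrable g"
    and Fg: "square_integrable (fourier g)"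
  shows "(LINT \<zeta>|lborel. v \<zeta> * g \<zeta>) = (LINT z|lborel. u z * fourier g z)"
proof -
  have u: "square_integrable u" and v: "square_integrable v"
    and lim: "((\<lambda>R::real. \<integral>\<^sup>+\<zeta>. ennreal ((cmod (fourier (\<lambda>z. indicator (cball 0 R) z * u z) \<zeta> - v \<zeta>))\<^sup>2) \<partial>lborel) \<longlongrightarrow> 0) at_top"
    using uv by (auto simp: has_fourier_L2_def)
  have [measurable]: "u \<in> borel_measurable borel" "v \<in> borel_measurable borel" "g \<in> borel_measurable borel"
    using u v g2 by (auto simp: square_integrable_def)
  have [measurable]: "cball 0 r \<in> sets (borel :: 'a measure)" for r by (rule borel_closed) simp
  define f where "f n z = indicator (cball 0 (real n)) z * u z" for n and z :: 'a
  have [measurable]: "f n \<in> borel_measurable borel" for n unfolding f_def[abs_def] by measurable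
  have f1: "integrable lborel (f n)" for n
  proof (rule Bochner_Integration.integrable_bound)
    show "integrable lborel (\<lambda>z::'a. indicator (cball 0 (real n)) z + (cmod (u z))\<^sup>2)"
      using u emeasure_bounded_finite[of "cball 0 (real n) :: 'a set"]
      by (intro Bochner_Integration.integrable_add integrable_real_indicator) (auto simp: square_integrable_def)
    show "AE z in lborel. cmod (f n z) \<le> norm (indicator (cball 0 (real n)) z + (cmod (u z))\<^sup>2)"
    proof (rule AE_I2)
      fix z :: 'a
      have "2 * cmod (u z) \<le> 1 + (cmod (u z))\<^sup>2" using sum_squares_bound[of 1 "cmod (u z)"] by simp
      moreover have "0 \<le> cmod (u z)" by simp
      ultimately have "cmod (u z) \<le> 1 + (cmod (u z))\<^sup>2" by linarith
      then show "cmod (f n z) \<le> norm (indicator (cball 0 (real n)) z + (cmod (u z))\<^sup>2)"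
        by (simp add: f_def indicator_def)
    qed
  qed measurable
  have swap: "(LINT \<zeta>|lborel. fourier (f n) \<zeta> * g \<zeta>) = (LINT z|lborel. f n z * fourier g z)" for n
  proof -
    let ?k = "\<lambda>z \<zeta>. exp (- (\<i> * of_real (z \<bullet> \<zeta>))) * f n z * g \<zeta>"
    have "(LINT \<zeta>|lborel. fourier (f n) \<zeta> * g \<zeta>) = (LINT \<zeta>|lborel. LINT z|lborel. ?k z \<zeta>)"
      by (simp add: fourier_def)
    also have "\<dots> = (LINT z|lborel. LINT \<zeta>|lborel. ?k z \<zeta>)"
    proof (rule lborel_pair.Fubini_integral, rule fubini_integrable_bound)
      show "integrable lborel (\<lambda>z. cmod (f n z))" "integrable lborel (\<lambda>z. cmod (g z))" using f1 g1 by auto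
      show "cmod (case (z, \<zeta>) of (z, \<zeta>) \<Rightarrow> ?k z \<zeta>) \<le> norm (cmod (f n z)) * norm (cmod (g \<zeta>))" for z \<zeta>
        by (simp add: norm_mult)
    qed (auto intro: lborel.sigma_finite_measure_axioms)
    also have "\<dots> = (LINT z|lborel. f n z * fourier g z)"
    proof (intro Bochner_Integration.integral_cong refl)
      fix z :: 'a
      have "?k z \<zeta> = f n z * (exp (- (\<i> * of_real (\<zeta> \<bullet> z))) * g \<zeta>)" for \<zeta> by (simp add: inner_commute)
      then show "(LINT \<zeta>|lborel. ?k z \<zeta>) = f n z * fourier g z" by (simp only: fourier_def integral_mult_right_zero)
    qed
    finally show ?thesis .
  qed
  have "(\<lambda>n. LINT z|lborel. f n z * fourier g z) \<longlonglongrightarrow> (LINT z|lborel. u z * fourier g z)"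
  proof (rule integral_dominated_convergence)
    show "integrable lborel (\<lambda>z. cmod (u z * fourier g z))"
      using square_integrable_mult(1)[OF u Fg] by simp
    show "AE z in lborel. (\<lambda>n. f n z * fourier g z) \<longlonglongrightarrow> u z * fourier g z"
    proof (intro AE_I2 tendsto_mult tendsto_const)
      fix z :: 'a
      obtain N where "norm z \<le> real N" using real_arch_simple by blast
      then have "\<forall>\<^sub>F n in sequentially. u z = f n z"
        by (intro eventually_sequentiallyI[of N]) (auto simp: f_def)
      then show "(\<lambda>n. f n z) \<longlonglongrightarrow> u z" by (rule Lim_transform_eventually[OF tendsto_const])
    qed
    show "AE z in lborel. cmod (f n z * fourier g z) \<le> cmod (u z * fourier g z)" for n
      by (auto simp: f_def indicator_def)
  qed measurable
  moreover have "(\<lambda>n. LINT z|lborel. f n z * fourier g z) \<longlonglongrightarrow> (LINT \<zeta>|lborel. v \<zeta> * g \<zeta>)"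
  proof (rule tendstoI)
    fix e :: real assume e: "e > 0"
    \<comment> \<open>Young's inequality with parameter \<open>\<delta>\<close> bounds the error by
      (L2_sq d / \<delta> + \<delta> * L2_sq g) / 2. Once L2_sq d < \<delta>^2 this is at most
      \<delta> * (1 + L2_sq g) / 2 = e / 2.\<close>
    define \<delta> where "\<delta> = e / (1 + L2_sq g)"
    have \<delta>: "\<delta> > 0" using e L2_sq_nonneg[of g] by (auto simp: \<delta>_def intro!: divide_pos_pos)
    have "((\<lambda>n::nat. \<integral>\<^sup>+\<zeta>. ennreal ((cmod (fourier (f n) \<zeta> - v \<zeta>))\<^sup>2) \<partial>lborel) \<longlongrightarrow> 0) sequentially"
      unfolding f_def[abs_def] by (rule filterlim_compose[OF lim filterlim_real_sequentially])
    then have "\<forall>\<^sub>F n in sequentially. (\<integral>\<^sup>+\<zeta>. ennreal ((cmod (fourier (f n) \<zeta> - v \<zeta>))\<^sup>2) \<partial>lborel) < ennreal (\<delta>\<^sup>2)"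
      by (rule order_tendstoD) (use \<delta> in simp)
    then show "\<forall>\<^sub>F n in sequentially. dist (LINT z|lborel. f n z * fourier g z) (LINT \<zeta>|lborel. v \<zeta> * g \<zeta>) < e"
    proof eventually_elim
      case (elim n)
      let ?d = "\<lambda>\<zeta>. fourier (f n) \<zeta> - v \<zeta>"
      have di: "integrable lborel (\<lambda>\<zeta>. (cmod (?d \<zeta>))\<^sup>2)"
        by (rule integrableI_bounded) (use elim in \<open>auto intro: less_trans\<close>)
      then have d2: "square_integrable ?d" by (simp add: square_integrable_def)
      have "ennreal (L2_sq ?d) < ennreal (\<delta>\<^sup>2)"
        unfolding L2_sq_def using elim by (subst nn_integral_eq_integral[OF di, symmetric]) auto
      then have L: "L2_sq ?d < \<delta>\<^sup>2" by (subst (asm) ennreal_less_iff) (auto simp: L2_sq_nonneg)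
      have vg: "integrable lborel (\<lambda>\<zeta>. v \<zeta> * g \<zeta>)" and dg: "integrable lborel (\<lambda>\<zeta>. ?d \<zeta> * g \<zeta>)"
        using square_integrable_mult(1) v g2 d2 by blast+
      have "(LINT \<zeta>|lborel. fourier (f n) \<zeta> * g \<zeta>) = (LINT \<zeta>|lborel. ?d \<zeta> * g \<zeta> + v \<zeta> * g \<zeta>)"
        by (simp add: algebra_simps)
      also have "\<dots> = (LINT \<zeta>|lborel. ?d \<zeta> * g \<zeta>) + (LINT \<zeta>|lborel. v \<zeta> * g \<zeta>)"
        by (rule Bochner_Integration.integral_add[OF dg vg])
      finally have "dist (LINT z|lborel. f n z * fourier g z) (LINT \<zeta>|lborel. v \<zeta> * g \<zeta>) = cmod (LINT \<zeta>|lborel. ?d \<zeta> * g \<zeta>)"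
        by (simp add: swap dist_norm)
      also have "\<dots> \<le> (LINT \<zeta>|lborel. cmod (?d \<zeta> * g \<zeta>))" by (rule integral_norm_bound)
      also have "\<dots> \<le> (L2_sq ?d / \<delta> + \<delta> * L2_sq g) / 2" by (rule square_integrable_mult(2)[OF d2 g2 \<delta>])
      also have "\<dots> \<le> (\<delta> + \<delta> * L2_sq g) / 2"
        using L \<delta> by (simp add: divide_right_mono field_simps power2_eq_square)
      also have "\<dots> = \<delta> * (1 + L2_sq g) / 2" by (simp add: algebra_simps)
      also have "\<dots> = e / 2" using L2_sq_nonneg[of g] by (simp add: \<delta>_def)
      also have "\<dots> < e" using e by simp
      finally show ?case .
    qed
  qed
  ultimately show ?thesis using LIMSEQ_unique by metis
qed

subsection \<open>The heat flow tested in the region\<close>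

lemma heat_symbol_altdef: "heat_symbol \<zeta> = \<i> * of_real (fst \<zeta>) + of_real ((norm (snd \<zeta>))\<^sup>2)"
  by (simp add: heat_symbol_def split: prod.split)

lemma heat_symbol_measurable [measurable]: "heat_symbol \<in> borel_measurable borel"
  unfolding heat_symbol_altdef[abs_def] by (intro borel_measurable_continuous_onI continuous_intros)

lemma Re_heat_symbol: "Re (heat_symbol \<zeta>) = (norm (snd \<zeta>))\<^sup>2"
  unfolding heat_symbol_altdef by (simp add: Re_power2)

text \<open>The real part |\<xi>|^2 vanishes only for \<xi> = 0, a null set by Fubini. On that set
  the symbol is imaginary and lies outside the half-plane of
  \<open>frac_integral_eq_powr\<close>.\<close>

lemma AE_Re_heat_symbol_pos: "AE \<zeta> :: real \<times> (real ^ 'n) in lborel. Re (heat_symbol \<zeta>) > 0"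
proof -
  have "AE \<zeta> :: real \<times> (real ^ 'n) in lborel \<Otimes>\<^sub>M lborel. Re (heat_symbol \<zeta>) > 0"
  proof (rule lborel_pair.AE_pair_measure)
    have "open {\<zeta> :: real \<times> (real ^ 'n). 0 < Re (heat_symbol \<zeta>)}"
      unfolding Re_heat_symbol by (intro open_Collect_less continuous_intros)
    then show "{\<zeta> \<in> space (lborel \<Otimes>\<^sub>M lborel). 0 < Re (heat_symbol (\<zeta> :: real \<times> (real ^ 'n)))} \<in> sets (lborel \<Otimes>\<^sub>M lborel)"
      unfolding lborel_prod by simp
    have "{0 :: real ^ 'n} \<in> null_sets lborel" by (rule finite_imp_null_set_lborel) simp
    from AE_not_in[OF this] have "AE \<xi> :: real ^ 'n in lborel. Re (heat_symbol (\<rho>, \<xi>)) > 0" for \<rho>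
      by eventually_elim (simp add: Re_heat_symbol)
    then show "AE \<rho> in lborel. AE \<xi> :: real ^ 'n in lborel. Re (heat_symbol (\<rho>, \<xi>)) > 0" by simp
  qed
  then show ?thesis by (simp only: lborel_prod)
qed

lemma cmod_exp_heat_symbol: "\<tau> \<ge> 0 \<Longrightarrow> cmod (exp (- (of_real \<tau> * heat_symbol \<zeta>))) \<le> 1"
  by (simp add: Re_heat_symbol)

text \<open>The adjoint of the semigroup, which shifts time forward.\<close>

definition heat_average :: "real \<Rightarrow> (real \<times> (real ^ 'n) \<Rightarrow> complex) \<Rightarrow> real \<times> (real ^ 'n) \<Rightarrow> complex" where
  "heat_average \<tau> \<psi> z = (LINT y|lborel. of_real (heat_kernel \<tau> y) * \<psi> (z + (\<tau>, y)))"

lemma Pair_add_measurable [measurable]: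
  "(\<lambda>(y :: real ^ 'n, z :: real \<times> (real ^ 'n)). z + (\<tau>, y)) \<in> borel \<Otimes>\<^sub>M borel \<rightarrow>\<^sub>M borel"
  unfolding borel_prod by (rule borel_measurable_continuous_onI) (auto simp: case_prod_beta intro!: continuous_intros)

text \<open>The factor splits into exp (- i \<tau> \<rho>), a shift in time, and exp (- \<tau>
  |\<xi>|^2), the transform of the heat kernel. Writing the latter as an integral over
  \<open>y\<close> and exchanging integrals leaves the inversion formula at
  \<open>z + (\<tau>, y)\<close>.\<close>

lemma fourier_exp_heat_inv_fourier:
  fixes \<psi> :: "real \<times> (real ^ 'n) \<Rightarrow> complex"
  assumes \<psi>: "test_function \<Omega> \<psi>" and \<tau>: "\<tau> > 0"
  shows "fourier (\<lambda>\<zeta>. exp (- (of_real \<tau> * heat_symbol \<zeta>)) * inv_fourier \<psi> \<zeta>) z = heat_average \<tau> \<psi> z"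
proof -
  note [measurable] = test_functionD(3)[OF \<psi>]
  let ?g = "inv_fourier \<psi>"
  let ?k = "\<lambda>(\<zeta> :: real \<times> (real ^ 'n)) (y :: real ^ 'n). of_real (heat_kernel \<tau> y) * (exp (- (\<i> * of_real (\<zeta> \<bullet> (z + (\<tau>, y))))) * ?g \<zeta>)"
  have k: "exp (- (\<i> * of_real (\<zeta> \<bullet> z))) * (exp (- (of_real \<tau> * heat_symbol \<zeta>)) * ?g \<zeta>) = (LINT y|lborel. ?k \<zeta> y)" for \<zeta>
  proof -
    have e: "?k \<zeta> y = exp (- (\<i> * of_real (\<zeta> \<bullet> z))) * exp (- (\<i> * of_real (\<tau> * fst \<zeta>))) * ?g \<zeta>
       * (of_real (heat_kernel \<tau> y) * exp (\<i> * of_real (y \<bullet> (- snd \<zeta>))))" for y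
    proof -
      have "exp (- (\<i> * of_real (\<zeta> \<bullet> (z + (\<tau>, y))))) = exp (- (\<i> * of_real (\<zeta> \<bullet> z))) * exp (- (\<i> * of_real (\<tau> * fst \<zeta>)))
         * exp (\<i> * of_real (y \<bullet> (- snd \<zeta>)))"
        by (cases \<zeta>) (simp add: exp_add[symmetric] inner_add_right inner_commute[of y] algebra_simps)
      then show ?thesis by (simp only: mult_ac)
    qed
    have "exp (- (of_real \<tau> * heat_symbol \<zeta>)) = exp (- (\<i> * of_real (\<tau> * fst \<zeta>))) * of_real (exp (- \<tau> * (norm (- snd \<zeta>))\<^sup>2))"
      by (simp add: heat_symbol_altdef exp_add[symmetric] algebra_simps flip: exp_of_real)
    then show ?thesis
      unfolding e integral_mult_right_zero heat_kernel_fourier[OF \<tau>] by (simp only: mult_ac)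
  qed
  have "fourier (\<lambda>\<zeta>. exp (- (of_real \<tau> * heat_symbol \<zeta>)) * ?g \<zeta>) z = (LINT \<zeta>|lborel. LINT y|lborel. ?k \<zeta> y)"
    unfolding fourier_def k ..
  also have "\<dots> = (LINT y|lborel. LINT \<zeta>|lborel. ?k \<zeta> y)"
  proof (rule lborel_pair.Fubini_integral[symmetric], rule fubini_integrable_bound)
    show "integrable lborel (\<lambda>\<zeta>. cmod (?g \<zeta>))" using inv_fourier_integrable(1)[OF \<psi>] by simp
    show "integrable lborel (heat_kernel \<tau> :: real ^ 'n \<Rightarrow> real)" by (rule heat_kernel_integrable[OF \<tau>])
    show "cmod (case (\<zeta>, y) of (\<zeta>, y) \<Rightarrow> ?k \<zeta> y) \<le> norm (cmod (?g \<zeta>)) * norm (heat_kernel \<tau> y)" for \<zeta> y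
      by (simp add: norm_mult)
  qed (auto intro: lborel.sigma_finite_measure_axioms)
  also have "\<dots> = heat_average \<tau> \<psi> z"
    unfolding heat_average_def integral_mult_right_zero fourier_def[symmetric] fourier_inv_fourier[OF \<psi>] ..
  finally show ?thesis .
qed

section \<open>Pairings with shifted functions and their Gaussian averages\<close>

lemma square_integrable_if_bounded:
  assumes f: "integrable lborel f" and M: "\<And>z. cmod (f z) \<le> M"
  shows "square_integrable f"
proof -
  have [measurable]: "f \<in> borel_measurable borel" using f by auto
  have "integrable lborel (\<lambda>z. (cmod (f z))\<^sup>2)"
  proof (rule Bochner_Integration.integrable_bound)
    show "integrable lborel (\<lambda>z. M * cmod (f z))" using f by simp
    show "AE z in lborel. norm ((cmod (f z))\<^sup>2) \<le> norm (M * cmod (f z))"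
      using M by (auto simp: power2_eq_square abs_mult intro!: mult_right_mono order_trans[OF _ abs_ge_self])
  qed measurable
  then show ?thesis by (simp add: square_integrable_def)
qed

lemma square_integrable_test_function:
  assumes "test_function \<Omega> \<psi>" shows "square_integrable \<psi>"
proof -
  obtain M where "\<And>z. cmod (\<psi> z) \<le> M" using test_functionD(7)[OF assms] by blast
  then show ?thesis using test_functionD(8)[OF assms] by (rule square_integrable_if_bounded[rotated])
qed

lemma square_integrable_translate:
  assumes "square_integrable f"
  shows "square_integrable (\<lambda>z. f (z + w))" "L2_sq (\<lambda>z. f (z + w)) = L2_sq f"
proof -
  have [measurable]: "f \<in> borel_measurable borel" and i: "integrable lborel (\<lambda>z. (cmod (f z))\<^sup>2)"
    using assms by (auto simp: square_integrable_def)
  show "square_integrable (\<lambda>z. f (z + w))"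
    using lborel_integrable_translate[OF i, of w] by (simp add: square_integrable_def add.commute[of w])
  show "L2_sq (\<lambda>z. f (z + w)) = L2_sq f"
    using lborel_integral_translate[of "\<lambda>z. (cmod (f z))\<^sup>2" w] by (simp add: L2_sq_def add.commute[of w])
qed

text \<open>Translation invariance of the L2 norm makes the bound independent of the shift
  \<open>w\<close>; this uniformity allows integration over shifts against the heat kernel.\<close>

lemma translate_pairing_bound:
  assumes "square_integrable u" "square_integrable \<psi>"
  shows "integrable lborel (\<lambda>z. u z * \<psi> (z + w))"
    and "(LINT z|lborel. cmod (u z * \<psi> (z + w))) \<le> L2_sq u + L2_sq \<psi>"
proof -
  note t = square_integrable_translate[OF assms(2), of w]
  show "integrable lborel (\<lambda>z. u z * \<psi> (z + w))" by (rule square_integrable_mult(1)[OF assms(1) t(1)])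
  show "(LINT z|lborel. cmod (u z * \<psi> (z + w))) \<le> L2_sq u + L2_sq \<psi>"
    using square_integrable_mult(2)[OF assms(1) t(1), of 1] t(2) L2_sq_nonneg[of u] L2_sq_nonneg[of \<psi>] by simp
qed

text \<open>Kept general in \<open>f\<close> and in the time shift \<open>t\<close> to serve several
  roles: \<open>f = 1\<close> with an integrable \<open>\<psi>\<close>, then \<open>u\<close> paired
  with a test function shifted forward, and a test function paired with \<open>u\<close> shifted
  backward.\<close>

lemma heat_pair_integrable:
  fixes f \<psi> :: "real \<times> (real ^ 'n) \<Rightarrow> complex"
  assumes \<tau>: "\<tau> > 0"
    and [measurable]: "f \<in> borel_measurable borel" "\<psi> \<in> borel_measurable borel"
    and int: "\<And>w. integrable lborel (\<lambda>z. f z * \<psi> (z + w))"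
    and M: "\<And>w. (LINT z|lborel. cmod (f z * \<psi> (z + w))) \<le> M"
  shows "integrable (lborel \<Otimes>\<^sub>M lborel) (\<lambda>(y, z). of_real (heat_kernel \<tau> y) * (f z * \<psi> (z + (t, y))))"
proof (rule lborel_pair.Fubini_integrable)
  let ?F = "\<lambda>(y, z). of_real (heat_kernel \<tau> y) * (f z * \<psi> (z + (t, y)))"
  have [measurable]: "(\<lambda>(y, z). \<psi> (z + (t, y))) \<in> borel_measurable (borel \<Otimes>\<^sub>M borel)"
    using measurable_compose[OF Pair_add_measurable, of \<psi>] by (simp add: case_prod_beta')
  show m: "?F \<in> borel_measurable (lborel \<Otimes>\<^sub>M lborel)" by measurable
  show "AE y in lborel. integrable lborel (\<lambda>z. ?F (y, z))" using int by simp
  show "integrable lborel (\<lambda>y. LINT z|lborel. cmod (?F (y, z)))"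
  proof (rule Bochner_Integration.integrable_bound)
    show "integrable lborel (\<lambda>y :: real ^ 'n. M * heat_kernel \<tau> y)" by (intro integrable_mult_right heat_kernel_integrable \<tau>)
    show "(\<lambda>y. LINT z|lborel. cmod (?F (y, z))) \<in> borel_measurable lborel" using m by measurable
    show "AE y in lborel. norm (LINT z|lborel. cmod (?F (y, z))) \<le> norm (M * heat_kernel \<tau> y)"
    proof (rule AE_I2)
      fix y :: "real ^ 'n"
      have h: "heat_kernel \<tau> y \<ge> 0" by (rule heat_kernel_nonneg[OF \<tau>])
      have "(LINT z|lborel. cmod (?F (y, z))) = heat_kernel \<tau> y * (LINT z|lborel. cmod (f z * \<psi> (z + (t, y))))"
        using h by (simp only: prod.case norm_mult[of "of_real _"] integral_mult_right_zero norm_of_real abs_of_nonneg)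
      also have "\<dots> \<le> heat_kernel \<tau> y * M" using h M by (intro mult_left_mono) auto
      finally have "(LINT z|lborel. cmod (?F (y, z))) \<le> M * heat_kernel \<tau> y" by (simp add: mult.commute)
      moreover have "(LINT z|lborel. cmod (?F (y, z))) \<ge> 0" by simp
      ultimately show "norm (LINT z|lborel. cmod (?F (y, z))) \<le> norm (M * heat_kernel \<tau> y)"
        unfolding real_norm_def by linarith
    qed
  qed
qed

lemma heat_average_square_integrable:
  fixes \<psi> :: "real \<times> (real ^ 'n) \<Rightarrow> complex"
  assumes \<psi>: "test_function \<Omega> \<psi>" and \<tau>: "\<tau> > 0"
  shows "square_integrable (heat_average \<tau> \<psi>)"
proof -
  note [measurable] = test_functionD(3)[OF \<psi>]
  note \<psi>i = test_functionD(8)[OF \<psi>]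
  obtain M where M: "\<And>z. cmod (\<psi> z) \<le> M" using test_functionD(7)[OF \<psi>] by blast
  have "integrable (lborel \<Otimes>\<^sub>M lborel) (\<lambda>(y, z). of_real (heat_kernel \<tau> y) * (1 * \<psi> (z + (\<tau>, y))))"
  proof (rule heat_pair_integrable[OF \<tau>])
    fix w :: "real \<times> (real ^ 'n)"
    show "integrable lborel (\<lambda>z. 1 * \<psi> (z + w))" using lborel_integrable_translate[OF \<psi>i, of w] by (simp add: add.commute[of w])
    show "(LINT z|lborel. cmod (1 * \<psi> (z + w))) \<le> (LINT z|lborel. cmod (\<psi> z))"
      using lborel_integral_translate[of "\<lambda>z. cmod (\<psi> z)" w] by (simp add: add.commute[of w])
  qed auto
  from lborel_pair.integrable_snd[OF this]
  have i: "integrable lborel (heat_average \<tau> \<psi>)" by (simp add: heat_average_def[abs_def])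
  have "cmod (heat_average \<tau> \<psi> z) \<le> M" for z
  proof -
    note hk = heat_kernel_integrable[OF \<tau>, where 'a="real ^ 'n"]
    have "cmod (heat_average \<tau> \<psi> z) \<le> (LINT y|lborel. M * heat_kernel \<tau> (y :: real ^ 'n))"
      unfolding heat_average_def
    proof (rule Bochner_Integration.integral_norm_bound_integral)
      show "integrable lborel (\<lambda>y :: real ^ 'n. M * heat_kernel \<tau> y)" using hk by simp
      show b: "cmod (of_real (heat_kernel \<tau> y) * \<psi> (z + (\<tau>, y))) \<le> M * heat_kernel \<tau> y" for y :: "real ^ 'n"
        using M heat_kernel_nonneg[OF \<tau>, of y] by (simp add: norm_mult mult.commute[of M] mult_left_mono)
      show "integrable lborel (\<lambda>y. of_real (heat_kernel \<tau> y) * \<psi> (z + (\<tau>, y)))"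
      proof (rule Bochner_Integration.integrable_bound[OF integrable_mult_right[OF hk, of M]])
        show "AE y in lborel. cmod (of_real (heat_kernel \<tau> y) * \<psi> (z + (\<tau>, y))) \<le> norm (M * heat_kernel \<tau> y)"
          using b by (auto intro: order_trans[OF _ abs_ge_self] simp del: norm_mult)
      qed measurable
    qed
    then show ?thesis by (simp add: heat_kernel_integral[OF \<tau>])
  qed
  with i show ?thesis by (rule square_integrable_if_bounded)
qed

text \<open>The quantity a (1 / \<tau>) of the overview, written on the Fourier side with
  \<open>v\<close> the transform of \<open>u\<close>. In this form it makes sense at \<tau> = 0, it
  is continuous in \<tau>, and the symbol acts by multiplication.\<close>

definition heat_pairing :: "(real \<times> (real ^ 'n) \<Rightarrow> complex) \<Rightarrow> (real \<times> (real ^ 'n) \<Rightarrow> complex) \<Rightarrow> real \<Rightarrow> complex" where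
  "heat_pairing v \<psi> \<tau> = (LINT \<zeta>|lborel. v \<zeta> * (exp (- (of_real \<tau> * heat_symbol \<zeta>)) * inv_fourier \<psi> \<zeta>))"

lemma heat_pairing_0:
  assumes "has_fourier_L2 u v" "test_function \<Omega> \<psi>"
  shows "heat_pairing v \<psi> 0 = (LINT z|lborel. u z * \<psi> z)"
proof -
  have "fourier (inv_fourier \<psi>) = \<psi>" using fourier_inv_fourier[OF assms(2)] by auto
  then show ?thesis
    using has_fourier_L2_transfer[OF assms(1) inv_fourier_integrable[OF assms(2)]] square_integrable_test_function[OF assms(2)]
    by (simp add: heat_pairing_def)
qed

text \<open>The same quantity in physical space, where the supports of \<open>u\<close> and
  \<open>\<psi>\<close> become visible. It follows by transposing the Fourier transform and
  exchanging the integrals over \<open>z\<close> and \<open>y\<close>.\<close>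

lemma heat_pairing_eq:
  assumes uv: "has_fourier_L2 u v" and \<psi>: "test_function \<Omega> \<psi>" and \<tau>: "\<tau> > 0"
  shows "heat_pairing v \<psi> \<tau> = (LINT y|lborel. of_real (heat_kernel \<tau> y) * (LINT z|lborel. u z * \<psi> (z + (\<tau>, y))))"
proof -
  note [measurable] = test_functionD(3)[OF \<psi>]
  let ?G = "\<lambda>\<zeta>. exp (- (of_real \<tau> * heat_symbol \<zeta>)) * inv_fourier \<psi> \<zeta>"
  have u: "square_integrable u" using uv by (simp add: has_fourier_L2_def)
  then have [measurable]: "u \<in> borel_measurable borel" by (simp add: square_integrable_def)
  note g = inv_fourier_integrable[OF \<psi>]
  have b: "cmod (?G \<zeta>) \<le> cmod (inv_fourier \<psi> \<zeta>)" for \<zeta>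
    unfolding norm_mult using cmod_exp_heat_symbol[of \<tau> \<zeta>] \<tau> by (intro mult_left_le_one_le) auto
  have G1: "integrable lborel ?G"
    by (rule Bochner_Integration.integrable_bound[OF g(1)]) (use b in auto)
  have "integrable lborel (\<lambda>\<zeta>. (cmod (?G \<zeta>))\<^sup>2)"
  proof (rule Bochner_Integration.integrable_bound)
    show "integrable lborel (\<lambda>\<zeta>. (cmod (inv_fourier \<psi> \<zeta>))\<^sup>2)" using g(2) by (simp add: square_integrable_def)
    show "AE \<zeta> in lborel. norm ((cmod (?G \<zeta>))\<^sup>2) \<le> norm ((cmod (inv_fourier \<psi> \<zeta>))\<^sup>2)"
      using power_mono[OF b, where n=2] by (simp del: norm_mult)
  qed measurable
  then have G2: "square_integrable ?G" by (simp add: square_integrable_def)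
  have F: "fourier ?G = heat_average \<tau> \<psi>" using fourier_exp_heat_inv_fourier[OF \<psi> \<tau>] by auto
  have "heat_pairing v \<psi> \<tau> = (LINT z|lborel. u z * heat_average \<tau> \<psi> z)"
    unfolding heat_pairing_def F[symmetric]
    by (rule has_fourier_L2_transfer[OF uv G1 G2]) (simp only: F heat_average_square_integrable[OF \<psi> \<tau>])
  also have "\<dots> = (LINT z|lborel. LINT y|lborel. of_real (heat_kernel \<tau> y) * (u z * \<psi> (z + (\<tau>, y))))"
    unfolding heat_average_def integral_mult_right_zero[symmetric] by (simp only: mult.left_commute)
  also have "\<dots> = (LINT y|lborel. LINT z|lborel. of_real (heat_kernel \<tau> y) * (u z * \<psi> (z + (\<tau>, y))))"
  proof (rule lborel_pair.Fubini_integral)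
    note t = translate_pairing_bound[OF u square_integrable_test_function[OF \<psi>]]
    show "integrable (lborel \<Otimes>\<^sub>M lborel) (\<lambda>(y, z). of_real (heat_kernel \<tau> y) * (u z * \<psi> (z + (\<tau>, y))))"
      by (rule heat_pair_integrable[OF \<tau> _ _ t]) auto
  qed
  finally show ?thesis by simp
qed

text \<open>For small \<open>\<tau>\<close> only the part of the heat kernel that leaves \<open>\<Omega>\<close> contributes.\<close>

lemma heat_pairing_decay:
  fixes u v \<psi> :: "real \<times> (real ^ 'n) \<Rightarrow> complex"
  assumes uv: "has_fourier_L2 u v" and \<psi>: "test_function \<Omega> \<psi>" and "open \<Omega>"
    and u0: "AE z in lborel. z \<in> \<Omega> \<longrightarrow> u z = 0"
  obtains C c where "c > 0" "C \<ge> 0" "\<And>\<tau>. \<tau> > 0 \<Longrightarrow> cmod (heat_pairing v \<psi> \<tau>) \<le> C * exp (- c / \<tau>)"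
proof -
  note [measurable] = test_functionD(3)[OF \<psi>]
  have u: "square_integrable u" using uv by (simp add: has_fourier_L2_def)
  then have [measurable]: "u \<in> borel_measurable borel" by (simp add: square_integrable_def)
  note t = translate_pairing_bound[OF u square_integrable_test_function[OF \<psi>]]
  let ?K = "closure {z. \<psi> z \<noteq> 0}"
  obtain e where e: "e > 0" "(\<Union>x\<in>?K. ball x e) \<subseteq> \<Omega>"
    using compact_subset_open_imp_ball_epsilon_subset[OF test_functionD(4)[OF \<psi>] \<open>open \<Omega>\<close> test_functionD(5)[OF \<psi>]] by blast
  \<comment> \<open>If \<tau> and |y| are below e / 3, the displacement (\<tau>, y) is shorter than
    e, so it leads from the support of \<open>\<psi>\<close> to points of \<open>\<Omega>\<close>,
    where \<open>u\<close> vanishes.\<close>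
  define \<delta> where "\<delta> = e / 3"
  have \<delta>: "\<delta> > 0" using e by (simp add: \<delta>_def)
  define M where "M = L2_sq u + L2_sq \<psi>"
  have M0: "M \<ge> 0" by (simp add: M_def L2_sq_nonneg)
  define N where "N = sqrt 2 ^ DIM(real ^ 'n)"
  have N1: "N \<ge> 1" unfolding N_def by (rule one_le_power) simp
  define c where "c = \<delta>\<^sup>2 / 8"
  have c: "c > 0" using \<delta> by (simp add: c_def)
  let ?P = "\<lambda>\<tau> y. LINT z|lborel. u z * \<psi> (z + (\<tau>, y))"
  have P: "cmod (?P \<tau> y) \<le> M" for \<tau> y
    using integral_norm_bound[of lborel "\<lambda>z. u z * \<psi> (z + (\<tau>, y))"] t(2)[of "(\<tau>, y)"] unfolding M_def by linarith
  have P0: "?P \<tau> y = 0" if "0 < \<tau>" "\<tau> < \<delta>" "norm y < \<delta>" for \<tau> y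
  proof (rule integral_eq_zero_AE)
    show "AE z in lborel. u z * \<psi> (z + (\<tau>, y)) = 0"
      using u0
    proof eventually_elim
      case (elim z)
      show ?case
      proof (cases "\<psi> (z + (\<tau>, y)) = 0")
        case False
        then have "z + (\<tau>, y) \<in> ?K" using closure_subset[of "{z. \<psi> z \<noteq> 0}"] by auto
        moreover have "z \<in> ball (z + (\<tau>, y)) e"
          using norm_Pair_le[of \<tau> y] that by (simp add: dist_norm \<delta>_def)
        ultimately have "z \<in> \<Omega>" using e(2) by blast
        then show ?thesis using elim by simp
      qed simp
    qed
  qed
  have i: "integrable lborel (\<lambda>y. of_real (heat_kernel \<tau> y) * ?P \<tau> y)" if "\<tau> > 0" for \<tau>
    using lborel_pair.integrable_fst[OF heat_pair_integrable[OF that _ _ t]] by simp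
  \<comment> \<open>The factor exp (c / \<delta>) serves the times \<tau> \<ge> \<delta>: there the
    pairing is merely bounded by \<open>M\<close>, while exp (c / \<delta> - c / \<tau>) is at least
    1.\<close>
  have bound: "cmod (heat_pairing v \<psi> \<tau>) \<le> M * N * exp (c / \<delta>) * exp (- c / \<tau>)" if \<tau>: "\<tau> > 0" for \<tau>
  proof (cases "\<tau> < \<delta>")
    case True
    have "cmod (heat_pairing v \<psi> \<tau>) \<le> (LINT y|lborel. M * (indicator {y. norm y \<ge> \<delta>} y * heat_kernel \<tau> (y :: real ^ 'n)))"
      unfolding heat_pairing_eq[OF uv \<psi> \<tau>]
    proof (rule Bochner_Integration.integral_norm_bound_integral[OF i[OF \<tau>]])
      show "integrable lborel (\<lambda>y :: real ^ 'n. M * (indicator {y. norm y \<ge> \<delta>} y * heat_kernel \<tau> y))"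
        by (intro integrable_mult_right heat_kernel_tail_integrable \<tau>)
      show "cmod (of_real (heat_kernel \<tau> y) * ?P \<tau> y) \<le> M * (indicator {y. norm y \<ge> \<delta>} y * heat_kernel \<tau> y)" for y
        using P0[OF \<tau> True, of y] mult_right_mono[OF P heat_kernel_nonneg[OF \<tau>, of y], of \<tau> y] heat_kernel_nonneg[OF \<tau>, of y]
        by (cases "norm y < \<delta>") (simp_all add: norm_mult mult.commute)
    qed
    also have "\<dots> \<le> M * (N * exp (- \<delta>\<^sup>2 / (8 * \<tau>)))"
      unfolding integral_mult_right_zero N_def using M0 by (intro mult_left_mono heat_kernel_tail \<tau> \<delta>)
    also have "\<dots> = M * N * 1 * exp (- c / \<tau>)" by (simp add: c_def)
    also have "\<dots> \<le> M * N * exp (c / \<delta>) * exp (- c / \<tau>)"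
      using M0 N1 c \<delta> by (intro mult_right_mono mult_left_mono) auto
    finally show ?thesis .
  next
    case False
    have "cmod (heat_pairing v \<psi> \<tau>) \<le> (LINT y|lborel. M * heat_kernel \<tau> (y :: real ^ 'n))"
      unfolding heat_pairing_eq[OF uv \<psi> \<tau>]
    proof (rule Bochner_Integration.integral_norm_bound_integral[OF i[OF \<tau>]])
      show "integrable lborel (\<lambda>y :: real ^ 'n. M * heat_kernel \<tau> y)"
        by (intro integrable_mult_right heat_kernel_integrable \<tau>)
      show "cmod (of_real (heat_kernel \<tau> y) * ?P \<tau> y) \<le> M * heat_kernel \<tau> y" for y
        using mult_right_mono[OF P heat_kernel_nonneg[OF \<tau>, of y], of \<tau> y] heat_kernel_nonneg[OF \<tau>, of y]
        by (simp add: norm_mult mult.commute)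
    qed
    also have "\<dots> = M * 1 * 1" by (simp add: heat_kernel_integral[OF \<tau>])
    also have "\<dots> \<le> M * N * exp (c / \<delta> - c / \<tau>)"
      using M0 N1 c \<delta> False by (intro mult_mono mult_left_mono) (auto simp: divide_left_mono mult_pos_pos)
    also have "\<dots> = M * N * exp (c / \<delta>) * exp (- c / \<tau>)" by (simp flip: exp_add)
    finally show ?thesis .
  qed
  show ?thesis by (rule that[OF c _ bound]) (use M0 N1 in auto)
qed

text \<open>The formal adjoint \<open>- \<partial>\<^sub>t - \<Delta>\<close> of the heat operator.\<close>

definition heat_adjoint :: "(real \<times> (real ^ 'n) \<Rightarrow> complex) \<Rightarrow> real \<times> (real ^ 'n) \<Rightarrow> complex" where
  "heat_adjoint \<psi> z = (- 1) * dir_deriv (1, 0) \<psi> z + (\<Sum>b\<in>Basis. (- 1) * dir_deriv (0, b) (dir_deriv (0, b) \<psi>) z)"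

lemma inv_fourier_sum:
  assumes "finite I" "\<And>i. i \<in> I \<Longrightarrow> integrable lborel (f i)"
  shows "inv_fourier (\<lambda>z. \<Sum>i\<in>I. f i z) \<zeta> = (\<Sum>i\<in>I. inv_fourier (f i) \<zeta>)"
  using assms
proof (induction I rule: finite_induct)
  case empty then show ?case by (simp add: inv_fourier_def)
next
  case (insert i I)
  then show ?case using inv_fourier_add[of "f i" "\<lambda>z. \<Sum>i\<in>I. f i z" \<zeta>] by simp
qed

text \<open>Multiplication by the symbol can thus be absorbed into the test function without leaving
  \<open>\<Omega>\<close>. Under \<open>inv_fourier\<close> the time derivative becomes - i \<rho>
  and the Laplacian - |\<xi>|^2, whence the two minus signs in the operator.\<close>

lemma heat_adjoint:
  fixes \<psi> :: "real \<times> (real ^ 'n) \<Rightarrow> complex"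
  assumes \<psi>: "test_function \<Omega> \<psi>"
  shows "test_function \<Omega> (heat_adjoint \<psi>)"
    and "inv_fourier (heat_adjoint \<psi>) \<zeta> = heat_symbol \<zeta> * inv_fourier \<psi> \<zeta>"
proof -
  have b1: "(1 :: real, 0 :: real ^ 'n) \<in> Basis" by (simp add: Basis_prod_def)
  have b2: "(0 :: real, b) \<in> Basis" if "b \<in> Basis" for b :: "real ^ 'n" using that by (simp add: Basis_prod_def)
  note t1 = test_function_cmult[OF test_function_dir_deriv[OF \<psi> b1], of "- 1"]
  note t2 = test_function_dir_deriv[OF \<psi> b2]
  note t3 = test_function_cmult[OF test_function_dir_deriv[OF t2 b2], where c="- 1"]
  have t4: "test_function \<Omega> (\<lambda>z. \<Sum>b\<in>(Basis :: (real ^ 'n) set). (- 1) * dir_deriv (0, b) (dir_deriv (0, b) \<psi>) z)"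
    by (rule test_function_sum[where f="\<lambda>b z. (- 1) * dir_deriv (0, b) (dir_deriv (0, b) \<psi>) z"]) (use t3 in auto)
  have eq: "heat_adjoint \<psi> = (\<lambda>z. (- 1) * dir_deriv (1, 0) \<psi> z + (\<Sum>b\<in>Basis. (- 1) * dir_deriv (0, b) (dir_deriv (0, b) \<psi>) z))"
    by (rule ext) (rule heat_adjoint_def)
  show "test_function \<Omega> (heat_adjoint \<psi>)" unfolding eq by (rule test_function_add[OF t1 t4])
  have "inv_fourier (heat_adjoint \<psi>) \<zeta> = inv_fourier (\<lambda>z. (- 1) * dir_deriv (1, 0) \<psi> z) \<zeta>
     + (\<Sum>b\<in>Basis. inv_fourier (\<lambda>z. (- 1) * dir_deriv (0, b) (dir_deriv (0, b) \<psi>) z) \<zeta>)"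
    unfolding eq inv_fourier_add[OF test_functionD(8)[OF t1] test_functionD(8)[OF t4]]
    by (subst inv_fourier_sum) (use test_functionD(8)[OF t3] in auto)
  also have "inv_fourier (\<lambda>z. (- 1) * dir_deriv (1, 0) \<psi> z) \<zeta> = \<i> * of_real (fst \<zeta>) * inv_fourier \<psi> \<zeta>"
    unfolding inv_fourier_cmult inv_fourier_dir_deriv[OF \<psi> b1] by (cases \<zeta>) simp
  also have "(\<Sum>b\<in>Basis. inv_fourier (\<lambda>z. (- 1) * dir_deriv (0, b) (dir_deriv (0, b) \<psi>) z) \<zeta>)
     = (\<Sum>b\<in>Basis. of_real ((snd \<zeta> \<bullet> b)\<^sup>2) * inv_fourier \<psi> \<zeta>)"
  proof (rule sum.cong[OF refl])
    fix b :: "real ^ 'n" assume b: "b \<in> Basis"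
    show "inv_fourier (\<lambda>z. (- 1) * dir_deriv (0, b) (dir_deriv (0, b) \<psi>) z) \<zeta> = of_real ((snd \<zeta> \<bullet> b)\<^sup>2) * inv_fourier \<psi> \<zeta>"
      unfolding inv_fourier_cmult inv_fourier_dir_deriv[OF t2[OF b] b2[OF b]] inv_fourier_dir_deriv[OF \<psi> b2[OF b]]
      by (cases \<zeta>) (simp add: power2_eq_square algebra_simps)
  qed
  also have "\<dots> = of_real ((norm (snd \<zeta>))\<^sup>2) * inv_fourier \<psi> \<zeta>"
  proof -
    have "(norm (snd \<zeta>))\<^sup>2 = (\<Sum>b\<in>Basis. (snd \<zeta> \<bullet> b)\<^sup>2)"
      unfolding power2_norm_eq_inner by (subst euclidean_inner) (simp add: power2_eq_square)
    then show ?thesis by (simp add: sum_distrib_right)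
  qed
  finally show "inv_fourier (heat_adjoint \<psi>) \<zeta> = heat_symbol \<zeta> * inv_fourier \<psi> \<zeta>"
    by (simp add: heat_symbol_altdef algebra_simps)
qed

section \<open>The pairing as a function of the reciprocal time\<close>

lemma heat_pairing_measurable [measurable]:
  assumes [measurable]: "v \<in> borel_measurable borel" "\<psi> \<in> borel_measurable borel"
  shows "heat_pairing v \<psi> \<in> borel_measurable borel"
  unfolding heat_pairing_def[abs_def] by measurable

lemma integrable_inverse_square_tail:
  assumes "\<eta> > 0"
  shows "integrable lborel (\<lambda>\<theta>::real. indicator {\<eta><..} \<theta> / \<theta>\<^sup>2)"
proof -
  have "(\<lambda>\<theta>. \<theta> powr (- 2)) integrable_on {\<eta>..}"
    using has_integral_powr_to_inf[of "- 2" \<eta>] assms by (auto simp: integrable_on_def)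
  then have "integrable lborel (\<lambda>\<theta>. indicator {\<eta>..} \<theta> * \<theta> powr (- 2))"
    by (rule integrable_lborel_if_integrable_on) auto
  then show ?thesis
  proof (rule Bochner_Integration.integrable_bound)
    show "AE \<theta> in lborel. norm (indicator {\<eta><..} \<theta> / \<theta>\<^sup>2) \<le> norm (indicator {\<eta>..} \<theta> * \<theta> powr (- 2))"
      using assms by (auto simp: indicator_def powr_minus divide_inverse powr_numeral)
  qed measurable
qed

text \<open>The integrand is the derivative of \<theta> \<mapsto> exp (- h / \<theta>), which tends
  to 1 at infinity. Re h \<ge> 0 keeps the exponential bounded, so 1 / \<theta>^2 gives
  integrability.\<close>

lemma exp_inverse_FTC:
  assumes "\<eta> > 0" "Re h \<ge> 0"
  shows "(LINT \<theta>|lborel. of_real (indicator {\<eta><..} \<theta> / \<theta>\<^sup>2) * (exp (- (of_real (1 / \<theta>) * h)) * h))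
       = 1 - exp (- (of_real (1 / \<eta>) * h))"
proof -
  let ?F = "\<lambda>\<theta>::real. exp (- (of_real (1 / \<theta>) * h))"
  let ?f = "\<lambda>\<theta>::real. of_real (1 / \<theta>\<^sup>2) * (exp (- (of_real (1 / \<theta>) * h)) * h)"
  have eq: "indicator {\<eta><..} \<theta> *\<^sub>R ?f \<theta> = of_real (indicator {\<eta><..} \<theta> / \<theta>\<^sup>2) * (exp (- (of_real (1 / \<theta>) * h)) * h)" for \<theta>
    by (simp add: indicator_def)
  have einterval: "einterval \<eta> \<infinity> = {\<eta><..}" by (auto simp: einterval_def)
  have "(LBINT \<theta>=ereal \<eta>..\<infinity>. ?f \<theta>) = 1 - ?F \<eta>"
  proof (rule interval_integral_FTC_integrable)
    show "ereal \<eta> < \<infinity>" by simp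
    fix \<theta> assume "ereal \<eta> < ereal \<theta>"
    then have \<theta>: "\<theta> > 0" using assms by simp
    have "((\<lambda>x. - (of_real (1 / x) * h)) has_vector_derivative of_real (1 / \<theta>\<^sup>2) * h) (at \<theta>)"
    proof -
      have "((\<lambda>x. 1 / x) has_real_derivative - (1 / \<theta>\<^sup>2)) (at \<theta>)"
        using \<theta> by (auto intro!: derivative_eq_intros simp: power2_eq_square)
      then have "((\<lambda>x. complex_of_real (1 / x)) has_vector_derivative of_real (- (1 / \<theta>\<^sup>2))) (at \<theta>)"
        by (rule has_vector_derivative_of_real)
      then have "((\<lambda>x. - (of_real (1 / x) * h)) has_vector_derivative - (of_real (- (1 / \<theta>\<^sup>2)) * h)) (at \<theta>)"
        by (intro has_vector_derivative_minus has_vector_derivative_mult_left)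
      then show ?thesis by simp
    qed
    from field_vector_diff_chain_at[OF this DERIV_exp]
    show "(?F has_vector_derivative ?f \<theta>) (at \<theta>)" by (simp add: o_def mult_ac)
    show "isCont ?f \<theta>" using \<theta> by (intro continuous_intros) auto
  next
    show "set_integrable lborel (einterval (ereal \<eta>) \<infinity>) ?f"
      unfolding set_integrable_def einterval eq
    proof (rule Bochner_Integration.integrable_bound)
      show "integrable lborel (\<lambda>\<theta>::real. indicator {\<eta><..} \<theta> / \<theta>\<^sup>2 * cmod h)"
        by (intro integrable_mult_left integrable_inverse_square_tail assms)
      show "AE \<theta> in lborel. cmod (of_real (indicator {\<eta><..} \<theta> / \<theta>\<^sup>2) * (exp (- (of_real (1 / \<theta>) * h)) * h))
          \<le> norm (indicator {\<eta><..} \<theta> / \<theta>\<^sup>2 * cmod h)"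
      proof (rule AE_I2)
        fix \<theta> :: real
        show "cmod (of_real (indicator {\<eta><..} \<theta> / \<theta>\<^sup>2) * (exp (- (of_real (1 / \<theta>) * h)) * h))
          \<le> norm (indicator {\<eta><..} \<theta> / \<theta>\<^sup>2 * cmod h)"
        proof (cases "\<theta> > \<eta>")
          case True
          then have "Re (of_real (1 / \<theta>) * h) \<ge> 0" using assms by simp
          then have "cmod (exp (- (of_real (1 / \<theta>) * h))) \<le> 1" by (simp only: norm_exp_eq_Re) simp
          then have "cmod (exp (- (of_real (1 / \<theta>) * h)) * h) \<le> 1 * cmod h"
            unfolding norm_mult by (intro mult_right_mono) auto
          then have "cmod (exp (- (of_real (1 / \<theta>) * h)) * h) \<le> cmod h" by (simp only: mult_1)
          from mult_left_mono[OF this abs_ge_zero[of "indicator {\<eta><..} \<theta> / \<theta>\<^sup>2"]]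
          show ?thesis
            by (simp only: norm_mult[of "of_real _"] norm_of_real real_norm_def abs_mult abs_norm_cancel)
        qed simp
      qed
    qed measurable
    show "((?F \<circ> real_of_ereal) \<longlongrightarrow> ?F \<eta>) (at_right (ereal \<eta>))"
    proof -
      have "isCont ?F \<eta>" using assms by (intro continuous_intros) auto
      then show ?thesis unfolding ereal_tendsto_simps1 by (simp add: isCont_def filterlim_at_split)
    qed
    show "((?F \<circ> real_of_ereal) \<longlongrightarrow> 1) (at_left \<infinity>)"
    proof -
      have "((\<lambda>\<theta>. inverse \<theta>) \<longlongrightarrow> (0::real)) at_top" by (rule tendsto_inverse_0_at_top[OF filterlim_ident])
      then have "((\<lambda>\<theta>. exp (- (complex_of_real (inverse \<theta>) * h))) \<longlongrightarrow> exp (- (complex_of_real 0 * h))) at_top"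
        by (intro tendsto_intros)
      then show ?thesis unfolding ereal_tendsto_simps1 by (simp add: inverse_eq_divide)
    qed
  qed
  then show ?thesis
    unfolding interval_lebesgue_integral_def set_lebesgue_integral_def einterval eq
    by (simp only: ereal_less_eq if_True)
qed

context
  fixes v \<psi> :: "real \<times> (real ^ 'n) \<Rightarrow> complex" and \<Omega>
  assumes v: "square_integrable v" and \<psi>: "test_function \<Omega> \<psi>"
begin

lemma pairing_measurable: "v \<in> borel_measurable borel" "\<psi> \<in> borel_measurable borel"
  using v test_functionD(3)[OF \<psi>] by (auto simp: square_integrable_def)

lemma pairing_integrable:
  "integrable lborel (\<lambda>\<zeta>. v \<zeta> * inv_fourier \<psi> \<zeta>)"
  "integrable lborel (\<lambda>\<zeta>. v \<zeta> * (heat_symbol \<zeta> * inv_fourier \<psi> \<zeta>))"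
  using square_integrable_mult(1)[OF v inv_fourier_integrable(2)[OF \<psi>]]
    square_integrable_mult(1)[OF v inv_fourier_integrable(2)[OF heat_adjoint(1)[OF \<psi>]]]
  by (simp_all add: heat_adjoint(2)[OF \<psi>])

lemma exp_pairing_integrable:
  assumes "\<tau> \<ge> 0"
  shows "integrable lborel (\<lambda>\<zeta>. v \<zeta> * (exp (- (of_real \<tau> * heat_symbol \<zeta>)) * inv_fourier \<psi> \<zeta>))"
proof (rule Bochner_Integration.integrable_bound[OF pairing_integrable(1)])
  note [measurable] = pairing_measurable
  show "(\<lambda>\<zeta>. v \<zeta> * (exp (- (of_real \<tau> * heat_symbol \<zeta>)) * inv_fourier \<psi> \<zeta>)) \<in> borel_measurable lborel" by measurable
  show "AE \<zeta> in lborel. cmod (v \<zeta> * (exp (- (of_real \<tau> * heat_symbol \<zeta>)) * inv_fourier \<psi> \<zeta>)) \<le> cmod (v \<zeta> * inv_fourier \<psi> \<zeta>)"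
    unfolding norm_mult
    using cmod_exp_heat_symbol[OF assms] by (intro AE_I2 mult_left_mono mult_left_le_one_le) auto
qed

lemma heat_pairing_continuous: "continuous_on {0..} (heat_pairing v \<psi>)"
  unfolding continuous_on_sequentially
proof (intro allI impI ballI)
  fix X :: "nat \<Rightarrow> real" and \<tau> assume X: "(\<forall>n. X n \<in> {0..}) \<and> X \<longlonglongrightarrow> \<tau>" and "\<tau> \<in> {0..}"
  note [measurable] = pairing_measurable
  show "(heat_pairing v \<psi> \<circ> X) \<longlonglongrightarrow> heat_pairing v \<psi> \<tau>"
    unfolding heat_pairing_def comp_def
  proof (rule integral_dominated_convergence)
    show "integrable lborel (\<lambda>\<zeta>. cmod (v \<zeta> * inv_fourier \<psi> \<zeta>))" using pairing_integrable(1) by simp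
    show "AE \<zeta> in lborel. (\<lambda>n. v \<zeta> * (exp (- (of_real (X n) * heat_symbol \<zeta>)) * inv_fourier \<psi> \<zeta>))
      \<longlonglongrightarrow> v \<zeta> * (exp (- (of_real \<tau> * heat_symbol \<zeta>)) * inv_fourier \<psi> \<zeta>)"
      using X by (intro AE_I2 tendsto_intros) auto
    show "AE \<zeta> in lborel. cmod (v \<zeta> * (exp (- (of_real (X n) * heat_symbol \<zeta>)) * inv_fourier \<psi> \<zeta>)) \<le> cmod (v \<zeta> * inv_fourier \<psi> \<zeta>)" for n
      unfolding norm_mult
      using X cmod_exp_heat_symbol[of "X n"] by (intro AE_I2 mult_left_mono mult_left_le_one_le) auto
  qed measurable
qed

text \<open>With a (\<eta>) the pairing at time 1 / \<eta>, this integrates a' (\<eta>) = b (\<eta>)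
  / \<eta>^2 from \<eta> to infinity, where b belongs to \<open>heat_adjoint \<psi>\<close> and a
  (\<infinity>) is the pairing at time 0. It comes from \<open>exp_inverse_FTC\<close> under the
  integral over \<zeta>, so no derivative of the pairing is taken.\<close>

lemma heat_pairing_eq_integral_adjoint:
  assumes \<eta>: "\<eta> > 0"
  shows "heat_pairing v \<psi> (1 / \<eta>) = heat_pairing v \<psi> 0
     - (LINT \<theta>|lborel. of_real (indicator {\<eta><..} \<theta> / \<theta>\<^sup>2) * heat_pairing v (heat_adjoint \<psi>) (1 / \<theta>))"
proof -
  note [measurable] = pairing_measurable
  let ?w = "\<lambda>\<theta>. complex_of_real (indicator {\<eta><..} \<theta> / \<theta>\<^sup>2)"
  let ?k = "\<lambda>\<theta> \<zeta>. ?w \<theta> * (v \<zeta> * (exp (- (of_real (1 / \<theta>) * heat_symbol \<zeta>)) * (heat_symbol \<zeta> * inv_fourier \<psi> \<zeta>)))"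
  have "(LINT \<theta>|lborel. ?w \<theta> * heat_pairing v (heat_adjoint \<psi>) (1 / \<theta>)) = (LINT \<theta>|lborel. LINT \<zeta>|lborel. ?k \<theta> \<zeta>)"
    unfolding heat_pairing_def heat_adjoint(2)[OF \<psi>] integral_mult_right_zero ..
  also have "\<dots> = (LINT \<zeta>|lborel. LINT \<theta>|lborel. ?k \<theta> \<zeta>)"
  proof (rule lborel_pair.Fubini_integral[symmetric], rule fubini_integrable_bound)
    show "integrable lborel (\<lambda>\<theta>::real. indicator {\<eta><..} \<theta> / \<theta>\<^sup>2)" by (rule integrable_inverse_square_tail[OF \<eta>])
    show "integrable lborel (\<lambda>\<zeta>. cmod (v \<zeta> * (heat_symbol \<zeta> * inv_fourier \<psi> \<zeta>)))" using pairing_integrable(2) by simp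
    show "cmod (case (\<theta>, \<zeta>) of (\<theta>, \<zeta>) \<Rightarrow> ?k \<theta> \<zeta>) \<le> norm (indicator {\<eta><..} \<theta> / \<theta>\<^sup>2 :: real) * norm (cmod (v \<zeta> * (heat_symbol \<zeta> * inv_fourier \<psi> \<zeta>)))" for \<theta> \<zeta>
    proof (cases "\<theta> > \<eta>")
      case True
      then have "cmod (exp (- (of_real (1 / \<theta>) * heat_symbol \<zeta>))) \<le> 1" using \<eta> by (intro cmod_exp_heat_symbol) simp
      then have "cmod (v \<zeta> * (exp (- (of_real (1 / \<theta>) * heat_symbol \<zeta>)) * (heat_symbol \<zeta> * inv_fourier \<psi> \<zeta>)))
          \<le> cmod (v \<zeta> * (heat_symbol \<zeta> * inv_fourier \<psi> \<zeta>))"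
        unfolding norm_mult by (intro mult_left_mono mult_left_le_one_le) auto
      then have "cmod (?w \<theta>) * cmod (v \<zeta> * (exp (- (of_real (1 / \<theta>) * heat_symbol \<zeta>)) * (heat_symbol \<zeta> * inv_fourier \<psi> \<zeta>)))
          \<le> cmod (?w \<theta>) * cmod (v \<zeta> * (heat_symbol \<zeta> * inv_fourier \<psi> \<zeta>))"
        by (rule mult_left_mono) simp
      then show ?thesis by (simp only: prod.case norm_mult[of "?w \<theta>"] norm_of_real real_norm_def abs_norm_cancel)
    qed simp
  qed (auto intro: lborel.sigma_finite_measure_axioms)
  also have "\<dots> = (LINT \<zeta>|lborel. v \<zeta> * (exp (- (of_real 0 * heat_symbol \<zeta>)) * inv_fourier \<psi> \<zeta>)
       - v \<zeta> * (exp (- (of_real (1 / \<eta>) * heat_symbol \<zeta>)) * inv_fourier \<psi> \<zeta>))"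
  proof (intro Bochner_Integration.integral_cong refl)
    fix \<zeta> :: "real \<times> (real ^ 'n)"
    let ?h = "heat_symbol \<zeta>"
    have "(LINT \<theta>|lborel. ?k \<theta> \<zeta>) = (LINT \<theta>|lborel. v \<zeta> * inv_fourier \<psi> \<zeta> * (?w \<theta> * (exp (- (of_real (1 / \<theta>) * ?h)) * ?h)))"
      by (simp only: mult_ac)
    also have "\<dots> = v \<zeta> * inv_fourier \<psi> \<zeta> * (1 - exp (- (of_real (1 / \<eta>) * ?h)))"
      by (simp only: integral_mult_right_zero exp_inverse_FTC[OF \<eta>, of ?h] Re_heat_symbol zero_le_power2)
    finally show "(LINT \<theta>|lborel. ?k \<theta> \<zeta>) = v \<zeta> * (exp (- (of_real 0 * ?h)) * inv_fourier \<psi> \<zeta>)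
       - v \<zeta> * (exp (- (of_real (1 / \<eta>) * ?h)) * inv_fourier \<psi> \<zeta>)"
      by (simp add: algebra_simps)
  qed
  also have "\<dots> = heat_pairing v \<psi> 0 - heat_pairing v \<psi> (1 / \<eta>)"
    unfolding heat_pairing_def using \<eta>
    by (intro Bochner_Integration.integral_diff exp_pairing_integrable) auto
  finally show ?thesis by simp
qed

end

subsection \<open>Vanishing moments\<close>

text \<open>The equation is multiplied by Gamma (- s), the power of the symbol is replaced by its
  integral over \<eta>, and the integrals are exchanged. The term - 1 in
  \<open>frac_integrand\<close> contributes the pairing at time 0, which is zero by
  \<open>P0\<close>.\<close>

lemma frac_moment_zero:
  fixes v \<psi> :: "real \<times> (real ^ 'n) \<Rightarrow> complex"
  assumes v: "square_integrable v" and \<psi>: "test_function \<Omega> \<psi>"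
    and s: "0 < s" "s < 1"
    and W: "(LINT \<zeta>|lborel. heat_symbol \<zeta> powr of_real s * v \<zeta> * inv_fourier \<psi> \<zeta>) = 0"
    and P0: "heat_pairing v \<psi> 0 = 0"
  shows "(LINT \<eta>|lborel. of_real (indicator {0<..} \<eta> * \<eta> powr (s - 1)) * heat_pairing v \<psi> (1 / \<eta>)) = 0"
proof -
  note [measurable] = pairing_measurable[OF v \<psi>]
  let ?g = "inv_fourier \<psi>"
  let ?w = "\<lambda>\<eta>. complex_of_real (indicator {0<..} \<eta> * \<eta> powr (s - 1))"
  let ?k = "\<lambda>\<zeta> \<eta>. frac_integrand s (heat_symbol \<zeta>) \<eta> * (v \<zeta> * ?g \<zeta>)"
  have k: "?k \<zeta> \<eta> = ?w \<eta> * (v \<zeta> * (exp (- (of_real (1 / \<eta>) * heat_symbol \<zeta>)) * ?g \<zeta>) - v \<zeta> * (exp (- (of_real 0 * heat_symbol \<zeta>)) * ?g \<zeta>))" for \<zeta> \<eta>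
  proof -
    have a: "1 * ((a - 1) * p) * (x * y) = p * (x * (a * y) - x * (1 * y))" for a p x y :: complex
      by (simp add: algebra_simps)
    have "heat_symbol \<zeta> / of_real \<eta> = of_real (1 / \<eta>) * heat_symbol \<zeta>" by simp
    then show ?thesis
      using a[of "exp (- (of_real (1 / \<eta>) * heat_symbol \<zeta>))" "of_real (\<eta> powr (s - 1))" "v \<zeta>" "?g \<zeta>"]
      by (cases "\<eta> > 0") (simp_all add: frac_integrand_def)
  qed
  have "(\<lambda>(\<zeta> :: real \<times> (real ^ 'n), \<eta>). (heat_symbol \<zeta>, \<eta> :: real)) \<in> lborel \<Otimes>\<^sub>M lborel \<rightarrow>\<^sub>M borel \<Otimes>\<^sub>M borel"
    by measurable
  from measurable_compose[OF this frac_integrand_measurable_pair]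
  have [measurable]: "(\<lambda>(\<zeta> :: real \<times> (real ^ 'n), \<eta>). frac_integrand s (heat_symbol \<zeta>) \<eta>) \<in> borel_measurable (lborel \<Otimes>\<^sub>M lborel)"
    by (simp add: case_prod_beta')
  have km: "(\<lambda>(\<zeta>, \<eta>). ?k \<zeta> \<eta>) \<in> borel_measurable (lborel \<Otimes>\<^sub>M lborel)"
    by measurable
  have "0 = frac_integral s 1 * (LINT \<zeta>|lborel. heat_symbol \<zeta> powr of_real s * v \<zeta> * ?g \<zeta>)" by (simp add: W)
  also have "\<dots> = (LINT \<zeta>|lborel. frac_integral s 1 * (heat_symbol \<zeta> powr of_real s * v \<zeta> * ?g \<zeta>))" by simp
  also have "\<dots> = (LINT \<zeta>|lborel. LINT \<eta>|lborel. ?k \<zeta> \<eta>)"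
  proof (rule integral_cong_AE)
    show "(\<lambda>\<zeta>. LINT \<eta>|lborel. ?k \<zeta> \<eta>) \<in> borel_measurable lborel"
      using km by measurable
    show "(\<lambda>\<zeta>. frac_integral s 1 * (heat_symbol \<zeta> powr of_real s * v \<zeta> * ?g \<zeta>)) \<in> borel_measurable lborel"
      by measurable
    show "AE \<zeta> in lborel. frac_integral s 1 * (heat_symbol \<zeta> powr of_real s * v \<zeta> * ?g \<zeta>) = (LINT \<eta>|lborel. ?k \<zeta> \<eta>)"
      using AE_Re_heat_symbol_pos
    proof eventually_elim
      case (elim \<zeta>)
      have "(LINT \<eta>|lborel. ?k \<zeta> \<eta>) = frac_integral s (heat_symbol \<zeta>) * (v \<zeta> * ?g \<zeta>)"
        by (simp add: frac_integral_def)
      also note frac_integral_eq_powr[OF s elim]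
      finally show ?case by (simp only: mult_ac)
    qed
  qed
  also have "\<dots> = (LINT \<eta>|lborel. LINT \<zeta>|lborel. ?k \<zeta> \<eta>)"
  proof (rule lborel_pair.Fubini_integral[symmetric], rule fubini_integrable_bound)
    show "integrable lborel (\<lambda>\<zeta>. cmod (v \<zeta> * ?g \<zeta>) + cmod (v \<zeta> * (heat_symbol \<zeta> * ?g \<zeta>)))"
      using pairing_integrable[OF v \<psi>] by (intro Bochner_Integration.integrable_add integrable_norm)
    show "(\<lambda>(\<zeta>, \<eta>). ?k \<zeta> \<eta>) \<in> borel_measurable (lborel \<Otimes>\<^sub>M lborel)"
      by (rule km)
    show "integrable lborel (frac_majorant s 1)" by (rule frac_majorant_integrable[OF s]) simp
    show "cmod (case (\<zeta>, \<eta>) of (\<zeta>, \<eta>) \<Rightarrow> ?k \<zeta> \<eta>)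
       \<le> norm (cmod (v \<zeta> * ?g \<zeta>) + cmod (v \<zeta> * (heat_symbol \<zeta> * ?g \<zeta>))) * norm (frac_majorant s 1 \<eta>)" for \<zeta> \<eta>
    proof -
      let ?r = "cmod (heat_symbol \<zeta>)"
      \<comment> \<open>This separates the variables: the factor 1 + |h| is absorbed by the test
        function, because \<open>v * inv_fourier \<psi>\<close> and its multiple by the symbol are
        both integrable.\<close>
      have "frac_majorant s ?r \<eta> \<le> (1 + ?r) * frac_majorant s 1 \<eta>"
      proof (cases "\<eta> > 0")
        case True
        have "min 2 (?r / \<eta>) \<le> (1 + ?r) * min 2 (1 / \<eta>)"
        proof (cases "1 / \<eta> \<le> 2")
          case True
          have "min 2 (?r / \<eta>) \<le> ?r / \<eta>" by simp
          also have "\<dots> \<le> (1 + ?r) * (1 / \<eta>)" using \<open>\<eta> > 0\<close> by (simp add: divide_right_mono)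
          finally show ?thesis using True by (simp only: min_absorb2)
        next
          case False
          then have "min 2 (1 / \<eta>) = 2" by simp
          moreover have "min 2 (?r / \<eta>) \<le> 2" by simp
          moreover have "2 \<le> (1 + ?r) * 2" by simp
          ultimately show ?thesis by (simp only:)
        qed
        then have "min 2 (?r / \<eta>) * \<eta> powr (s - 1) \<le> (1 + ?r) * min 2 (1 / \<eta>) * \<eta> powr (s - 1)"
          by (rule mult_right_mono) simp
        then show ?thesis using True by (simp add: frac_majorant_def mult.assoc)
      qed (simp add: frac_majorant_def)
      then have "cmod (frac_integrand s (heat_symbol \<zeta>) \<eta>) \<le> (1 + ?r) * frac_majorant s 1 \<eta>"
        using frac_integrand_bound[of "heat_symbol \<zeta>" s \<eta>] by (simp add: Re_heat_symbol)
      then have "cmod (frac_integrand s (heat_symbol \<zeta>) \<eta>) * cmod (v \<zeta> * ?g \<zeta>) \<le> (1 + ?r) * frac_majorant s 1 \<eta> * cmod (v \<zeta> * ?g \<zeta>)"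
        by (rule mult_right_mono) simp
      also have "\<dots> = (cmod (v \<zeta> * ?g \<zeta>) + cmod (v \<zeta> * (heat_symbol \<zeta> * ?g \<zeta>))) * frac_majorant s 1 \<eta>"
        unfolding norm_mult by (simp add: algebra_simps)
      finally show ?thesis
        using frac_majorant_nonneg[of 1 s \<eta>] by (simp only: prod.case norm_mult[of "frac_integrand _ _ _"] real_norm_def
          abs_of_nonneg add_nonneg_nonneg norm_ge_zero zero_le_one)
    qed
  qed (auto intro: lborel.sigma_finite_measure_axioms)
  also have "\<dots> = (LINT \<eta>|lborel. ?w \<eta> * heat_pairing v \<psi> (1 / \<eta>))"
  proof (intro Bochner_Integration.integral_cong refl)
    fix \<eta> :: real
    show "(LINT \<zeta>|lborel. ?k \<zeta> \<eta>) = ?w \<eta> * heat_pairing v \<psi> (1 / \<eta>)"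
    proof (cases "\<eta> > 0")
      case True
      have "(LINT \<zeta>|lborel. ?k \<zeta> \<eta>) = ?w \<eta> * (heat_pairing v \<psi> (1 / \<eta>) - heat_pairing v \<psi> 0)"
        unfolding k integral_mult_right_zero heat_pairing_def
        by (subst Bochner_Integration.integral_diff[OF exp_pairing_integrable[OF v \<psi>] exp_pairing_integrable[OF v \<psi>]]) (use True in auto)
      then show ?thesis by (simp add: P0)
    qed (simp add: frac_integrand_def)
  qed
  finally show ?thesis by simp
qed

lemma integrable_powr_exp:
  fixes p c :: real
  assumes "p > 0" "c > 0"
  shows "integrable lborel (\<lambda>t::real. indicator {0<..} t * (t powr (p - 1) / exp (c * t)))"
proof (rule integrable_lborel_if_integrable_on)
  have "(\<lambda>t. cmod (of_real t powr (of_real p - 1) / of_real (exp (c * t)))) integrable_on {0<..}"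
    using absolutely_integrable_Gamma_integral[of "of_real p" c] assms by (simp add: absolutely_integrable_on_def)
  then show "(\<lambda>t. t powr (p - 1) / exp (c * t)) integrable_on {0<..}"
  proof (rule integrable_eq)
    fix t :: real assume "t \<in> {0<..}"
    then show "cmod (of_real t powr (of_real p - 1) / of_real (exp (c * t))) = t powr (p - 1) / exp (c * t)"
      by (simp add: norm_divide norm_powr_real_powr)
  qed
qed auto

lemma integral_powr_from_0:
  fixes p \<theta> :: real
  assumes p: "p > 0" and \<theta>: "\<theta> > 0"
  shows "integrable lborel (\<lambda>\<eta>. indicator {0<..<\<theta>} \<eta> * \<eta> powr p)"
    and "(LINT \<eta>|lborel. indicator {0<..<\<theta>} \<eta> * \<eta> powr p) = \<theta> powr (p + 1) / (p + 1)"
proof -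
  have hi: "((\<lambda>\<eta>. \<eta> powr p) has_integral (\<theta> powr (p + 1) / (p + 1))) {0..\<theta>}"
    using p \<theta> by (intro has_integral_powr_from_0) auto
  then have hi2: "((\<lambda>\<eta>. \<eta> powr p) has_integral (\<theta> powr (p + 1) / (p + 1))) {0<..<\<theta>}"
    using has_integral_Icc_iff_Ioo by blast
  then show i: "integrable lborel (\<lambda>\<eta>. indicator {0<..<\<theta>} \<eta> * \<eta> powr p)"
    by (intro integrable_lborel_if_integrable_on) (auto simp: integrable_on_def)
  have "(\<lambda>\<eta>. indicator {0<..<\<theta>} \<eta> * \<eta> powr p) = (\<lambda>\<eta>. if \<eta> \<in> {0<..<\<theta>} then \<eta> powr p else 0)"
    by (auto simp: indicator_def)
  then have "((\<lambda>\<eta>. indicator {0<..<\<theta>} \<eta> * \<eta> powr p) has_integral (\<theta> powr (p + 1) / (p + 1))) UNIV"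
    using hi2 by (simp only: has_integral_restrict_UNIV)
  then show "(LINT \<eta>|lborel. indicator {0<..<\<theta>} \<eta> * \<eta> powr p) = \<theta> powr (p + 1) / (p + 1)"
    using has_integral_integral_lborel[OF i] has_integral_unique by blast
qed

text \<open>The induction step integrates by parts, in the form of Fubini's theorem on \<open>0 < \<eta> < \<theta>\<close>.\<close>

lemma heat_moments_zero:
  fixes u v \<psi> :: "real \<times> (real ^ 'n) \<Rightarrow> complex"
  assumes s: "0 < s" "s < 1" and uv: "has_fourier_L2 u v" and \<Omega>: "open \<Omega>"
    and u0: "AE z in lborel. z \<in> \<Omega> \<longrightarrow> u z = 0"
    and W: "\<And>\<psi>. test_function \<Omega> \<psi> \<Longrightarrow> (LINT \<zeta>|lborel. heat_symbol \<zeta> powr of_real s * v \<zeta> * inv_fourier \<psi> \<zeta>) = 0"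
    and \<psi>: "test_function \<Omega> \<psi>"
  shows "(LINT \<eta>|lborel. of_real (indicator {0<..} \<eta> * \<eta> powr (s - 1 + real k)) * heat_pairing v \<psi> (1 / \<eta>)) = 0"
  using \<psi>
proof (induction k arbitrary: \<psi>)
  have v: "square_integrable v" using uv by (simp add: has_fourier_L2_def)
  have P0: "heat_pairing v \<psi> 0 = 0" if \<psi>: "test_function \<Omega> \<psi>" for \<psi>
    unfolding heat_pairing_0[OF uv \<psi>]
  proof (rule integral_eq_zero_AE)
    show "AE z in lborel. u z * \<psi> z = 0"
      using u0
    proof eventually_elim
      case (elim z)
      have "\<psi> z \<noteq> 0 \<Longrightarrow> z \<in> \<Omega>" using test_functionD(5)[OF \<psi>] closure_subset[of "{z. \<psi> z \<noteq> 0}"] by auto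
      then show ?case using elim by auto
    qed
  qed
  {
    case 0
    then show ?case using frac_moment_zero[OF v _ s W P0] by simp
  next
    case (Suc k)
    note \<psi> = Suc.prems
    let ?\<phi> = "heat_adjoint \<psi>"
    note \<phi> = heat_adjoint(1)[OF \<psi>]
    note [measurable] = pairing_measurable[OF v \<phi>]
    \<comment> \<open>The exponent of the moment of order \<open>Suc k\<close>. It is positive, so
      the inner integral of \<eta> powr p over 0 < \<eta> < \<theta> is finite.\<close>
    define p where "p = s + real k"
    have p: "p > 0" "s - 1 + real (Suc k) = p" using s by (auto simp: p_def)
    define B where "B \<theta> = heat_pairing v ?\<phi> (1 / \<theta>)" for \<theta>
    have [measurable]: "B \<in> borel_measurable borel" unfolding B_def[abs_def] by measurable
    obtain c C where c: "c > 0" "C \<ge> 0" and Cc: "\<And>\<tau>. \<tau> > 0 \<Longrightarrow> cmod (heat_pairing v ?\<phi> \<tau>) \<le> C * exp (- c / \<tau>)"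
      by (rule heat_pairing_decay[OF uv \<phi> \<Omega> u0], rule that, assumption+)
    let ?m = "\<lambda>\<theta>. C / (p + 1) * (indicator {0<..} \<theta> * (\<theta> powr (p - 1) / exp (c * \<theta>)))"
    have B: "cmod (B \<theta>) \<le> C / exp (c * \<theta>)" if "\<theta> > 0" for \<theta>
    proof -
      have "exp (- c / (1 / \<theta>)) = inverse (exp (c * \<theta>))" by (simp add: exp_minus[symmetric])
      then show ?thesis using Cc[of "1 / \<theta>"] that unfolding B_def divide_inverse[of C] by (simp only: zero_less_divide_1_iff)
    qed
    let ?K = "\<lambda>(\<theta>, \<eta>). complex_of_real (indicator {0<..} \<eta> * \<eta> powr p) * (of_real (indicator {\<eta><..} \<theta> / \<theta>\<^sup>2) * B \<theta>)"
    have ind: "indicator {0<..} \<eta> * indicator {\<eta><..} \<theta> = (indicator {0<..} \<theta> * indicator {0<..<\<theta>} \<eta> :: real)" for \<eta> \<theta> :: real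
      by (auto simp: indicator_def)
    have K: "?K (\<theta>, \<eta>) = of_real (indicator {0<..} \<theta> / \<theta>\<^sup>2) * B \<theta> * of_real (indicator {0<..<\<theta>} \<eta> * \<eta> powr p)" for \<theta> \<eta>
    proof -
      have "?K (\<theta>, \<eta>) = of_real ((indicator {0<..} \<eta> * indicator {\<eta><..} \<theta>) * (\<eta> powr p / \<theta>\<^sup>2)) * B \<theta>"
        by simp
      also have "\<dots> = of_real (indicator {0<..} \<theta> / \<theta>\<^sup>2) * B \<theta> * of_real (indicator {0<..<\<theta>} \<eta> * \<eta> powr p)"
        unfolding ind by simp
      finally show ?thesis .
    qed
    have Ki: "integrable (lborel \<Otimes>\<^sub>M lborel) ?K"
    proof (rule lborel_pair.Fubini_integrable)
      \<comment> \<open>The set in the indicator of \<open>{\<eta><..}\<close> varies with \<eta>;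
        rewritten as the comparison \<eta> < \<theta> it is visibly jointly measurable.\<close>
      have *: "(\<lambda>(\<theta>, \<eta>). of_real (indicator {0<..} \<theta> / \<theta>\<^sup>2) * B \<theta> * of_real (indicator {0<..} \<eta> * (if \<eta> < \<theta> then \<eta> powr p else 0)))
         \<in> borel_measurable (lborel \<Otimes>\<^sub>M lborel)" by measurable
      have "?K = (\<lambda>(\<theta>, \<eta>). of_real (indicator {0<..} \<theta> / \<theta>\<^sup>2) * B \<theta> * of_real (indicator {0<..} \<eta> * (if \<eta> < \<theta> then \<eta> powr p else 0)))"
        by (auto simp: indicator_def fun_eq_iff)
      then show m: "?K \<in> borel_measurable (lborel \<Otimes>\<^sub>M lborel)" using * by (simp only:)
      show "AE \<theta> in lborel. integrable lborel (\<lambda>\<eta>. ?K (\<theta>, \<eta>))"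
      proof (rule AE_I2)
        fix \<theta> :: real
        show "integrable lborel (\<lambda>\<eta>. ?K (\<theta>, \<eta>))"
        proof (cases "\<theta> > 0")
          case True
          show ?thesis unfolding K
            by (intro integrable_mult_right) (simp only: complex_of_real_integrable_eq integral_powr_from_0(1)[OF p(1) True])
        next
          case False
          then have "?K (\<theta>, \<eta>) = 0" for \<eta> unfolding K by simp
          then show ?thesis by (simp only: integrable_zero)
        qed
      qed
      show "integrable lborel (\<lambda>\<theta>. LINT \<eta>|lborel. cmod (?K (\<theta>, \<eta>)))"
      proof (rule Bochner_Integration.integrable_bound)
        show "integrable lborel (\<lambda>\<theta>. ?m \<theta>)"
          by (intro integrable_mult_right integrable_powr_exp p c)
        show "(\<lambda>\<theta>. LINT \<eta>|lborel. cmod (?K (\<theta>, \<eta>))) \<in> borel_measurable lborel" using m by measurable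
        show "AE \<theta> in lborel. norm (LINT \<eta>|lborel. cmod (?K (\<theta>, \<eta>)))
           \<le> norm (?m \<theta>)"
        proof (rule AE_I2)
          fix \<theta> :: real
          show "norm (LINT \<eta>|lborel. cmod (?K (\<theta>, \<eta>)))
           \<le> norm (?m \<theta>)"
          proof (cases "\<theta> > 0")
            case True
            have "cmod (?K (\<theta>, \<eta>)) = cmod (B \<theta>) / \<theta>\<^sup>2 * (indicator {0<..<\<theta>} \<eta> * \<eta> powr p)" for \<eta>
              unfolding K using True by (simp add: norm_mult norm_divide norm_power)
            then have "(LINT \<eta>|lborel. cmod (?K (\<theta>, \<eta>))) = cmod (B \<theta>) / \<theta>\<^sup>2 * (\<theta> powr (p + 1) / (p + 1))"
              by (simp only: integral_mult_right_zero integral_powr_from_0(2)[OF p(1) True])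
            moreover have "\<theta> powr (p + 1) = \<theta>\<^sup>2 * \<theta> powr (p - 1)"
              using True powr_add[of \<theta> 2 "p - 1"] by (simp add: powr_numeral add.commute)
            ultimately have "(LINT \<eta>|lborel. cmod (?K (\<theta>, \<eta>))) = cmod (B \<theta>) * (\<theta> powr (p - 1) / (p + 1))"
              using True by (simp only: times_divide_times_eq times_divide_eq_right times_divide_eq_left) simp
            also have "\<dots> \<le> C / exp (c * \<theta>) * (\<theta> powr (p - 1) / (p + 1))"
              using B[OF True] p by (intro mult_right_mono) auto
            finally have le: "(LINT \<eta>|lborel. cmod (?K (\<theta>, \<eta>))) \<le> ?m \<theta>"
              using True by (simp add: mult_ac)
            have "0 \<le> (LINT \<eta>|lborel. cmod (?K (\<theta>, \<eta>)))" by simp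
            with le show ?thesis unfolding real_norm_def by linarith
          next
            case False
            then have "?K (\<theta>, \<eta>) = 0" for \<eta> unfolding K by simp
            then show ?thesis by (simp only: norm_zero integral_zero norm_ge_zero)
          qed
        qed
      qed
    qed
    have "(LINT \<eta>|lborel. of_real (indicator {0<..} \<eta> * \<eta> powr p) * heat_pairing v \<psi> (1 / \<eta>))
       = (LINT \<eta>|lborel. - (LINT \<theta>|lborel. ?K (\<theta>, \<eta>)))"
    proof (intro Bochner_Integration.integral_cong refl)
      fix \<eta> :: real
      show "of_real (indicator {0<..} \<eta> * \<eta> powr p) * heat_pairing v \<psi> (1 / \<eta>) = - (LINT \<theta>|lborel. ?K (\<theta>, \<eta>))"
      proof (cases "\<eta> > 0")
        case True
        show ?thesis
          unfolding heat_pairing_eq_integral_adjoint[OF v \<psi> True] P0[OF \<psi>] prod.case integral_mult_right_zero B_def by simp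
      qed simp
    qed
    also have "\<dots> = - (LINT \<eta>|lborel. LINT \<theta>|lborel. ?K (\<theta>, \<eta>))" by simp
    also have "(LINT \<eta>|lborel. LINT \<theta>|lborel. ?K (\<theta>, \<eta>)) = (LINT \<theta>|lborel. LINT \<eta>|lborel. ?K (\<theta>, \<eta>))"
      by (rule lborel_pair.Fubini_integral) (use Ki in simp)
    \<comment> \<open>The inner integral is \<theta> powr (p + 1) / (p + 1), and the factor 1 /
      \<theta>^2 lowers the exponent to p - 1 = s - 1 + k. What remains is the moment of order
      \<open>k\<close> for \<open>heat_adjoint \<psi>\<close>, to which the induction hypothesis
      applies.\<close>
    also have "\<dots> = (LINT \<theta>|lborel. of_real (1 / (p + 1)) * (of_real (indicator {0<..} \<theta> * \<theta> powr (s - 1 + real k)) * B \<theta>))"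
    proof (intro Bochner_Integration.integral_cong refl)
      fix \<theta> :: real
      show "(LINT \<eta>|lborel. ?K (\<theta>, \<eta>)) = of_real (1 / (p + 1)) * (of_real (indicator {0<..} \<theta> * \<theta> powr (s - 1 + real k)) * B \<theta>)"
      proof (cases "\<theta> > 0")
        case True
        have e: "\<theta> powr (p + 1) / (p + 1) = \<theta>\<^sup>2 * (\<theta> powr (s - 1 + real k) / (p + 1))"
          using True powr_add[of \<theta> 2 "p - 1"] by (simp add: powr_numeral p_def algebra_simps)
        have "(LINT \<eta>|lborel. complex_of_real (indicator {0<..<\<theta>} \<eta> * \<eta> powr p)) = of_real (\<theta>\<^sup>2 * (\<theta> powr (s - 1 + real k) / (p + 1)))"
          unfolding integral_complex_of_real integral_powr_from_0(2)[OF p(1) True] e ..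
        then have "(LINT \<eta>|lborel. ?K (\<theta>, \<eta>)) = of_real (indicator {0<..} \<theta> / \<theta>\<^sup>2) * B \<theta> * of_real (\<theta>\<^sup>2 * (\<theta> powr (s - 1 + real k) / (p + 1)))"
          unfolding K integral_mult_right_zero by (simp only:)
        then show ?thesis using True by simp
      next
        case False
        then have "?K (\<theta>, \<eta>) = 0" for \<eta> unfolding K by simp
        then have "(LINT \<eta>|lborel. ?K (\<theta>, \<eta>)) = 0" by (simp only: integral_zero)
        moreover have "indicator {0<..} \<theta> = (0 :: real)" using False by simp
        ultimately show ?thesis by (simp only: mult_zero_left mult_zero_right of_real_0)
      qed
    qed
    also have "\<dots> = 0"
      using Suc.IH[OF \<phi>] by (simp only: integral_mult_right_zero B_def mult_zero_right)
    finally show ?case by (simp only: p(2) minus_zero)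
  }
qed

section \<open>Moments, Laplace integrals and Fourier integrals of exponentially decaying
  functions\<close>

lemma exp_partial_sum_le:
  fixes x :: real
  assumes "x \<ge> 0" shows "(\<Sum>k<n. x ^ k / fact k) \<le> exp x"
  using assms sum_le_suminf[of "\<lambda>k. x ^ k / fact k" "{..<n}"] exp_converges[of x]
  by (auto simp: divide_inverse mult.commute sums_iff)

lemma power_le_fact_exp:
  fixes x :: real
  assumes "x \<ge> 0" shows "x ^ k / fact k \<le> exp x"
proof -
  have "x ^ k / fact k \<le> (\<Sum>j<Suc k. x ^ j / fact j)" using assms by (simp add: sum_nonneg)
  then show ?thesis using exp_partial_sum_le[OF assms, of "Suc k"] by linarith
qed

text \<open>The exponential series is integrated term by term, its partial sums being dominated by
  exp (c |X|) |f|. \<open>X\<close> is left general so that it can be the variable on the half-line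
  as well as a linear functional on space.\<close>

lemma integral_exp_power_series:
  fixes f :: "'a::euclidean_space \<Rightarrow> complex" and X :: "'a \<Rightarrow> real"
  assumes [measurable]: "f \<in> borel_measurable borel" "X \<in> borel_measurable borel"
    and i: "integrable lborel (\<lambda>z. exp (c * \<bar>X z\<bar>) * cmod (f z))" and w: "cmod w \<le> c"
  shows "(\<lambda>k. (LINT z|lborel. f z * of_real (X z) ^ k) / fact k * w ^ k) sums (LINT z|lborel. f z * exp (w * of_real (X z)))"
proof -
  have le: "(\<Sum>k<n. (cmod w * \<bar>X z\<bar>) ^ k / fact k) \<le> exp (c * \<bar>X z\<bar>)" for n z
  proof -
    have "(\<Sum>k<n. (cmod w * \<bar>X z\<bar>) ^ k / fact k) \<le> exp (cmod w * \<bar>X z\<bar>)"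
      by (rule exp_partial_sum_le) simp
    also have "\<dots> \<le> exp (c * \<bar>X z\<bar>)" using w by (simp add: mult_right_mono)
    finally show ?thesis .
  qed
  let ?t = "\<lambda>k z. f z * ((w * of_real (X z)) ^ k / fact k)"
  have tb: "cmod (?t k z) = cmod (f z) * ((cmod w * \<bar>X z\<bar>) ^ k / fact k)" for k z
    by (simp add: norm_mult norm_divide norm_power power_mult_distrib)
  have sb: "cmod (\<Sum>k<n. ?t k z) \<le> exp (c * \<bar>X z\<bar>) * cmod (f z)" for n z
  proof -
    have "cmod (\<Sum>k<n. ?t k z) \<le> (\<Sum>k<n. cmod (?t k z))" by (rule norm_sum)
    also have "\<dots> = cmod (f z) * (\<Sum>k<n. (cmod w * \<bar>X z\<bar>) ^ k / fact k)" unfolding tb sum_distrib_left ..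
    also have "\<dots> \<le> cmod (f z) * exp (c * \<bar>X z\<bar>)" using le by (rule mult_left_mono) simp
    finally show ?thesis by (simp add: mult.commute)
  qed
  have ti: "integrable lborel (?t k)" for k
  proof (rule Bochner_Integration.integrable_bound[OF i])
    have "(cmod w * \<bar>X z\<bar>) ^ k / fact k \<le> (\<Sum>k<Suc k. (cmod w * \<bar>X z\<bar>) ^ k / fact k)" for z
      by (simp add: sum_nonneg)
    then have "(cmod w * \<bar>X z\<bar>) ^ k / fact k \<le> exp (c * \<bar>X z\<bar>)" for z using le[of z "Suc k"] by (rule order_trans)
    then have "cmod (?t k z) \<le> cmod (f z) * exp (c * \<bar>X z\<bar>)" for z unfolding tb by (rule mult_left_mono) simp
    then show "AE z in lborel. cmod (?t k z) \<le> norm (exp (c * \<bar>X z\<bar>) * cmod (f z))"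
      by (simp add: mult.commute)
  qed measurable
  have "(\<lambda>n. LINT z|lborel. (\<Sum>k<n. ?t k z)) \<longlonglongrightarrow> (LINT z|lborel. f z * exp (w * of_real (X z)))"
  proof (rule integral_dominated_convergence)
    show "AE z in lborel. (\<lambda>n. \<Sum>k<n. ?t k z) \<longlonglongrightarrow> f z * exp (w * of_real (X z))"
    proof (rule AE_I2)
      fix z
      have "(\<lambda>k. (w * of_real (X z)) ^ k / fact k) sums exp (w * of_real (X z))"
        using exp_converges[of "w * of_real (X z)"] by (simp add: scaleR_conv_of_real divide_inverse mult.commute)
      from sums_mult[OF this, of "f z"] show "(\<lambda>n. \<Sum>k<n. ?t k z) \<longlonglongrightarrow> f z * exp (w * of_real (X z))"
        by (simp add: sums_def)
    qed
    show "AE z in lborel. cmod (\<Sum>k<n. ?t k z) \<le> exp (c * \<bar>X z\<bar>) * cmod (f z)" for n using sb by simp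
  qed (use i in measurable)
  moreover have "(LINT z|lborel. (\<Sum>k<n. ?t k z)) = (\<Sum>k<n. (LINT z|lborel. f z * of_real (X z) ^ k) / fact k * w ^ k)" for n
  proof -
    have "(LINT z|lborel. (\<Sum>k<n. ?t k z)) = (\<Sum>k<n. LINT z|lborel. ?t k z)"
      by (rule Bochner_Integration.integral_sum) (rule ti)
    also have "\<dots> = (\<Sum>k<n. (LINT z|lborel. f z * of_real (X z) ^ k) / fact k * w ^ k)"
    proof (rule sum.cong[OF refl])
      fix k
      have "?t k z = w ^ k / fact k * (f z * of_real (X z) ^ k)" for z by (simp add: power_mult_distrib)
      then show "(LINT z|lborel. ?t k z) = (LINT z|lborel. f z * of_real (X z) ^ k) / fact k * w ^ k"
        by (simp only: integral_mult_right_zero) simp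
    qed
    finally show ?thesis .
  qed
  ultimately show ?thesis by (simp add: sums_def)
qed

text \<open>The series in the moments is justified only for exponents of limited size, so the
  imaginary axis is covered in short steps. Multiplying \<open>f\<close> by a unimodular character
  does not affect the exponential weight, so every step has the same admissible length.\<close>

lemma moments_zero_imp_fourier_zero:
  fixes f :: "'a::euclidean_space \<Rightarrow> complex" and X :: "'a \<Rightarrow> real"
  assumes [measurable]: "f \<in> borel_measurable borel" "X \<in> borel_measurable borel" and c: "c > 0"
    and i: "integrable lborel (\<lambda>z. exp (c * \<bar>X z\<bar>) * cmod (f z))"
    and zero: "\<And>k. (LINT z|lborel. f z * of_real (X z) ^ k) = 0"
  shows "(LINT z|lborel. f z * exp (\<i> * of_real (a * X z))) = 0"
proof -
  \<comment> \<open>One half of the rate \<open>c\<close> absorbs the power of \<open>X\<close>, as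
    |X|^k is at most k! / d^k * exp (d |X|); the other half is left for the series.\<close>
  define d where "d = c / 2"
  have d: "d > 0" using c by (simp add: d_def)
  \<comment> \<open>All moments of the modulated function are carried along, not only its integral,
    since the next step expands in them.\<close>
  define S where "S a \<longleftrightarrow> (\<forall>k. (LINT z|lborel. f z * exp (\<i> * of_real (a * X z)) * of_real (X z) ^ k) = 0)" for a
  have step: "S (a + b)" if S: "S a" and b: "\<bar>b\<bar> \<le> d" for a b
    unfolding S_def
  proof
    fix k
    let ?f = "\<lambda>z. f z * exp (\<i> * of_real (a * X z)) * of_real (X z) ^ k"
    have "(\<lambda>j. (LINT z|lborel. ?f z * of_real (X z) ^ j) / fact j * (\<i> * of_real b) ^ j) sums (LINT z|lborel. ?f z * exp (\<i> * of_real b * of_real (X z)))"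
    proof (rule integral_exp_power_series)
      show "cmod (\<i> * of_real b) \<le> d" using b by (simp add: norm_mult)
      show "integrable lborel (\<lambda>z. exp (d * \<bar>X z\<bar>) * cmod (?f z))"
      proof (rule Bochner_Integration.integrable_bound[OF integrable_mult_right[OF i, of "fact k / d ^ k"]])
        show "AE z in lborel. norm (exp (d * \<bar>X z\<bar>) * cmod (?f z)) \<le> norm (fact k / d ^ k * (exp (c * \<bar>X z\<bar>) * cmod (f z)))"
        proof (rule AE_I2)
          fix z
          have "(d * \<bar>X z\<bar>) ^ k / fact k \<le> exp (d * \<bar>X z\<bar>)" using d by (intro power_le_fact_exp) simp
          then have "\<bar>X z\<bar> ^ k \<le> fact k / d ^ k * exp (d * \<bar>X z\<bar>)"
            using d by (simp add: power_mult_distrib field_simps)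
          then have "exp (d * \<bar>X z\<bar>) * (cmod (f z) * \<bar>X z\<bar> ^ k) \<le> exp (d * \<bar>X z\<bar>) * (cmod (f z) * (fact k / d ^ k * exp (d * \<bar>X z\<bar>)))"
            by (intro mult_left_mono) auto
          also have "\<dots> = fact k / d ^ k * ((exp (d * \<bar>X z\<bar>) * exp (d * \<bar>X z\<bar>)) * cmod (f z))" by (simp only: mult_ac)
          also have "exp (d * \<bar>X z\<bar>) * exp (d * \<bar>X z\<bar>) = exp (c * \<bar>X z\<bar>)" by (simp add: d_def flip: exp_add)
          finally have "exp (d * \<bar>X z\<bar>) * cmod (?f z) \<le> fact k / d ^ k * (exp (c * \<bar>X z\<bar>) * cmod (f z))"
            by (simp add: norm_mult norm_power)
          then show "norm (exp (d * \<bar>X z\<bar>) * cmod (?f z)) \<le> norm (fact k / d ^ k * (exp (c * \<bar>X z\<bar>) * cmod (f z)))"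
            unfolding real_norm_def by (intro order_trans[OF _ abs_ge_self]) (simp add: abs_mult)
        qed
      qed measurable
    qed measurable
    moreover have "(LINT z|lborel. ?f z * of_real (X z) ^ j) = 0" for j
    proof -
      have "?f z * of_real (X z) ^ j = f z * exp (\<i> * of_real (a * X z)) * of_real (X z) ^ (k + j)" for z
        by (simp add: power_add)
      then show ?thesis using S unfolding S_def by (simp only:)
    qed
    ultimately have "(\<lambda>j. 0) sums (LINT z|lborel. ?f z * exp (\<i> * of_real b * of_real (X z)))"
      by (simp only: div_0 mult_zero_left)
    then have "(LINT z|lborel. ?f z * exp (\<i> * of_real b * of_real (X z))) = 0"
      using sums_zero sums_unique2 by blast
    moreover have "?f z * exp (\<i> * of_real b * of_real (X z)) = f z * exp (\<i> * of_real ((a + b) * X z)) * of_real (X z) ^ k" for z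
      by (simp add: exp_add algebra_simps)
    ultimately show "(LINT z|lborel. f z * exp (\<i> * of_real ((a + b) * X z)) * of_real (X z) ^ k) = 0" by (simp only:)
  qed
  \<comment> \<open>The number of steps is taken as \<open>Suc m\<close> so that the division by it
    is sound also for a = 0.\<close>
  obtain m :: nat where m: "\<bar>a\<bar> / d \<le> real m" using real_arch_simple by blast
  define n where "n = Suc m"
  have n: "n > 0" "\<bar>a\<bar> / d \<le> real n" using m by (auto simp: n_def)
  define b where "b = a / real n"
  have b: "\<bar>b\<bar> \<le> d" using n d by (simp add: b_def field_simps)
  have "S (real m * b)" for m
  proof (induction m)
    case 0 then show ?case using zero by (simp add: S_def)
  next
    case (Suc m)
    from step[OF this b] show ?case by (simp add: algebra_simps)
  qed
  from this[of n] have "S a" using n by (simp add: b_def)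
  then show ?thesis unfolding S_def by (auto dest: spec[of _ 0])
qed

text \<open>Near 0 the Laplace integral is a power series whose coefficients are the moments over
  factorials. A series with value 0 at 0 and a nonzero coefficient has no further zeros close to 0,
  but this one vanishes at all small real arguments; so all moments vanish.\<close>

lemma laplace_zero_imp_fourier_zero:
  fixes f :: "'a::euclidean_space \<Rightarrow> complex" and X :: "'a \<Rightarrow> real"
  assumes [measurable]: "f \<in> borel_measurable borel" "X \<in> borel_measurable borel" and c: "c > 0"
    and i: "integrable lborel (\<lambda>z. exp (c * \<bar>X z\<bar>) * cmod (f z))"
    and e: "e > 0" and zero: "\<And>r. \<bar>r\<bar> < e \<Longrightarrow> (LINT z|lborel. f z * exp (of_real r * of_real (X z))) = 0"
  shows "(LINT z|lborel. f z * exp (\<i> * of_real (a * X z))) = 0"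
proof (rule moments_zero_imp_fourier_zero[OF assms(1-4)])
  fix k
  define A where "A k = (LINT z|lborel. f z * of_real (X z) ^ k) / fact k" for k
  define F where "F w = (LINT z|lborel. f z * exp (w * of_real (X z)))" for w
  have sums: "(\<lambda>k. A k * (w - 0) ^ k) sums F w" if "norm (w - 0) < c" for w
    using integral_exp_power_series[OF assms(1,2) i, of w] that by (simp add: A_def F_def)
  have F0: "F 0 = 0" using zero[of 0] e by (simp add: F_def)
  have "A k = 0"
  proof (cases "k = 0")
    case True
    then show ?thesis using F0 by (simp add: A_def F_def)
  next
    case False
    show ?thesis
    proof (rule ccontr)
      assume "A k \<noteq> 0"
      then obtain r where r: "0 < r" "\<And>z. z \<in> cball 0 r - {0} \<Longrightarrow> F z \<noteq> 0"
        using powser_0_nonzero[OF c sums F0] False by blast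
      define t where "t = min r e / 2"
      have "t > 0" "t \<le> r" "t < e" using r(1) e by (auto simp: t_def)
      then have "F (of_real t) \<noteq> 0" by (intro r(2)) auto
      then show False using zero[of t] \<open>t > 0\<close> \<open>t < e\<close> by (simp add: F_def)
    qed
  qed
  then show "(LINT z|lborel. f z * of_real (X z) ^ k) = 0" by (simp add: A_def)
qed

lemma AE_zero_imp_zero_on_open:
  fixes f :: "'a::euclidean_space \<Rightarrow> complex"
  assumes "open S" "continuous_on S f" "AE x in lborel. x \<in> S \<longrightarrow> f x = 0" "x \<in> S"
  shows "f x = 0"
proof (rule ccontr)
  assume "f x \<noteq> 0"
  let ?N = "S \<inter> f -` (- {0})"
  have op: "open ?N" by (rule continuous_open_preimage[OF assms(2,1)]) auto
  have "AE x in lborel. x \<notin> ?N" using assms(3) by eventually_elim auto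
  then have "?N \<in> null_sets lborel" using op by (subst (asm) AE_iff_null_sets[symmetric]) auto
  then have "negligible ?N" using op by (simp add: negligible_iff_null_sets null_sets_completion_iff)
  moreover have "x \<in> ?N" using assms(4) \<open>f x \<noteq> 0\<close> by simp
  ultimately show False using open_not_negligible[OF op] by blast
qed

text \<open>The pairing as a function of \<eta>, times \<eta> powr (s - 1), has vanishing moments
  and decays exponentially, so its Fourier transform is zero and it vanishes almost everywhere.
  Continuity in \<tau> removes the exceptional set.\<close>

lemma heat_pairing_zero:
  fixes u v \<psi> :: "real \<times> (real ^ 'n) \<Rightarrow> complex"
  assumes s: "0 < s" "s < 1" and uv: "has_fourier_L2 u v" and \<Omega>: "open \<Omega>"
    and u0: "AE z in lborel. z \<in> \<Omega> \<longrightarrow> u z = 0"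
    and W: "\<And>\<psi>. test_function \<Omega> \<psi> \<Longrightarrow> (LINT \<zeta>|lborel. heat_symbol \<zeta> powr of_real s * v \<zeta> * inv_fourier \<psi> \<zeta>) = 0"
    and \<psi>: "test_function \<Omega> \<psi>" and \<tau>: "\<tau> > 0"
  shows "heat_pairing v \<psi> \<tau> = 0"
proof -
  have v: "square_integrable v" using uv by (simp add: has_fourier_L2_def)
  note [measurable] = pairing_measurable[OF v \<psi>]
  define f where "f \<eta> = of_real (indicator {0<..} \<eta> * \<eta> powr (s - 1)) * heat_pairing v \<psi> (1 / \<eta>)" for \<eta>
  have [measurable]: "f \<in> borel_measurable borel" unfolding f_def[abs_def] by measurable
  obtain c C where c: "c > 0" "C \<ge> 0" and Cc: "\<And>\<tau>. \<tau> > 0 \<Longrightarrow> cmod (heat_pairing v \<psi> \<tau>) \<le> C * exp (- c / \<tau>)"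
    by (rule heat_pairing_decay[OF uv \<psi> \<Omega> u0], rule that, assumption+)
  \<comment> \<open>The weight exp (r \<eta>) uses up a part r of the decay rate \<open>c\<close>.
    The value r = c / 2 serves the moment argument, and r = 0 plain integrability.\<close>
  let ?m = "\<lambda>r \<eta>. C * (indicator {0<..} \<eta> * (\<eta> powr (s - 1) / exp ((c - r) * \<eta>)))"
  have fb: "exp (r * \<bar>\<eta>\<bar>) * cmod (f \<eta>) \<le> ?m r \<eta>" for r \<eta>
  proof (cases "\<eta> > 0")
    case True
    have "cmod (f \<eta>) \<le> \<eta> powr (s - 1) * (C * exp (- (c * \<eta>)))"
      using mult_left_mono[OF Cc[of "1 / \<eta>"], of "\<eta> powr (s - 1)"] True by (simp add: f_def norm_mult)
    then have "exp (r * \<bar>\<eta>\<bar>) * cmod (f \<eta>) \<le> exp (r * \<bar>\<eta>\<bar>) * (\<eta> powr (s - 1) * (C * exp (- (c * \<eta>))))"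
      by (rule mult_left_mono) simp
    also have "\<dots> = C * (\<eta> powr (s - 1) * (exp (r * \<eta>) * exp (- (c * \<eta>))))" using True by simp
    also have "exp (r * \<eta>) * exp (- (c * \<eta>)) = inverse (exp ((c - r) * \<eta>))"
      by (simp add: exp_minus[symmetric] exp_add[symmetric] algebra_simps)
    finally show ?thesis using True by (simp add: divide_inverse)
  qed (simp add: f_def)
  have int: "integrable lborel (\<lambda>\<eta>. exp (r * \<bar>\<eta>\<bar>) * cmod (f \<eta>))" if "r < c" for r
  proof (rule Bochner_Integration.integrable_bound)
    show "integrable lborel (\<lambda>\<eta>. ?m r \<eta>)"
      using that s by (intro integrable_mult_right integrable_powr_exp) auto
    show "AE \<eta> in lborel. norm (exp (r * \<bar>\<eta>\<bar>) * cmod (f \<eta>)) \<le> norm (?m r \<eta>)"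
    proof (rule AE_I2)
      fix \<eta> :: real
      have "0 \<le> exp (r * \<bar>\<eta>\<bar>) * cmod (f \<eta>)" by simp
      with fb[of r \<eta>] show "norm (exp (r * \<bar>\<eta>\<bar>) * cmod (f \<eta>)) \<le> norm (?m r \<eta>)"
        unfolding real_norm_def by linarith
    qed
  qed measurable
  have "(LINT \<eta>|lborel. f \<eta> * exp (\<i> * of_real (a * \<eta>))) = 0" for a
  proof (rule moments_zero_imp_fourier_zero[where c="c / 2"])
    show "(LINT \<eta>|lborel. f \<eta> * of_real \<eta> ^ k) = 0" for k
    proof -
      have "f \<eta> * of_real \<eta> ^ k = of_real (indicator {0<..} \<eta> * \<eta> powr (s - 1 + real k)) * heat_pairing v \<psi> (1 / \<eta>)" for \<eta>
        by (simp add: f_def indicator_def powr_add powr_realpow)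
      then show ?thesis using heat_moments_zero[OF s uv \<Omega> u0 W \<psi>, of k] by simp
    qed
  qed (use c int[of "c / 2"] in auto)
  then have "AE \<eta> in lborel. f \<eta> = 0"
    by (intro fourier_L1_unique integrable_norm_cancel[of lborel f])
       (use int[of 0] c in \<open>auto simp: mult.commute\<close>)
  then have "AE \<eta> in lborel. \<eta> \<in> {0<..} \<longrightarrow> heat_pairing v \<psi> (1 / \<eta>) = 0"
    by eventually_elim (auto simp: f_def)
  moreover have "continuous_on {0<..} (\<lambda>\<eta>. heat_pairing v \<psi> (1 / \<eta>))"
    by (rule continuous_on_compose2[OF heat_pairing_continuous[OF v \<psi>]]) (auto intro!: continuous_intros)
  ultimately have "heat_pairing v \<psi> (1 / (1 / \<tau>)) = 0"
    by (intro AE_zero_imp_zero_on_open[where S="{0<..}" and f="\<lambda>\<eta>. heat_pairing v \<psi> (1 / \<eta>)"]) (use \<tau> in auto)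
  then show ?thesis by simp
qed

subsection \<open>Unique continuation for the heat flow\<close>

text \<open>The Gaussian times an exponential of |y| is square integrable, and its product with the
  square integrable \<open>f\<close> is integrable.\<close>

lemma gauss_weight_integrable:
  fixes f :: "'a::euclidean_space \<Rightarrow> complex"
  assumes f: "square_integrable f" and a: "a > 0"
  shows "integrable lborel (\<lambda>y. exp (c * norm y) * cmod (f y * of_real (exp (- a * (norm y)\<^sup>2))))"
proof -
  let ?e = "\<lambda>y::'a. complex_of_real (exp (c * norm y) * exp (- a * (norm y)\<^sup>2))"
  have [measurable]: "f \<in> borel_measurable borel" using f by (simp add: square_integrable_def)
  have g: "integrable lborel (\<lambda>y::'a. exp (- a * (norm y)\<^sup>2))"
    using gauss_fourier(1)[OF a, of 0, THEN integrable_norm] by (simp add: norm_mult)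
  have "square_integrable (\<lambda>y::'a. ?e y)"
    unfolding square_integrable_def
  proof
    show "integrable lborel (\<lambda>y::'a. (cmod (?e y))\<^sup>2)"
    proof (rule Bochner_Integration.integrable_bound[OF integrable_mult_right[OF g, of "exp (c\<^sup>2 / a)"]])
      show "AE y::'a in lborel. norm ((cmod (?e y))\<^sup>2) \<le> norm (exp (c\<^sup>2 / a) * exp (- a * (norm y)\<^sup>2))"
      proof (rule AE_I2)
        fix y :: 'a
        \<comment> \<open>Completing the square: it shows that 2 (c |y| - a |y|^2) is at most c^2 /
          a - a |y|^2, which leaves an integrable Gaussian.\<close>
        have "0 \<le> (c - a * norm y)\<^sup>2 / a" using a by simp
        also have "\<dots> = c\<^sup>2 / a - 2 * c * norm y + a * (norm y)\<^sup>2" using a by (simp add: power2_eq_square field_simps)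
        finally have "2 * (c * norm y + - a * (norm y)\<^sup>2) \<le> c\<^sup>2 / a + - a * (norm y)\<^sup>2" by simp
        then have "exp (2 * (c * norm y + - a * (norm y)\<^sup>2)) \<le> exp (c\<^sup>2 / a + - a * (norm y)\<^sup>2)" by simp
        moreover have "(cmod (?e y))\<^sup>2 = exp (2 * (c * norm y + - a * (norm y)\<^sup>2))"
          by (simp only: norm_of_real exp_add[symmetric] abs_exp_cancel exp_double)
        moreover have "exp (c\<^sup>2 / a + - a * (norm y)\<^sup>2) = exp (c\<^sup>2 / a) * exp (- a * (norm y)\<^sup>2)" by (rule exp_add)
        ultimately show "norm ((cmod (?e y))\<^sup>2) \<le> norm (exp (c\<^sup>2 / a) * exp (- a * (norm y)\<^sup>2))"
          by (simp only: real_norm_def) (simp only: abs_mult abs_exp_cancel)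
      qed
    qed measurable
  qed measurable
  from square_integrable_mult(1)[OF f this]
  have "integrable lborel (\<lambda>y. cmod (f y * ?e y))" by (rule integrable_norm)
  moreover have "cmod (f y * ?e y) = exp (c * norm y) * cmod (f y * of_real (exp (- a * (norm y)\<^sup>2)))" for y
    by (simp only: norm_mult norm_of_real abs_mult abs_exp_cancel mult_ac)
  ultimately show ?thesis by (simp only:)
qed

lemma heat_kernel_shift:
  fixes x y :: "'a::euclidean_space"
  assumes "\<tau> > 0"
  shows "heat_kernel \<tau> (y - x) = exp (- (norm x)\<^sup>2 / (4 * \<tau>)) / sqrt (4 * pi * \<tau>) ^ DIM('a)
    * (exp (- (1 / (4 * \<tau>)) * (norm y)\<^sup>2) * exp ((x \<bullet> y) / (2 * \<tau>)))"
proof -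
  have "(norm (y - x))\<^sup>2 = (norm x)\<^sup>2 + (norm y)\<^sup>2 - 2 * (x \<bullet> y)"
    by (simp add: power2_norm_eq_inner inner_diff inner_commute)
  then have "- (norm (y - x))\<^sup>2 / (4 * \<tau>) = - (norm x)\<^sup>2 / (4 * \<tau>) + (- (1 / (4 * \<tau>)) * (norm y)\<^sup>2 + (x \<bullet> y) / (2 * \<tau>))"
    using assms by (simp add: diff_divide_distrib add_divide_distrib)
  then show ?thesis unfolding heat_kernel_def by (simp only: exp_add times_divide_eq_left)
qed

text \<open>
  Up to a nonvanishing factor the Gaussian average of \<open>f\<close> at \<open>x\<close> is the Laplace transform of
  a rapidly decreasing multiple of \<open>f\<close>, hence real analytic in \<open>x\<close>.
\<close>

lemma heat_semigroup_unique_continuation: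
  fixes f :: "'a::euclidean_space \<Rightarrow> complex"
  assumes f: "square_integrable f" and \<tau>: "\<tau> > 0" and U: "open U" "U \<noteq> {}"
    and zero: "AE x in lborel. x \<in> U \<longrightarrow> (LINT y|lborel. of_real (heat_kernel \<tau> y) * f (x + y)) = 0"
  shows "AE x in lborel. f x = 0"
proof -
  have [measurable]: "f \<in> borel_measurable borel" using f by (simp add: square_integrable_def)
  define F where "F y = f y * of_real (exp (- (1 / (4 * \<tau>)) * (norm y)\<^sup>2))" for y
  have [measurable]: "F \<in> borel_measurable borel" unfolding F_def[abs_def] by measurable
  define E where "E x = (LINT y|lborel. F y * of_real (exp ((x \<bullet> y) / (2 * \<tau>))))" for x
  have Fi: "integrable lborel (\<lambda>y. exp (c * norm y) * cmod (F y))" for c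
    unfolding F_def by (rule gauss_weight_integrable[OF f]) (use \<tau> in simp)
  have le: "\<bar>x \<bullet> y\<bar> / (2 * \<tau>) \<le> R / (2 * \<tau>) * norm y" if "norm x \<le> R" for x y :: 'a and R
  proof -
    have "\<bar>x \<bullet> y\<bar> \<le> norm x * norm y" by (rule Cauchy_Schwarz_ineq2)
    also have "\<dots> \<le> R * norm y" using that by (intro mult_right_mono) auto
    finally show ?thesis using \<tau> by (simp add: divide_right_mono)
  qed
  have avg: "(LINT y|lborel. of_real (heat_kernel \<tau> y) * f (x + y))
     = of_real (exp (- (norm x)\<^sup>2 / (4 * \<tau>)) / sqrt (4 * pi * \<tau>) ^ DIM('a)) * E x" for x
  proof -
    have "(LINT y|lborel. of_real (heat_kernel \<tau> y) * f (x + y)) = (LINT y|lborel. of_real (heat_kernel \<tau> ((x + y) - x)) * f (x + y))"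
      by simp
    also have "\<dots> = (LINT y|lborel. of_real (heat_kernel \<tau> (y - x)) * f y)"
      by (rule lborel_integral_translate[of "\<lambda>y. of_real (heat_kernel \<tau> (y - x)) * f y"]) measurable
    also have "\<dots> = (LINT y|lborel. of_real (exp (- (norm x)\<^sup>2 / (4 * \<tau>)) / sqrt (4 * pi * \<tau>) ^ DIM('a)) * (F y * of_real (exp ((x \<bullet> y) / (2 * \<tau>)))))"
      unfolding heat_kernel_shift[OF \<tau>] F_def of_real_mult by (simp only: mult_ac)
    finally show ?thesis unfolding integral_mult_right_zero E_def .
  qed
  have "exp (- (norm x)\<^sup>2 / (4 * \<tau>)) / sqrt (4 * pi * \<tau>) ^ DIM('a) \<noteq> 0" for x :: 'a
    using \<tau> by simp
  then have "AE x in lborel. x \<in> U \<longrightarrow> E x = 0"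
    using zero unfolding avg mult_eq_0_iff of_real_eq_0_iff by simp
  moreover have "continuous_on U E"
    unfolding continuous_on_sequentially
  proof (intro allI impI ballI)
    fix X :: "nat \<Rightarrow> 'a" and x assume "(\<forall>n. X n \<in> U) \<and> X \<longlonglongrightarrow> x"
    then have X: "X \<longlonglongrightarrow> x" by blast
    then obtain R where R: "\<And>n. norm (X n) \<le> R"
      using convergent_imp_Bseq[of X] unfolding convergent_def Bseq_def by blast
    show "(E \<circ> X) \<longlonglongrightarrow> E x"
      unfolding E_def comp_def
    proof (rule integral_dominated_convergence)
      show "integrable lborel (\<lambda>y. exp (R / (2 * \<tau>) * norm y) * cmod (F y))" by (rule Fi)
      show "AE y in lborel. (\<lambda>n. F y * of_real (exp ((X n \<bullet> y) / (2 * \<tau>)))) \<longlonglongrightarrow> F y * of_real (exp ((x \<bullet> y) / (2 * \<tau>)))"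
        using \<tau> by (intro AE_I2 tendsto_intros X) auto
      show "AE y in lborel. cmod (F y * of_real (exp ((X n \<bullet> y) / (2 * \<tau>)))) \<le> exp (R / (2 * \<tau>) * norm y) * cmod (F y)" for n
      proof (rule AE_I2)
        fix y :: 'a
        have "(X n \<bullet> y) / (2 * \<tau>) \<le> \<bar>X n \<bullet> y\<bar> / (2 * \<tau>)" using \<tau> by (intro divide_right_mono) auto
        then have "(X n \<bullet> y) / (2 * \<tau>) \<le> R / (2 * \<tau>) * norm y" using le[OF R[of n], of y] by linarith
        then have "cmod (F y) * exp ((X n \<bullet> y) / (2 * \<tau>)) \<le> cmod (F y) * exp (R / (2 * \<tau>) * norm y)"
          by (intro mult_left_mono) auto
        then show "cmod (F y * of_real (exp ((X n \<bullet> y) / (2 * \<tau>)))) \<le> exp (R / (2 * \<tau>) * norm y) * cmod (F y)"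
          by (simp only: norm_mult norm_of_real abs_exp_cancel mult.commute)
      qed
    qed measurable
  qed
  ultimately have E0: "E x = 0" if "x \<in> U" for x using AE_zero_imp_zero_on_open[OF U(1) _ _ that] by blast
  obtain x0 where x0: "x0 \<in> U" using U(2) by blast
  obtain \<rho> where \<rho>: "\<rho> > 0" "ball x0 \<rho> \<subseteq> U" using U(1) x0 open_contains_ball by blast
  \<comment> \<open>\<open>F\<close> recentred at \<open>x0\<close>: the value of \<open>E\<close>
    at \<open>x0 + (2 * \<tau> * r) *\<^sub>R \<omega>\<close> is the Laplace integral of
    \<open>H\<close> at r for the linear functional y \<mapsto> \<omega> \<bullet> y.\<close>
  define H where "H y = F y * of_real (exp ((x0 \<bullet> y) / (2 * \<tau>)))" for y
  have [measurable]: "H \<in> borel_measurable borel" unfolding H_def[abs_def] by measurable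
  have Hi: "integrable lborel (\<lambda>y. exp (c * norm y) * cmod (H y))" for c
  proof (rule Bochner_Integration.integrable_bound[OF Fi[of "c + norm x0 / (2 * \<tau>)"]])
    show "AE y in lborel. norm (exp (c * norm y) * cmod (H y)) \<le> norm (exp ((c + norm x0 / (2 * \<tau>)) * norm y) * cmod (F y))"
    proof (rule AE_I2)
      fix y :: 'a
      have "(x0 \<bullet> y) / (2 * \<tau>) \<le> \<bar>x0 \<bullet> y\<bar> / (2 * \<tau>)" using \<tau> by (intro divide_right_mono) auto
      then have "(x0 \<bullet> y) / (2 * \<tau>) \<le> norm x0 / (2 * \<tau>) * norm y" using le[of x0 "norm x0" y] by simp
      then have "exp (c * norm y) * exp ((x0 \<bullet> y) / (2 * \<tau>)) \<le> exp ((c + norm x0 / (2 * \<tau>)) * norm y)"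
        unfolding exp_add[symmetric] by (simp add: algebra_simps)
      then have "exp (c * norm y) * exp ((x0 \<bullet> y) / (2 * \<tau>)) * cmod (F y) \<le> exp ((c + norm x0 / (2 * \<tau>)) * norm y) * cmod (F y)"
        by (rule mult_right_mono) simp
      then show "norm (exp (c * norm y) * cmod (H y)) \<le> norm (exp ((c + norm x0 / (2 * \<tau>)) * norm y) * cmod (F y))"
        unfolding H_def by (simp only: norm_mult norm_of_real abs_exp_cancel real_norm_def abs_mult abs_norm_cancel mult_ac)
    qed
  qed measurable
  have fourier0: "(LINT y|lborel. exp (\<i> * of_real (y \<bullet> \<omega>)) * H y) = 0" for \<omega>
  proof -
    have "(LINT y|lborel. H y * exp (\<i> * of_real (1 * (\<omega> \<bullet> y)))) = 0"
    proof (rule laplace_zero_imp_fourier_zero[where c=1 and e="\<rho> / (2 * \<tau> * (1 + norm \<omega>))"])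
      show "\<rho> / (2 * \<tau> * (1 + norm \<omega>)) > 0" using \<rho> \<tau> by (auto intro!: divide_pos_pos mult_pos_pos add_pos_nonneg)
      show "integrable lborel (\<lambda>y. exp (1 * \<bar>\<omega> \<bullet> y\<bar>) * cmod (H y))"
      proof (rule Bochner_Integration.integrable_bound[OF Hi[of "norm \<omega>"]])
        show "AE y in lborel. norm (exp (1 * \<bar>\<omega> \<bullet> y\<bar>) * cmod (H y)) \<le> norm (exp (norm \<omega> * norm y) * cmod (H y))"
          using Cauchy_Schwarz_ineq2[of \<omega>] by (intro AE_I2) (auto simp: abs_mult intro!: mult_right_mono)
      qed measurable
      \<comment> \<open>For such r the point at distance 2 \<tau> |r| |\<omega>| from
        \<open>x0\<close> stays in the ball where \<open>E\<close> vanishes;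
        \<open>1 + norm \<omega>\<close> keeps the bound meaningful for \<omega> = 0.\<close>
      fix r :: real assume r: "\<bar>r\<bar> < \<rho> / (2 * \<tau> * (1 + norm \<omega>))"
      have "1 + norm \<omega> > 0" by (simp add: add_pos_nonneg)
      then have r': "2 * \<tau> * \<bar>r\<bar> * (1 + norm \<omega>) < \<rho>" using r \<tau> by (simp add: pos_less_divide_eq mult_ac)
      have "norm ((2 * \<tau> * r) *\<^sub>R \<omega>) = 2 * \<tau> * \<bar>r\<bar> * norm \<omega>" using \<tau> by (simp add: abs_mult)
      also have "\<dots> \<le> 2 * \<tau> * \<bar>r\<bar> * (1 + norm \<omega>)" using \<tau> by (intro mult_left_mono) auto
      finally have "x0 + (2 * \<tau> * r) *\<^sub>R \<omega> \<in> ball x0 \<rho>" using r' by (simp add: dist_norm)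
      then have "E (x0 + (2 * \<tau> * r) *\<^sub>R \<omega>) = 0" using E0 \<rho>(2) by blast
      moreover have "F y * of_real (exp (((x0 + (2 * \<tau> * r) *\<^sub>R \<omega>) \<bullet> y) / (2 * \<tau>))) = H y * exp (of_real r * of_real (\<omega> \<bullet> y))" for y
      proof -
        have "((x0 + (2 * \<tau> * r) *\<^sub>R \<omega>) \<bullet> y) / (2 * \<tau>) = (x0 \<bullet> y) / (2 * \<tau>) + r * (\<omega> \<bullet> y)"
          using \<tau> by (simp add: inner_add_left add_divide_distrib)
        then show ?thesis unfolding H_def by (simp add: exp_add exp_of_real[symmetric] mult.assoc)
      qed
      ultimately show "(LINT y|lborel. H y * exp (of_real r * of_real (\<omega> \<bullet> y))) = 0"
        unfolding E_def by simp
    qed auto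
    then show ?thesis by (simp add: inner_commute mult.commute)
  qed
  have "AE y in lborel. H y = 0"
  proof (rule fourier_L1_unique[OF _ fourier0])
    show "integrable lborel H" by (rule integrable_norm_cancel) (use Hi[of 0] in auto)
  qed
  then show ?thesis by eventually_elim (simp add: H_def F_def)
qed

lemma AE_lborel_translate:
  assumes "AE z in lborel. P z" and [measurable]: "Measurable.pred borel P"
  shows "AE z :: 'a::euclidean_space in lborel. P (w + z)"
proof -
  have "AE z in distr lborel borel ((+) w). P z" using assms(1) unfolding lborel_distr_plus[of w] .
  then show ?thesis by (subst (asm) AE_distr_iff) auto
qed

text \<open>By Fubini almost every time slice of \<open>w\<close> is square integrable in space and
  has vanishing average at almost every point of \<open>U\<close>. Unique continuation is applied
  slice by slice, and the slices are reassembled by measurability.\<close>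

lemma heat_average_zero_imp_zero:
  fixes w :: "real \<times> (real ^ 'n) \<Rightarrow> complex"
  assumes w: "square_integrable w" and \<tau>: "\<tau> > 0" and U: "open U" "U \<noteq> {}"
    and zero: "AE z in lborel. z \<in> I \<times> U \<longrightarrow> (LINT y|lborel. of_real (heat_kernel \<tau> y) * w (z + (0, y))) = 0"
    and [measurable]: "I \<in> sets borel"
  shows "AE z in lborel. fst z \<in> I \<longrightarrow> w z = 0"
proof -
  have [measurable]: "w \<in> borel_measurable borel" and w2: "integrable lborel (\<lambda>z. (cmod (w z))\<^sup>2)"
    using w by (auto simp: square_integrable_def)
  have [measurable]: "(\<lambda>x :: real ^ 'n. w (t, x)) \<in> borel_measurable borel" for t
    using measurable_compose[of "\<lambda>x. (t, x)" borel borel w] by (simp add: borel_prod[symmetric])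
  have "AE t in lborel. AE x in lborel. (t, x) \<in> I \<times> U \<longrightarrow> (LINT y|lborel. of_real (heat_kernel \<tau> y) * w ((t, x) + (0, y))) = 0"
    by (rule lborel_pair.AE_pair) (simp only: lborel_prod zero)
  moreover have "AE t in lborel. integrable lborel (\<lambda>x. (cmod (w (t, x)))\<^sup>2)"
    by (rule lborel_pair.AE_integrable_fst') (simp only: lborel_prod w2)
  ultimately have "AE t in lborel. AE x in lborel. fst (t, x) \<in> I \<longrightarrow> w (t, x) = 0"
  proof eventually_elim
    case (elim t)
    show ?case
    proof (cases "t \<in> I")
      case True
      have "AE x in lborel. w (t, x) = 0"
      proof (rule heat_semigroup_unique_continuation[OF _ \<tau> U])
        show "square_integrable (\<lambda>x. w (t, x))" using elim(2) by (simp add: square_integrable_def)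
        show "AE x in lborel. x \<in> U \<longrightarrow> (LINT y|lborel. of_real (heat_kernel \<tau> y) * w (t, x + y)) = 0"
          using elim(1) by eventually_elim (use True in simp)
      qed
      then show ?thesis by eventually_elim simp
    qed simp
  qed
  then have "AE z in lborel \<Otimes>\<^sub>M lborel. fst z \<in> I \<longrightarrow> w z = 0"
  proof (rule lborel_pair.AE_pair_measure[rotated])
    have [measurable]: "fst \<in> borel_measurable (borel :: (real \<times> (real ^ 'n)) measure)"
      by (intro borel_measurable_continuous_onI continuous_intros)
    show "{z \<in> space (lborel \<Otimes>\<^sub>M lborel). fst z \<in> I \<longrightarrow> w z = 0} \<in> sets (lborel \<Otimes>\<^sub>M lborel)"
      unfolding lborel_prod by measurable
  qed
  then show ?thesis by (simp only: lborel_prod)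
qed

text \<open>A change of variables moves the averaging from the test function to \<open>u\<close>,
  where it looks backward in time. The average is then orthogonal to all bumps, which tend to
  indicators of boxes, so it vanishes almost everywhere on \<open>\<Omega>\<close>.\<close>

lemma heat_pairing_zero_imp_heat_average_zero:
  fixes u v :: "real \<times> (real ^ 'n) \<Rightarrow> complex"
  assumes uv: "has_fourier_L2 u v" and \<tau>: "\<tau> > 0" and \<Omega>: "open \<Omega>"
    and zero: "\<And>\<psi>. test_function \<Omega> \<psi> \<Longrightarrow> heat_pairing v \<psi> \<tau> = 0"
  shows "AE z in lborel. z \<in> \<Omega> \<longrightarrow> (LINT y|lborel. of_real (heat_kernel \<tau> y) * u (z + (- \<tau>, y))) = 0"
proof -
  have u: "square_integrable u" using uv by (simp add: has_fourier_L2_def)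
  then have [measurable]: "u \<in> borel_measurable borel" by (simp add: square_integrable_def)
  define N where "N z = (LINT y|lborel. of_real (heat_kernel \<tau> y) * u (z + (- \<tau>, y)))" for z
  have prod: "integrable (lborel \<Otimes>\<^sub>M lborel) (\<lambda>(y, z). of_real (heat_kernel \<tau> y) * (\<psi> z * u (z + (- \<tau>, y))))"
    if "square_integrable \<psi>" for \<psi> :: "real \<times> (real ^ 'n) \<Rightarrow> complex"
    by (rule heat_pair_integrable[OF \<tau> _ _ translate_pairing_bound[OF that u]])
       (use that in \<open>auto simp: square_integrable_def\<close>)
  have N\<psi>: "(LINT y|lborel. of_real (heat_kernel \<tau> y) * (\<psi> z * u (z + (- \<tau>, y)))) = \<psi> z * N z" for \<psi> :: "real \<times> (real ^ 'n) \<Rightarrow> complex" and z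
    unfolding N_def integral_mult_right_zero[symmetric] by (simp only: mult.left_commute)
  have Ni: "integrable lborel (\<lambda>z. \<psi> z * N z)" if "square_integrable \<psi>" for \<psi>
    using lborel_pair.integrable_snd[OF prod[OF that]] by (simp only: N\<psi>)
  have N0: "(LINT z|lborel. \<psi> z * N z) = 0" if \<psi>: "test_function \<Omega> \<psi>" for \<psi>
  proof -
    note [measurable] = test_functionD(3)[OF \<psi>]
    let ?G = "\<lambda>y :: real ^ 'n. of_real (heat_kernel \<tau> y) * (LINT z|lborel. \<psi> z * u (z + (- \<tau>, y)))"
    have eq: "(LINT z|lborel. u z * \<psi> (z + (\<tau>, y))) = (LINT z|lborel. \<psi> z * u (z + (- \<tau>, - y)))" for y
    proof -
      have "(LINT z|lborel. \<psi> z * u (z + (- \<tau>, - y))) = (LINT z|lborel. \<psi> ((\<tau>, y) + z) * u (((\<tau>, y) + z) + (- \<tau>, - y)))"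
        by (rule lborel_integral_translate[symmetric]) measurable
      also have "\<dots> = (LINT z|lborel. u z * \<psi> (z + (\<tau>, y)))"
        by (intro Bochner_Integration.integral_cong refl) (simp add: add.commute[of "(\<tau>, y)"] add.assoc mult.commute zero_prod_def[symmetric])
      finally show ?thesis ..
    qed
    have p: "integrable (lborel \<Otimes>\<^sub>M lborel) (\<lambda>(y, z). of_real (heat_kernel \<tau> y) * (\<psi> z * u (z + (- \<tau>, y))))"
      by (rule prod[OF square_integrable_test_function[OF \<psi>]])
    have Gm: "?G \<in> borel_measurable borel"
      using lborel_pair.integrable_fst[OF p, THEN borel_measurable_integrable]
      by (simp only: integral_mult_right_zero measurable_lborel2)
    have "0 = (LINT y|lborel. of_real (heat_kernel \<tau> y) * (LINT z|lborel. u z * \<psi> (z + (\<tau>, y))))"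
      by (simp only: heat_pairing_eq[OF uv \<psi> \<tau>, symmetric] zero[OF \<psi>])
    \<comment> \<open>The translation by (\<tau>, y) has put the shift (- \<tau>, - y) on
      \<open>u\<close>. The heat kernel is even, so \<open>y\<close> may be reflected.\<close>
    also have "\<dots> = (LINT y|lborel. ?G (0 - y))" unfolding eq by (simp only: diff_0 heat_kernel_minus)
    also have "\<dots> = (LINT y|lborel. ?G y)" by (rule lborel_integral_reflect[OF Gm])
    also have "\<dots> = (LINT y|lborel. LINT z|lborel. of_real (heat_kernel \<tau> y) * (\<psi> z * u (z + (- \<tau>, y))))"
      by (simp only: integral_mult_right_zero)
    also have "\<dots> = (LINT z|lborel. LINT y|lborel. of_real (heat_kernel \<tau> y) * (\<psi> z * u (z + (- \<tau>, y))))"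
      by (rule lborel_pair.Fubini_integral[symmetric]) (rule p)
    finally show ?thesis by (simp only: N\<psi>)
  qed
  have "AE z in lborel. z \<in> \<Omega> \<longrightarrow> N z = 0"
  proof (rule AE_zero_on_open_if_box_integrals_zero[OF \<Omega>])
    fix a b :: "real \<times> (real ^ 'n)" assume ab: "cbox a b \<subseteq> \<Omega>"
    let ?b = "\<lambda>n z. complex_of_real (box_bump (real (Suc n)) a b z) * N z"
    have "square_integrable (\<lambda>z. indicator (box a b) z :: complex)"
    proof (rule square_integrable_if_bounded)
      have "integrable lborel (indicator (box a b) :: _ \<Rightarrow> real)" by (rule integrable_real_indicator) (auto simp: emeasure_lborel_box_eq)
      then show "integrable lborel (\<lambda>z. indicator (box a b) z :: complex)"
        by (rule Bochner_Integration.integrable_bound) (auto simp: indicator_def)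
      show "cmod (indicator (box a b) z) \<le> 1" for z :: "real \<times> (real ^ 'n)" by (simp add: indicator_def)
    qed
    then show i: "integrable lborel (\<lambda>z. indicator (box a b) z * N z)" by (rule Ni)
    have "(\<lambda>n. LINT z|lborel. ?b n z) \<longlonglongrightarrow> (LINT z|lborel. indicator (box a b) z * N z)"
    proof (rule integral_dominated_convergence)
      show "integrable lborel (\<lambda>z. cmod (indicator (box a b) z * N z))" using i by simp
      show "(\<lambda>z. indicator (box a b) z * N z) \<in> borel_measurable lborel" using i by auto
      show "(\<lambda>z. ?b n z) \<in> borel_measurable lborel" for n
        using Ni[OF square_integrable_test_function[OF test_function_box_bump[OF _ ab, of "real (Suc n)"]]] by auto
      show "AE z in lborel. (\<lambda>n. ?b n z) \<longlonglongrightarrow> indicator (box a b) z * N z"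
      proof (rule AE_I2)
        fix z
        have "(\<lambda>n. complex_of_real (box_bump (real (Suc n)) a b z)) \<longlonglongrightarrow> of_real (indicator (box a b) z)"
          by (intro tendsto_of_real box_bump_tendsto)
        moreover have "complex_of_real (indicator (box a b) z) = indicator (box a b) z" by (simp add: indicator_def)
        ultimately show "(\<lambda>n. ?b n z) \<longlonglongrightarrow> indicator (box a b) z * N z"
          by (intro tendsto_mult_right) (simp only:)
      qed
      show "AE z in lborel. cmod (?b n z) \<le> cmod (indicator (box a b) z * N z)" for n
      proof (rule AE_I2)
        fix z
        show "cmod (?b n z) \<le> cmod (indicator (box a b) z * N z)"
        proof (cases "z \<in> box a b")
          case True
          then show ?thesis using box_bump_bounds[of "real (Suc n)" a b z]
            by (simp add: norm_mult mult_left_le_one_le del: of_nat_Suc)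
        next
          case False
          then have "box_bump (real (Suc n)) a b z = 0" using box_bump_eq_0_iff[of "real (Suc n)" a b z] by simp
          then show ?thesis by (simp only: of_real_0 mult_zero_left norm_zero norm_ge_zero)
        qed
      qed
    qed
    moreover have "(LINT z|lborel. ?b n z) = 0" for n
      by (rule N0[OF test_function_box_bump[OF _ ab]]) simp
    ultimately show "(LINT z|lborel. indicator (box a b) z * N z) = 0"
      by (simp only: LIMSEQ_const_iff)
  qed
  then show ?thesis by (simp only: N_def)
qed

theorem theorem1p3:
  fixes s T :: real and U :: "(real ^ 'n) set" and u :: "real \<times> (real ^ 'n) \<Rightarrow> complex"
  assumes "0 < s" and "s < 1" and "0 < T"
    and "open U" and "U \<noteq> {}"
    and "u \<in> parabolic_sobolev s"
    and "AE z in lborel. z \<in> {-T<..<T} \<times> U \<longrightarrow> u z = 0"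
    and "dist_vanishes_on (frac_heat s u) ({-T<..<T} \<times> U)"
  shows "AE z in lborel. z \<in> {-T<..<T} \<times> (UNIV :: (real ^ 'n) set) \<longrightarrow> u z = 0"
proof -
  define v where "v = fourier_L2 u"
  have "\<exists>v. has_fourier_L2 u v" using assms(6) by (auto simp: parabolic_sobolev_def)
  \<comment> \<open>Membership in the Sobolev space supplies some transform, so the choice in
    \<open>fourier_L2\<close> returns a genuine one.\<close>
  then have uv: "has_fourier_L2 u v" unfolding v_def fourier_L2_def by (rule someI_ex)
  then have u: "square_integrable u" by (simp add: has_fourier_L2_def)
  then have [measurable]: "u \<in> borel_measurable borel" by (simp add: square_integrable_def)
  let ?I = "{-T<..<T}"
  have \<Omega>: "open (?I \<times> U)" using assms(4) by (intro open_Times) auto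
  have W: "(LINT \<zeta>|lborel. heat_symbol \<zeta> powr of_real s * v \<zeta> * inv_fourier \<psi> \<zeta>) = 0"
    if "test_function (?I \<times> U) \<psi>" for \<psi>
    using assms(8) that by (simp add: dist_vanishes_on_def frac_heat_def inv_fourier_dist_def dist_of_fun_def v_def)
  \<comment> \<open>The average at time t sees \<open>u\<close> at time t - \<tau>. So the slicewise
    lemma is applied to \<open>u\<close> shifted in time by \<tau>, and the result is translated
    back.\<close>
  have "AE z in lborel. fst z + \<tau> \<in> ?I \<longrightarrow> u z = 0" if \<tau>: "\<tau> > 0" for \<tau>
  proof -
    let ?w = "\<lambda>z. u (z + (- \<tau>, 0))"
    have "AE z in lborel. z \<in> ?I \<times> U \<longrightarrow> (LINT y|lborel. of_real (heat_kernel \<tau> y) * u (z + (- \<tau>, y))) = 0"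
      by (rule heat_pairing_zero_imp_heat_average_zero[OF uv \<tau> \<Omega>])
         (rule heat_pairing_zero[OF assms(1,2) uv \<Omega> assms(7) W _ \<tau>])
    moreover have "(z + (0, y)) + (- \<tau>, 0) = z + (- \<tau>, y)" for z :: "real \<times> (real ^ 'n)" and y
      by (simp add: add.assoc)
    ultimately have "AE z in lborel. z \<in> ?I \<times> U \<longrightarrow> (LINT y|lborel. of_real (heat_kernel \<tau> y) * ?w (z + (0, y))) = 0"
      by (simp only:)
    from heat_average_zero_imp_zero[OF square_integrable_translate(1)[OF u] \<tau> assms(4,5) this]
    have w0: "AE z in lborel. fst z \<in> ?I \<longrightarrow> ?w z = 0" by simp
    have [measurable]: "fst \<in> borel_measurable (borel :: (real \<times> (real ^ 'n)) measure)"
      by (intro borel_measurable_continuous_onI continuous_intros)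
    have "AE z in lborel. fst ((\<tau>, 0) + z) \<in> ?I \<longrightarrow> ?w ((\<tau>, 0) + z) = 0"
      by (rule AE_lborel_translate[OF w0]) measurable
    then show ?thesis
    proof eventually_elim
      case (elim z)
      have "((\<tau>, 0) + z) + (- \<tau>, 0) = z" by (cases z) simp
      moreover have "fst ((\<tau>, 0) + z) = fst z + \<tau>" by simp
      ultimately show ?case using elim by (simp only:)
    qed
  qed
  \<comment> \<open>Countably many shifts keep the exceptional set null. As they tend to 0, each
    time t < T admits one with t + \<tau> < T.\<close>
  then have "AE z in lborel. \<forall>m. fst z + inverse (real (Suc m)) \<in> ?I \<longrightarrow> u z = 0"
    unfolding AE_all_countable by simp
  then show ?thesis
  proof eventually_elim
    case (elim z)
    show ?case
    proof
      assume "z \<in> ?I \<times> UNIV"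
      then have z: "- T < fst z" "fst z < T" by auto
      then obtain m where m: "inverse (real (Suc m)) < T - fst z" using reals_Archimedean[of "T - fst z"] by auto
      moreover have "inverse (real (Suc m)) > 0" by simp
      ultimately have "fst z + inverse (real (Suc m)) \<in> ?I"
        unfolding greaterThanLessThan_iff using z by (intro conjI) linarith+
      then show "u z = 0" using elim by blast
    qed
  qed
qed

end
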